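(* The infimum of $I_2^{(2)}$ over $H^1_+\setminus\{0\}$ is attained and $$J_2^{(2)}=\min_{f\in H^1_+\setminus\{0\}}I_2^{(2)}(f)=\frac{8\pi^2}{3},$$ and the set of all minimizers is $$G_2^{(2)}=\left\{x\mapsto\frac{\lambda e^{i\theta}}{\mu x+y+i}\ :\ \lambda,\mu>0,\ \theta,y\in\mathbb{R}\right\}.$$
   Context: $L^2_+$ is the space of complex-valued $f\in L^2(\mathbb{R})$ whose Fourier transform $\hat f(\xi)=\int_{\mathbb{R}}e^{-ix\xi}f(x)\,\mathrm{d}x$ vanishes on $(-\infty,0)$, and $H^1_+=H^1(\mathbb{R})\cap L^2_+$. $|D|^{1/2}$ is the Fourier multiplier with symbol $|\xi|^{1/2}$. For $f\in H^1_+\setminus\{0\}$, $$I_2^{(2)}(f)=\frac{\|\partial_x f\|_{L^2}^2\|f\|_{L^2}^4+2\,\||D|^{1/2}f\|_{L^2}^4\|f\|_{L^2}^2}{\|f\|_{L^6}^6},$$ $J_2^{(2)}=\inf_{f\in H^1_+\setminus\{0\}}I_2^{(2)}(f)$ and $G_2^{(2)}=\{f\in H^1_+\setminus\{0\}:I_2^{(2)}(f)=J_2^{(2)}\}$. *)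

theory Defs
  imports "HOL-Analysis.Analysis"
begin

(* Elements of L^p(R) are represented by Borel functions; statements about them
   are understood modulo equality almost everywhere. *)

definition Lp_space :: "real \<Rightarrow> (real \<Rightarrow> complex) set" where
  "Lp_space p = {f \<in> borel_measurable lborel. integrable lborel (\<lambda>x. norm (f x) powr p)}"

definition Lp_norm :: "real \<Rightarrow> (real \<Rightarrow> complex) \<Rightarrow> real" where
  "Lp_norm p f = (LINT x|lborel. norm (f x) powr p) powr (1 / p)"

definition fourier_truncated :: "real \<Rightarrow> (real \<Rightarrow> complex) \<Rightarrow> real \<Rightarrow> complex" where
  "fourier_truncated R f \<xi> =
     (LINT x:{-R..R}|lborel. exp (- (\<i> * complex_of_real (x * \<xi>))) * f x)"

(* The Fourier transform on L^2 is the limit in L^2, as R tends to infinity, of the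
   integrals over [-R,R]; it is determined up to a null set. The squared L^2 distance
   is an extended nonnegative integral, so convergence to 0 is never an artefact of
   the convention that a non-integrable function has integral 0. *)
definition is_fourier_L2 :: "(real \<Rightarrow> complex) \<Rightarrow> (real \<Rightarrow> complex) \<Rightarrow> bool" where
  "is_fourier_L2 f g \<longleftrightarrow> g \<in> Lp_space 2 \<and>
     ((\<lambda>R. \<integral>\<^sup>+ \<xi>. ennreal ((norm (fourier_truncated R f \<xi> - g \<xi>))\<^sup>2) \<partial>lborel) \<longlongrightarrow> 0) at_top"

definition fourier_L2 :: "(real \<Rightarrow> complex) \<Rightarrow> (real \<Rightarrow> complex)" where
  "fourier_L2 f = (SOME g. is_fourier_L2 f g)"

definition fourier_multiplier :: "(real \<Rightarrow> complex) \<Rightarrow> (real \<Rightarrow> complex) \<Rightarrow> (real \<Rightarrow> complex)" where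
  "fourier_multiplier m f =
     (SOME g. g \<in> Lp_space 2 \<and> (AE \<xi> in lborel. fourier_L2 g \<xi> = m \<xi> * fourier_L2 f \<xi>))"

definition half_deriv :: "(real \<Rightarrow> complex) \<Rightarrow> (real \<Rightarrow> complex)" where
  "half_deriv = fourier_multiplier (\<lambda>\<xi>. complex_of_real (sqrt \<bar>\<xi>\<bar>))"

definition L2_plus :: "(real \<Rightarrow> complex) set" where
  "L2_plus = {f \<in> Lp_space 2. AE \<xi> in lborel. \<xi> < 0 \<longrightarrow> fourier_L2 f \<xi> = 0}"

(* Test functions are C^1 with compact support, as in Brezis' definition of W^{1,p}(R);
   by mollification this gives the same notion as smooth test functions. *)
definition test_function :: "(real \<Rightarrow> complex) \<Rightarrow> bool" where
  "test_function \<phi> \<longleftrightarrow> \<phi> C1_differentiable_on UNIV \<and> compact (closure {x. \<phi> x \<noteq> 0})"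

definition is_weak_deriv_L2 :: "(real \<Rightarrow> complex) \<Rightarrow> (real \<Rightarrow> complex) \<Rightarrow> bool" where
  "is_weak_deriv_L2 f g \<longleftrightarrow> g \<in> Lp_space 2 \<and>
     (\<forall>\<phi>. test_function \<phi> \<longrightarrow>
        (LINT x|lborel. f x * vector_derivative \<phi> (at x)) = - (LINT x|lborel. g x * \<phi> x))"

definition weak_deriv :: "(real \<Rightarrow> complex) \<Rightarrow> (real \<Rightarrow> complex)" where
  "weak_deriv f = (SOME g. is_weak_deriv_L2 f g)"

definition H1 :: "(real \<Rightarrow> complex) set" where
  "H1 = {f \<in> Lp_space 2. \<exists>g. is_weak_deriv_L2 f g}"

definition H1_plus :: "(real \<Rightarrow> complex) set" where
  "H1_plus = H1 \<inter> L2_plus"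

definition H1_plus_nonzero :: "(real \<Rightarrow> complex) set" where
  "H1_plus_nonzero = {f \<in> H1_plus. \<not> (AE x in lborel. f x = 0)}"

(* The Sobolev embedding of H^1(R) into L^6(R) makes the denominator finite, and
   nonzero for f not vanishing almost everywhere. *)
definition I22 :: "(real \<Rightarrow> complex) \<Rightarrow> real" where
  "I22 f = ((Lp_norm 2 (weak_deriv f))\<^sup>2 * Lp_norm 2 f ^ 4
            + 2 * Lp_norm 2 (half_deriv f) ^ 4 * (Lp_norm 2 f)\<^sup>2) / Lp_norm 6 f ^ 6"

definition J22 :: real where
  "J22 = (INF f\<in>H1_plus_nonzero. I22 f)"

definition G22 :: "(real \<Rightarrow> complex) set" where
  "G22 = {f \<in> H1_plus_nonzero. I22 f = J22}"

end

theory Submission imports Defs "HOL-Probability.Probability" begin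

text \<open>Write \<open>F\<close> for the Fourier transform of \<open>f\<close>, which lives on the positive half-line. The transform of
  \<open>f\<^sup>3\<close> at \<open>\<xi>\<close> is, up to a constant, the integral of \<open>F(\<xi> - s - t) F(s) F(t)\<close> over the triangle
  \<open>s, t > 0\<close>, \<open>s + t < \<xi>\<close> of area \<open>\<xi>\<^sup>2 / 2\<close>. Cauchy--Schwarz on each triangle, integration over \<open>\<xi>\<close> and the
  expansion of \<open>(a + b + c)\<^sup>2\<close> under \<open>|F(a)|\<^sup>2 |F(b)|\<^sup>2 |F(c)|\<^sup>2\<close> turn Plancherel's identity into the sharp
  bound. Equality forces \<open>F(a) F(b) F(c)\<close> to depend on \<open>a + b + c\<close> only, hence to annihilate
  \<open>(p'(a) q(c) - p(a) q'(c)) r(b)\<close> whenever \<open>p(0) = q(0) = 0\<close>; with \<open>p\<close> and \<open>q\<close> of the form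
  \<open>exp(-i a x) - 1\<close> this is an algebraic relation for \<open>f\<close> itself, whose only solutions are \<open>c / (x - \<beta>)\<close>.\<close>

section \<open>Square-integrable functions on the line\<close>

text \<open>Origin of \<open>8 * pi^2 / 3\<close>: the expansion has three squares and three doubled
  cross terms, so it equals three times
  \<open>moment 2 * (moment 0)^2 + 2 * (moment 1)^2 * moment 0\<close>. The coefficient 2 in the
  functional is thus exactly the one that the expansion produces. Inversion and Plancherel leave a
  factor \<open>(2 * pi)^2\<close>, the area of the triangle contributes 2, and the quotient is at
  least \<open>(2 * pi)^2 * 2 / 3\<close>. Two obstacles shape the development.
  \<open>fourier_L2\<close>, \<open>weak_deriv\<close> and \<open>half_deriv\<close> are Hilbert
  choices, so nothing can be computed with them before existence and uniqueness almost everywhere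
  are known; the L^2 transform is therefore built here, starting from Gaussian regularisation. In
  the equality case the factorisation holds only almost everywhere and \<open>F\<close> has no
  regularity, so it cannot be differentiated. The derivatives fall on the test functions
  \<open>p\<close> and \<open>q\<close> instead, and the resulting relation concerns
  \<open>FT F\<close>, where it holds at every point.\<close>

abbreviation L2 :: "(real \<Rightarrow> complex) set" where "L2 \<equiv> Lp_space 2"
abbreviation nrm :: "(real \<Rightarrow> complex) \<Rightarrow> real" where "nrm \<equiv> Lp_norm 2"

lemma L2_iff: "f \<in> L2 \<longleftrightarrow> f \<in> borel_measurable lborel \<and> integrable lborel (\<lambda>x. (norm (f x))\<^sup>2)"
  by (simp add: Lp_space_def)

lemma L2_measurable [measurable_dest]: "f \<in> L2 \<Longrightarrow> f \<in> borel_measurable borel"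
  by (simp add: L2_iff)

lemma L2_integrable_square: "f \<in> L2 \<Longrightarrow> integrable lborel (\<lambda>x. (norm (f x))\<^sup>2)"
  by (simp add: L2_iff)

lemma nrm_eq: "nrm f = sqrt (LINT x|lborel. (norm (f x))\<^sup>2)"
  by (simp add: Lp_norm_def powr_half_sqrt)

lemma nrm_nonneg [simp]: "0 \<le> nrm f"
  by (simp add: nrm_eq)

lemma nrm_square: "(nrm f)\<^sup>2 = (LINT x|lborel. (norm (f x))\<^sup>2)"
  by (simp add: nrm_eq)

lemma nn_integral_L2: "f \<in> L2 \<Longrightarrow> (\<integral>\<^sup>+x. ennreal ((norm (f x))\<^sup>2) \<partial>lborel) = ennreal ((nrm f)\<^sup>2)"
  by (simp add: nrm_square nn_integral_eq_integral L2_iff)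

lemma L2I_nn_integral:
  assumes [measurable]: "f \<in> borel_measurable borel"
    and "(\<integral>\<^sup>+x. ennreal ((norm (f x))\<^sup>2) \<partial>lborel) < \<infinity>"
  shows "f \<in> L2"
  using assms by (simp add: L2_iff integrable_iff_bounded)

lemma L2I_nn_integral_le:
  assumes [measurable]: "f \<in> borel_measurable borel" and "0 \<le> c"
    and le: "(\<integral>\<^sup>+x. ennreal ((norm (f x))\<^sup>2) \<partial>lborel) \<le> ennreal (c\<^sup>2)"
  shows "f \<in> L2" "nrm f \<le> c"
proof -
  show "f \<in> L2"
    using le by (intro L2I_nn_integral) (auto simp: top_unique less_top[symmetric])
  have "(nrm f)\<^sup>2 \<le> c\<^sup>2"
    using le by (simp only: nn_integral_L2[OF \<open>f \<in> L2\<close>] ennreal_le_iff zero_le_power2)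
  then show "nrm f \<le> c"
    using \<open>0 \<le> c\<close> by (rule power2_le_imp_le)
qed

lemma L2_dominated:
  assumes "g \<in> L2" and [measurable]: "f \<in> borel_measurable borel"
    and "\<And>x. norm (f x) \<le> c * norm (g x)"
  shows "f \<in> L2"
proof -
  have "integrable lborel (\<lambda>x. c\<^sup>2 * (norm (g x))\<^sup>2)"
    using assms by (simp add: L2_iff)
  then have "integrable lborel (\<lambda>x. (norm (f x))\<^sup>2)"
  proof (rule Bochner_Integration.integrable_bound)
    show "AE x in lborel. norm ((norm (f x))\<^sup>2) \<le> norm (c\<^sup>2 * (norm (g x))\<^sup>2)"
      using assms(3) by (auto simp flip: power_mult_distrib intro!: power_mono)
  qed simp
  then show ?thesis by (simp add: L2_iff)
qed

lemma L2_zero: "(\<lambda>_. 0) \<in> L2"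
  by (simp add: L2_iff)

lemma L2_add:
  assumes "f \<in> L2" "g \<in> L2" shows "(\<lambda>x. f x + g x) \<in> L2"
proof -
  note [measurable] = assms[THEN L2_measurable]
  have "integrable lborel (\<lambda>x. 2 * (norm (f x))\<^sup>2 + 2 * (norm (g x))\<^sup>2)"
    using assms by (simp add: L2_iff)
  then have "integrable lborel (\<lambda>x. (norm (f x + g x))\<^sup>2)"
  proof (rule Bochner_Integration.integrable_bound)
    have "(norm (f x + g x))\<^sup>2 \<le> 2 * (norm (f x))\<^sup>2 + 2 * (norm (g x))\<^sup>2" for x
    proof -
      have "(norm (f x + g x))\<^sup>2 \<le> (norm (f x) + norm (g x))\<^sup>2"
        by (intro power_mono norm_triangle_ineq) simp
      also have "\<dots> \<le> 2 * (norm (f x))\<^sup>2 + 2 * (norm (g x))\<^sup>2"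
        using sum_squares_bound[of "norm (f x)" "norm (g x)"] by (simp add: power2_sum)
      finally show ?thesis .
    qed
    then show "AE x in lborel. norm ((norm (f x + g x))\<^sup>2) \<le> norm (2 * (norm (f x))\<^sup>2 + 2 * (norm (g x))\<^sup>2)"
      by simp
  qed simp
  then show ?thesis by (simp add: L2_iff)
qed

lemma L2_cmult: "f \<in> L2 \<Longrightarrow> (\<lambda>x. c * f x) \<in> L2"
  by (rule L2_dominated[of f _ "norm c"]) (auto simp: norm_mult)

lemma L2_diff: "f \<in> L2 \<Longrightarrow> g \<in> L2 \<Longrightarrow> (\<lambda>x. f x - g x) \<in> L2"
  using L2_add[of f "\<lambda>x. - 1 * g x"] L2_cmult[of g "-1"] by simp

lemma L2_cnj: "f \<in> L2 \<Longrightarrow> (\<lambda>x. cnj (f x)) \<in> L2"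
  using borel_measurable_continuous_onI[of cnj] measurable_compose[of f borel borel cnj borel]
  by (simp add: L2_iff continuous_on_cnj continuous_on_id)

lemma L2_affine: "f \<in> L2 \<Longrightarrow> c \<noteq> 0 \<Longrightarrow> (\<lambda>x. f (t + c * x)) \<in> L2"
  using lborel_integrable_real_affine[of "\<lambda>x. (norm (f x))\<^sup>2" c t]
    measurable_compose[of "\<lambda>x. t + c * x" borel borel f borel] by (simp add: L2_iff)

lemma L2_reflect: "f \<in> L2 \<Longrightarrow> (\<lambda>x. f (- x)) \<in> L2"
  using L2_affine[of f "-1" 0] by simp

lemma L2_cong_AE:
  assumes "f \<in> L2" and [measurable]: "g \<in> borel_measurable borel" and "AE x in lborel. f x = g x"
  shows "g \<in> L2"
proof -
  note [measurable] = assms(1)[THEN L2_measurable]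
  have "integrable lborel (\<lambda>x. (norm (f x))\<^sup>2) \<longleftrightarrow> integrable lborel (\<lambda>x. (norm (g x))\<^sup>2)"
    using assms(3) by (intro integrable_cong_AE) auto
  then show ?thesis using assms by (simp add: L2_iff)
qed

lemma nrm_cong_AE:
  assumes [measurable]: "f \<in> borel_measurable borel" "g \<in> borel_measurable borel"
    and "AE x in lborel. f x = g x"
  shows "nrm f = nrm g"
proof -
  have "(LINT x|lborel. (norm (f x))\<^sup>2) = (LINT x|lborel. (norm (g x))\<^sup>2)"
    using assms(3) by (intro integral_cong_AE) auto
  then show ?thesis by (simp add: nrm_eq)
qed

lemma nrm_eq_0_iff:
  assumes "f \<in> L2" shows "nrm f = 0 \<longleftrightarrow> (AE x in lborel. f x = 0)"
  using integral_nonneg_eq_0_iff_AE[of lborel "\<lambda>x. (norm (f x))\<^sup>2"] assms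
  by (simp add: nrm_eq L2_iff)

lemma nrm_cmult: "nrm (\<lambda>x. c * f x) = norm c * nrm f"
  by (simp add: nrm_eq norm_mult power_mult_distrib real_sqrt_mult)

lemma nrm_cnj: "nrm (\<lambda>x. cnj (f x)) = nrm f"
  by (simp add: nrm_eq)

lemma nrm_minus_commute: "nrm (\<lambda>x. f x - g x) = nrm (\<lambda>x. g x - f x)"
  by (simp add: nrm_eq norm_minus_commute)

lemma nrm_affine: "c \<noteq> 0 \<Longrightarrow> (nrm f)\<^sup>2 = \<bar>c\<bar> * (nrm (\<lambda>x. f (t + c * x)))\<^sup>2"
  using lborel_integral_real_affine[of c "\<lambda>x. (norm (f x))\<^sup>2" t] by (simp add: nrm_square)

lemma nrm_translate: "nrm (\<lambda>x. f (x + t)) = nrm f"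
proof -
  have "(nrm f)\<^sup>2 = (nrm (\<lambda>x. f (x + t)))\<^sup>2"
    using nrm_affine[of 1 f t] by (simp add: add.commute)
  then show ?thesis using power2_eq_imp_eq by fastforce
qed

lemma nrm_reflect: "nrm (\<lambda>x. f (- x)) = nrm f"
  using nrm_affine[of "-1" f 0] power2_eq_imp_eq[of "nrm (\<lambda>x. f (- x))" "nrm f"] by simp

lemma L2_mult_integrable:
  assumes "f \<in> L2" "g \<in> L2" shows "integrable lborel (\<lambda>x. f x * g x)"
proof -
  note [measurable] = assms[THEN L2_measurable]
  have "integrable lborel (\<lambda>x. (norm (f x))\<^sup>2 + (norm (g x))\<^sup>2)"
    using assms by (simp add: L2_iff)
  then show ?thesis
  proof (rule Bochner_Integration.integrable_bound)
    have "norm (f x) * norm (g x) \<le> (norm (f x))\<^sup>2 + (norm (g x))\<^sup>2" for x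
      using sum_squares_bound[of "norm (f x)" "norm (g x)"]
        mult_nonneg_nonneg[OF norm_ge_zero norm_ge_zero, of "f x" "g x"] by linarith
    then show "AE x in lborel. norm (f x * g x) \<le> norm ((norm (f x))\<^sup>2 + (norm (g x))\<^sup>2)"
      by (simp add: norm_mult)
  qed simp
qed

lemma integral_norm_mult_le:
  assumes "f \<in> L2" "g \<in> L2" shows "(LINT x|lborel. norm (f x) * norm (g x)) \<le> nrm f * nrm g"
proof -
  note [measurable] = assms[THEN L2_measurable]
  have int: "integrable lborel (\<lambda>x. norm (f x) * norm (g x))"
    using integrable_norm[OF L2_mult_integrable[OF assms]] by (simp add: norm_mult)
  let ?I = "LINT x|lborel. norm (f x) * norm (g x)"
  have "ennreal (?I\<^sup>2) = (\<integral>\<^sup>+x. ennreal (norm (f x)) * ennreal (norm (g x)) \<partial>lborel)\<^sup>2"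
    by (simp add: nn_integral_eq_integral int ennreal_power flip: ennreal_mult)
  also have "\<dots> \<le> (\<integral>\<^sup>+x. ennreal (norm (f x)) ^ 2 \<partial>lborel) * (\<integral>\<^sup>+x. ennreal (norm (g x)) ^ 2 \<partial>lborel)"
    by (rule Cauchy_Schwarz_nn_integral) auto
  also have "\<dots> = ennreal ((nrm f * nrm g)\<^sup>2)"
    using assms by (simp add: ennreal_power nn_integral_L2 power_mult_distrib flip: ennreal_mult)
  finally have "?I\<^sup>2 \<le> (nrm f * nrm g)\<^sup>2"
    by (simp add: ennreal_le_iff)
  then show ?thesis
    by (rule power2_le_imp_le) simp
qed

lemma L2_Cauchy_Schwarz:
  assumes "f \<in> L2" "g \<in> L2" shows "norm (LINT x|lborel. f x * g x) \<le> nrm f * nrm g"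
proof -
  have "norm (LINT x|lborel. f x * g x) \<le> (LINT x|lborel. norm (f x) * norm (g x))"
    using integral_norm_bound[of lborel "\<lambda>x. f x * g x"] by (simp add: norm_mult)
  with integral_norm_mult_le[OF assms] show ?thesis by simp
qed

lemma nrm_triangle:
  assumes "f \<in> L2" "g \<in> L2" shows "nrm (\<lambda>x. f x + g x) \<le> nrm f + nrm g"
proof -
  note [measurable] = assms[THEN L2_measurable]
  have int: "integrable lborel (\<lambda>x. norm (f x) * norm (g x))"
    using integrable_norm[OF L2_mult_integrable[OF assms]] by (simp add: norm_mult)
  have "(nrm (\<lambda>x. f x + g x))\<^sup>2 = (LINT x|lborel. (norm (f x + g x))\<^sup>2)"
    by (rule nrm_square)
  also have "\<dots> \<le> (LINT x|lborel. (norm (f x))\<^sup>2 + 2 * (norm (f x) * norm (g x)) + (norm (g x))\<^sup>2)"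
  proof (intro integral_mono)
    show "integrable lborel (\<lambda>x. (norm (f x + g x))\<^sup>2)"
      using L2_add[OF assms] by (simp add: L2_iff)
    show "integrable lborel (\<lambda>x. (norm (f x))\<^sup>2 + 2 * (norm (f x) * norm (g x)) + (norm (g x))\<^sup>2)"
      using assms int by (simp add: L2_iff)
    show "(norm (f x + g x))\<^sup>2 \<le> (norm (f x))\<^sup>2 + 2 * (norm (f x) * norm (g x)) + (norm (g x))\<^sup>2" for x
      using power_mono[OF norm_triangle_ineq[of "f x" "g x"], of 2] by (simp add: power2_sum algebra_simps)
  qed
  also have "\<dots> = (nrm f)\<^sup>2 + 2 * (LINT x|lborel. norm (f x) * norm (g x)) + (nrm g)\<^sup>2"
    using assms int by (simp add: nrm_square L2_iff)
  also have "\<dots> \<le> (nrm f + nrm g)\<^sup>2"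
    using integral_norm_mult_le[OF assms] by (simp add: power2_sum)
  finally show ?thesis by (rule power2_le_imp_le) simp
qed

lemma nrm_triangle_diff:
  assumes "f \<in> L2" "g \<in> L2" "h \<in> L2"
  shows "nrm (\<lambda>x. f x - h x) \<le> nrm (\<lambda>x. f x - g x) + nrm (\<lambda>x. g x - h x)"
  using nrm_triangle[OF L2_diff[OF assms(1,2)] L2_diff[OF assms(2,3)]] by simp

lemma nrm_diff_ge:
  assumes "f \<in> L2" "g \<in> L2" shows "\<bar>nrm f - nrm g\<bar> \<le> nrm (\<lambda>x. f x - g x)"
  using nrm_triangle_diff[OF assms(1,2) L2_zero] nrm_triangle_diff[OF assms(2,1) L2_zero]
    nrm_minus_commute[of f g] by simp

lemma tendsto_nrm:
  assumes "\<And>n. f n \<in> L2" "g \<in> L2" "((\<lambda>n. nrm (\<lambda>x. f n x - g x)) \<longlongrightarrow> 0) F"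
  shows "((\<lambda>n. nrm (f n)) \<longlongrightarrow> nrm g) F"
proof (rule LIM_zero_cancel, rule Lim_null_comparison[OF _ assms(3)])
  show "\<forall>\<^sub>F n in F. norm (nrm (f n) - nrm g) \<le> nrm (\<lambda>x. f n x - g x)"
    using nrm_diff_ge[OF assms(1,2)] by simp
qed

section \<open>Cut-offs and completeness\<close>

lemma L2_cutoff:
  fixes a :: "nat \<Rightarrow> real \<Rightarrow> complex"
  assumes "f \<in> L2" and [measurable]: "\<And>n. a n \<in> borel_measurable borel"
    and bound: "\<And>n x. norm (a n x) \<le> 1" and lim: "\<And>x. (\<lambda>n. a n x) \<longlonglongrightarrow> 1"
  shows "(\<lambda>n. nrm (\<lambda>x. a n x * f x - f x)) \<longlonglongrightarrow> 0"
proof -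
  note [measurable] = assms(1)[THEN L2_measurable]
  have "(\<lambda>n. LINT x|lborel. (norm (a n x * f x - f x))\<^sup>2) \<longlonglongrightarrow> (LINT (x::real)|lborel. 0)"
  proof (rule integral_dominated_convergence[where w="\<lambda>x. (2 * norm (f x))\<^sup>2"])
    show "AE x in lborel. (\<lambda>n. (norm (a n x * f x - f x))\<^sup>2) \<longlonglongrightarrow> 0"
    proof (rule AE_I2)
      fix x
      have "(\<lambda>n. (norm (a n x * f x - f x))\<^sup>2) \<longlonglongrightarrow> (norm (1 * f x - f x))\<^sup>2"
        by (intro tendsto_intros lim)
      then show "(\<lambda>n. (norm (a n x * f x - f x))\<^sup>2) \<longlonglongrightarrow> 0" by simp
    qed
    show "AE x in lborel. norm ((norm (a n x * f x - f x))\<^sup>2) \<le> (2 * norm (f x))\<^sup>2" for n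
    proof (rule AE_I2)
      fix x
      have "norm (a n x * f x - f x) \<le> norm (a n x) * norm (f x) + norm (f x)"
        by (metis norm_mult norm_triangle_ineq4)
      also have "\<dots> \<le> 2 * norm (f x)"
        using mult_right_mono[OF bound[of n x], of "norm (f x)"] by simp
      finally have "(norm (a n x * f x - f x))\<^sup>2 \<le> (2 * norm (f x))\<^sup>2"
        by (intro power_mono) simp_all
      then show "norm ((norm (a n x * f x - f x))\<^sup>2) \<le> (2 * norm (f x))\<^sup>2"
        by simp
    qed
  qed (use assms in \<open>auto simp: L2_iff power_mult_distrib\<close>)
  from tendsto_real_sqrt[OF this] show ?thesis by (simp add: nrm_eq)
qed

lemma L2_truncate:
  assumes "f \<in> L2" "\<And>n. A n \<in> sets borel" "\<And>x. eventually (\<lambda>n. x \<in> A n) sequentially"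
  shows "(\<lambda>n. nrm (\<lambda>x. indicator (A n) x * f x - f x)) \<longlonglongrightarrow> 0"
proof (rule L2_cutoff[OF assms(1)])
  show "(\<lambda>n. indicator (A n) x :: complex) \<longlonglongrightarrow> 1" for x
    by (rule tendsto_eventually, rule eventually_mono[OF assms(3)[of x]]) simp
qed (use assms(2) in \<open>auto split: split_indicator\<close>)

lemma L2_indicator: "f \<in> L2 \<Longrightarrow> A \<in> sets borel \<Longrightarrow> (\<lambda>x. indicator A x * f x) \<in> L2"
  by (rule L2_dominated[of f _ 1]) (auto simp: norm_mult indicator_def)

text \<open>Riesz-Fischer: a fast subsequence converges almost everywhere, and Fatou's lemma carries
  the Cauchy estimate over to its limit. This produces the transform of a general square-integrable
  function.\<close>

lemma L2_complete:
  assumes f: "\<And>n. f n \<in> L2"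
    and cauchy: "\<And>e. 0 < e \<Longrightarrow> \<exists>N. \<forall>m\<ge>N. \<forall>n\<ge>N. nrm (\<lambda>x. f m x - f n x) \<le> e"
  obtains g where "g \<in> L2" "(\<lambda>n. nrm (\<lambda>x. f n x - g x)) \<longlonglongrightarrow> 0"
proof -
  note [measurable] = f[THEN L2_measurable]
  have "\<exists>N. \<forall>k. \<forall>m\<ge>N k. \<forall>n\<ge>N k. nrm (\<lambda>x. f m x - f n x) \<le> (1/4) ^ k"
    using cauchy by (intro choice allI) simp
  then obtain N where N: "\<And>k m n. m \<ge> N k \<Longrightarrow> n \<ge> N k \<Longrightarrow> nrm (\<lambda>x. f m x - f n x) \<le> (1/4) ^ k"
    by blast
  \<comment> \<open>The maximum over earlier indices puts both \<open>r k\<close> and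
    \<open>r (Suc k)\<close> beyond \<open>N k\<close>; the summand \<open>k\<close> makes
    \<open>r\<close> unbounded, which the Fatou argument uses.\<close>
  define r where "r k = k + Max (N ` {..k})" for k
  have rN: "N k \<le> r k" "N k \<le> r (Suc k)" for k
  proof -
    have "N k \<le> Max (N ` {..k})" "N k \<le> Max (N ` {..Suc k})" by (auto intro!: Max_ge)
    then show "N k \<le> r k" "N k \<le> r (Suc k)" unfolding r_def by linarith+
  qed
  have rk: "k \<le> r k" for k by (simp add: r_def)
  let ?d = "\<lambda>k x. norm (f (r (Suc k)) x - f (r k) x)"
  \<comment> \<open>The weight \<open>4 ^ k\<close> is affordable because the squared increments
    integrate to at most \<open>(1/16) ^ k\<close>. Where \<open>?T x\<close> is finite, the
    increments are bounded by a multiple of \<open>(1/2) ^ k\<close>, hence summable.\<close>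
  let ?T = "\<lambda>x. \<Sum>k. ennreal (4 ^ k * (?d k x)\<^sup>2)"
  have "(\<integral>\<^sup>+x. ?T x \<partial>lborel) = (\<Sum>k. \<integral>\<^sup>+x. ennreal (4 ^ k * (?d k x)\<^sup>2) \<partial>lborel)"
    by (rule nn_integral_suminf) simp
  also have "\<dots> \<le> (\<Sum>k. ennreal ((1/4)^k))"
  proof (intro suminf_le summableI)
    fix k
    have d: "(\<lambda>x. f (r (Suc k)) x - f (r k) x) \<in> L2"
      by (intro L2_diff f)
    have "(\<integral>\<^sup>+x. ennreal (4 ^ k * (?d k x)\<^sup>2) \<partial>lborel) = ennreal (4 ^ k) * (\<integral>\<^sup>+x. ennreal ((?d k x)\<^sup>2) \<partial>lborel)"
      by (subst nn_integral_cmult[symmetric]) (auto simp flip: ennreal_mult)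
    also have "\<dots> = ennreal (4 ^ k * (nrm (\<lambda>x. f (r (Suc k)) x - f (r k) x))\<^sup>2)"
      by (simp only: nn_integral_L2[OF d]) (simp add: ennreal_mult)
    also have "\<dots> \<le> ennreal (4 ^ k * ((1/4)^k)\<^sup>2)"
      using N[OF rN(2) rN(1), of k] by (intro ennreal_leI mult_left_mono power_mono) auto
    also have "4 ^ k * ((1/4)^k)\<^sup>2 = ((1/4)^k :: real)"
      by (simp add: power2_eq_square power_divide)
    finally show "(\<integral>\<^sup>+x. ennreal (4 ^ k * (?d k x)\<^sup>2) \<partial>lborel) \<le> ennreal ((1/4)^k)" .
  qed
  also have "\<dots> = ennreal (\<Sum>k. (1/4)^k)"
    by (rule suminf_ennreal2) (auto intro: summable_geometric)
  finally have "(\<integral>\<^sup>+x. ?T x \<partial>lborel) \<noteq> \<infinity>"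
    by (auto simp: top_unique)
  then have "AE x in lborel. ?T x \<noteq> \<infinity>"
    by (intro nn_integral_PInf_AE) auto
  then have conv: "AE x in lborel. convergent (\<lambda>k. f (r k) x)"
  proof eventually_elim
    fix x assume T: "?T x \<noteq> \<infinity>"
    have summ: "summable (\<lambda>k. 4 ^ k * (?d k x)\<^sup>2)"
      using T by (intro summable_suminf_not_top) auto
    then have "Bseq (\<lambda>k. 4 ^ k * (?d k x)\<^sup>2)"
      using convergent_imp_Bseq convergentI summable_LIMSEQ_zero by blast
    then obtain K where K: "0 < K" "\<And>k. 4 ^ k * (?d k x)\<^sup>2 \<le> K"
      by (auto simp: Bseq_def norm_mult)
    have "?d k x \<le> sqrt K * (1/2) ^ k" for k
    proof (rule power2_le_imp_le)
      have "((1/2)^k)\<^sup>2 = ((1/2)\<^sup>2 :: real) ^ k"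
        by (simp only: power_mult[symmetric] mult.commute)
      then have "(sqrt K * (1/2)^k)\<^sup>2 = K / 4 ^ k"
        using K(1) by (simp add: power_mult_distrib power_divide)
      moreover have "(?d k x)\<^sup>2 \<le> K / 4 ^ k"
        using K(2)[of k] by (simp add: pos_le_divide_eq mult.commute)
      ultimately show "(?d k x)\<^sup>2 \<le> (sqrt K * (1/2)^k)\<^sup>2" by linarith
    qed (use K in simp)
    moreover have "summable (\<lambda>k. sqrt K * (1/2::real)^k)"
      by (intro summable_mult summable_geometric) simp
    ultimately have "summable (\<lambda>k. f (r (Suc k)) x - f (r k) x)"
      by (rule summable_comparison_test'[where N=0, rotated])
    then have "convergent (\<lambda>n. \<Sum>k<n. f (r (Suc k)) x - f (r k) x)"
      by (simp add: summable_iff_convergent)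
    then have "convergent (\<lambda>n. f (r n) x - f (r 0) x)"
      by (simp only: sum_lessThan_telescope[of "\<lambda>k. f (r k) x"])
    from convergent_add[OF this convergent_const[of "f (r 0) x"]]
    show "convergent (\<lambda>k. f (r k) x)"
      by simp
  qed
  define g where "g x = lim (\<lambda>k. f (r k) x)" for x
  have [measurable]: "g \<in> borel_measurable borel"
    unfolding g_def by measurable
  have lim: "AE x in lborel. (\<lambda>k. f (r k) x) \<longlonglongrightarrow> g x"
    using conv by eventually_elim (auto simp: g_def convergent_LIMSEQ_iff)
  \<comment> \<open>Fatou along the subsequence, with \<open>n\<close> kept fixed, controls every
    late member of the original sequence and not only those selected by \<open>r\<close>.\<close>
  have near: "(\<lambda>x. f n x - g x) \<in> L2 \<and> nrm (\<lambda>x. f n x - g x) \<le> (1/4) ^ k" if "n \<ge> N k" for n k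
  proof -
    have "(\<integral>\<^sup>+x. ennreal ((norm (f n x - g x))\<^sup>2) \<partial>lborel)
        = (\<integral>\<^sup>+x. liminf (\<lambda>j. ennreal ((norm (f n x - f (r j) x))\<^sup>2)) \<partial>lborel)"
    proof (rule nn_integral_cong_AE)
      show "AE x in lborel. ennreal ((norm (f n x - g x))\<^sup>2) = liminf (\<lambda>j. ennreal ((norm (f n x - f (r j) x))\<^sup>2))"
        using lim
      proof eventually_elim
        fix x assume "(\<lambda>k. f (r k) x) \<longlonglongrightarrow> g x"
        then have "(\<lambda>j. ennreal ((norm (f n x - f (r j) x))\<^sup>2)) \<longlonglongrightarrow> ennreal ((norm (f n x - g x))\<^sup>2)"
          by (intro tendsto_intros)
        then show "ennreal ((norm (f n x - g x))\<^sup>2) = liminf (\<lambda>j. ennreal ((norm (f n x - f (r j) x))\<^sup>2))"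
          by (rule lim_imp_Liminf[OF sequentially_bot, symmetric])
      qed
    qed
    also have "\<dots> \<le> liminf (\<lambda>j. \<integral>\<^sup>+x. ennreal ((norm (f n x - f (r j) x))\<^sup>2) \<partial>lborel)"
      by (rule nn_integral_liminf) measurable
    also have "\<dots> \<le> ennreal (((1/4) ^ k)\<^sup>2)"
    proof (rule Liminf_le)
      show "\<forall>\<^sub>F j in sequentially. (\<integral>\<^sup>+x. ennreal ((norm (f n x - f (r j) x))\<^sup>2) \<partial>lborel) \<le> ennreal (((1/4) ^ k)\<^sup>2)"
        unfolding eventually_sequentially
      proof (intro exI allI impI)
        fix j assume "N k \<le> j"
        then have "N k \<le> r j" using rk[of j] by linarith
        then have "(nrm (\<lambda>x. f n x - f (r j) x))\<^sup>2 \<le> ((1/4) ^ k)\<^sup>2"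
          using N[OF that, of "r j"] by (intro power_mono) simp_all
        then show "(\<integral>\<^sup>+x. ennreal ((norm (f n x - f (r j) x))\<^sup>2) \<partial>lborel) \<le> ennreal (((1/4) ^ k)\<^sup>2)"
          by (simp only: nn_integral_L2[OF L2_diff[OF f f]] ennreal_leI)
      qed
    qed simp
    finally show ?thesis
      using L2I_nn_integral_le[of "\<lambda>x. f n x - g x" "(1/4)^k"] by simp
  qed
  have "g \<in> L2"
    using L2_diff[OF f[of "N 0"] conjunct1[OF near[of 0 "N 0"]]] by simp
  moreover have "(\<lambda>n. nrm (\<lambda>x. f n x - g x)) \<longlonglongrightarrow> 0"
  proof (rule LIMSEQ_I)
    fix e :: real assume "0 < e"
    then obtain k where k: "(1/4::real) ^ k < e"
      using real_arch_pow_inv[of e "1/4"] by auto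
    show "\<exists>no. \<forall>n\<ge>no. norm (nrm (\<lambda>x. f n x - g x) - 0) < e"
      using near k by (intro exI[of _ "N k"]) fastforce
  qed
  ultimately show thesis by (rule that)
qed

section \<open>Continuity of translation\<close>

lemma borel_measurable_cnj [measurable]: "cnj \<in> borel_measurable borel"
  by (intro borel_measurable_continuous_onI continuous_intros)

lemma integrable_translate:
  fixes f :: "real \<Rightarrow> 'a :: {banach, second_countable_topology}"
  shows "integrable lborel f \<Longrightarrow> integrable lborel (\<lambda>x. f (x + t))"
  using lborel_integrable_real_affine[of f 1 t] by (simp add: add.commute)

lemma integral_translate:
  fixes f :: "real \<Rightarrow> 'a :: {banach, second_countable_topology}"
  shows "(LINT x|lborel. f (x + t)) = (LINT x|lborel. f x)"
  using lborel_integral_real_affine[of 1 f t] by (simp add: add.commute)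

lemma integral_reflect:
  fixes f :: "real \<Rightarrow> 'a :: {banach, second_countable_topology}"
  shows "(LINT x|lborel. f (- x)) = (LINT x|lborel. f x)"
  using lborel_integral_real_affine[of "-1" f 0] by simp

text \<open>Translation preserves measure, so the mass that \<open>U\<close> loses equals the mass
  it gains, and the integral is twice the lost part. That part is dominated by
  \<open>indicator U\<close> and tends to 0 pointwise because a point of the open set
  \<open>U\<close> stays in \<open>U\<close> under small shifts.\<close>

lemma indicator_open_translation:
  fixes U :: "real set"
  assumes "open U" "emeasure lborel U < \<infinity>" "u \<longlonglongrightarrow> 0"
  shows "(\<lambda>n. LINT x|lborel. \<bar>indicator U (x + u n) - indicator U x :: real\<bar>) \<longlonglongrightarrow> 0"
proof -
  have [measurable]: "U \<in> sets borel" using assms by auto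
  have int: "integrable lborel (indicator U :: real \<Rightarrow> real)"
    using assms by (intro integrable_real_indicator) auto
  note intt = integrable_translate[OF int]
  have "(\<lambda>n. LINT x|lborel. 2 * max 0 (indicator U x - indicator U (x + u n) :: real)) \<longlonglongrightarrow> (LINT (x::real)|lborel. 0)"
  proof (rule integral_dominated_convergence[where w="\<lambda>x. 2 * indicator U x"])
    show "AE x in lborel. (\<lambda>n. 2 * max 0 (indicator U x - indicator U (x + u n) :: real)) \<longlonglongrightarrow> 0"
    proof (rule AE_I2)
      fix x :: real
      show "(\<lambda>n. 2 * max 0 (indicator U x - indicator U (x + u n) :: real)) \<longlonglongrightarrow> 0"
      proof (cases "x \<in> U")
        case True
        have "(\<lambda>n. x + u n) \<longlonglongrightarrow> x"
          using tendsto_add[OF tendsto_const[of x] assms(3)] by simp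
        then have "eventually (\<lambda>n. x + u n \<in> U) sequentially"
          using True assms(1) by (simp add: topological_tendstoD)
        then show ?thesis
          by (intro tendsto_eventually) (auto elim!: eventually_mono)
      qed simp
    qed
  next
    show "integrable lborel (\<lambda>x. 2 * indicator U x :: real)"
      using int by simp
  qed (auto split: split_indicator)
  moreover have "(LINT x|lborel. \<bar>indicator U (x + t) - indicator U x :: real\<bar>)
      = (LINT x|lborel. 2 * max 0 (indicator U x - indicator U (x + t) :: real))" for t
  proof -
    have "(LINT x|lborel. \<bar>indicator U (x + t) - indicator U x :: real\<bar>)
      = (LINT x|lborel. 2 * max 0 (indicator U x - indicator U (x + t)) + (indicator U (x + t) - indicator U x :: real))"
      by (intro Bochner_Integration.integral_cong) (auto simp: indicator_def)
    also have "\<dots> = (LINT x|lborel. 2 * max 0 (indicator U x - indicator U (x + t) :: real))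
        + ((LINT x|lborel. indicator U (x + t)) - (LINT x|lborel. indicator U x))"
      using int intt[of t] by (subst Bochner_Integration.integral_add) auto
    finally show ?thesis
      using integral_translate[of "indicator U :: real \<Rightarrow> real" t] by simp
  qed
  ultimately show ?thesis by simp
qed

text \<open>Outer regularity supplies an open \<open>U\<close> around \<open>A\<close>; replacing
  \<open>A\<close> by \<open>U\<close> costs the measure of \<open>U - A\<close> twice, once for the
  shifted set and once for the original.\<close>

lemma indicator_translation:
  fixes A :: "real set"
  assumes A: "A \<in> sets borel" "emeasure lborel A < \<infinity>" and u: "u \<longlonglongrightarrow> 0"
  shows "(\<lambda>n. LINT x|lborel. \<bar>indicator A (x + u n) - indicator A x :: real\<bar>) \<longlonglongrightarrow> 0"
proof (rule LIMSEQ_I)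
  fix e :: real assume "0 < e"
  obtain U where U: "open U" "A \<subseteq> U" "emeasure lborel (U - A) < ennreal (e/4)"
    using outer_regular_lborel[OF A(1), of "e/4"] \<open>0 < e\<close> by auto
  note [measurable] = A(1)
  have [measurable]: "U \<in> sets borel" using U by auto
  have "emeasure lborel U = emeasure lborel A + emeasure lborel (U - A)"
    using U by (subst plus_emeasure) (auto simp: Un_absorb1)
  then have finU: "emeasure lborel U < \<infinity>"
    using A(2) U(3) by (auto simp: less_top[symmetric] ennreal_add_eq_top)
  have intd: "integrable lborel (indicator (U - A) :: real \<Rightarrow> real)"
    using U(3) by (intro integrable_real_indicator) (auto simp: less_top[symmetric])
  have intU: "integrable lborel (indicator U :: real \<Rightarrow> real)"
    using finU by (intro integrable_real_indicator) auto
  have intA: "integrable lborel (indicator A :: real \<Rightarrow> real)"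
    using A by (intro integrable_real_indicator) auto
  have d: "(LINT x|lborel. indicator (U - A) x :: real) < e/4"
  proof -
    have "ennreal (measure lborel (U - A)) < ennreal (e/4)"
      using U(3) by (subst emeasure_eq_ennreal_measure[symmetric]) (auto simp: less_top[symmetric])
    then show ?thesis by (simp add: ennreal_less_iff)
  qed
  obtain N where N: "\<And>n. n \<ge> N \<Longrightarrow> norm ((LINT x|lborel. \<bar>indicator U (x + u n) - indicator U x :: real\<bar>) - 0) < e/4"
    using LIMSEQ_D[OF indicator_open_translation[OF U(1) finU u], of "e/4"] \<open>0 < e\<close> by auto
  show "\<exists>no. \<forall>n\<ge>no. norm ((LINT x|lborel. \<bar>indicator A (x + u n) - indicator A x :: real\<bar>) - 0) < e"
  proof (intro exI allI impI)
    fix n assume "N \<le> n"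
    have "(LINT x|lborel. \<bar>indicator A (x + u n) - indicator A x :: real\<bar>)
       \<le> (LINT x|lborel. indicator (U - A) (x + u n) + indicator (U - A) x + \<bar>indicator U (x + u n) - indicator U x :: real\<bar>)"
    proof (intro integral_mono)
      show "\<bar>indicator A (x + u n) - indicator A x\<bar> \<le> indicator (U - A) (x + u n) + indicator (U - A) x + \<bar>indicator U (x + u n) - indicator U x :: real\<bar>" for x
        using U(2) by (auto split: split_indicator)
    qed (use integrable_translate[OF intA] integrable_translate[OF intd] integrable_translate[OF intU] intA intd intU in simp_all)
    also have "\<dots> = (LINT x|lborel. indicator (U - A) (x + u n)) + (LINT x|lborel. indicator (U - A) x)
         + (LINT x|lborel. \<bar>indicator U (x + u n) - indicator U x :: real\<bar>)"
      using integrable_translate[OF intd] integrable_translate[OF intU] intd intU by simp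
    also have "(LINT x|lborel. indicator (U - A) (x + u n) :: real) = (LINT x|lborel. indicator (U - A) x)"
      by (rule integral_translate)
    finally show "norm ((LINT x|lborel. \<bar>indicator A (x + u n) - indicator A x :: real\<bar>) - 0) < e"
      using d N[OF \<open>N \<le> n\<close>] \<open>0 < e\<close> by simp
  qed
qed

lemma L1_translation_continuous:
  fixes f :: "real \<Rightarrow> complex"
  assumes "integrable lborel f" and u: "u \<longlonglongrightarrow> 0"
  shows "(\<lambda>n. LINT x|lborel. norm (f (x + u n) - f x)) \<longlonglongrightarrow> 0"
  using assms(1)
proof (induction rule: integrable_induct)
  case (base A c)
  have "(\<lambda>n. norm c * (LINT x|lborel. \<bar>indicator A (x + u n) - indicator A x :: real\<bar>)) \<longlonglongrightarrow> 0"
    using indicator_translation[OF _ _ u, of A] base by (auto intro!: tendsto_mult_right_zero)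
  then show ?case
    by (simp add: mult.commute flip: scaleR_diff_left)
next
  case (add f g)
  show ?case
  proof (rule Lim_null_comparison)
    show "(\<lambda>n. (LINT x|lborel. norm (f (x + u n) - f x)) + (LINT x|lborel. norm (g (x + u n) - g x))) \<longlonglongrightarrow> 0"
      using tendsto_add[OF add.IH] by simp
    have "(LINT x|lborel. norm (f (x + t) + g (x + t) - (f x + g x)))
        \<le> (LINT x|lborel. norm (f (x + t) - f x) + norm (g (x + t) - g x))" for t
      using add(1,2) integrable_translate[OF add(1), of t] integrable_translate[OF add(2), of t]
      by (intro integral_mono) (auto simp: add_diff_add norm_triangle_ineq)
    then show "\<forall>\<^sub>F n in sequentially. norm (LINT x|lborel. norm (f (x + u n) + g (x + u n) - (f x + g x)))
        \<le> (LINT x|lborel. norm (f (x + u n) - f x)) + (LINT x|lborel. norm (g (x + u n) - g x))"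
      using add(1,2) integrable_translate[OF add(1)] integrable_translate[OF add(2)]
      by (intro always_eventually allI) simp
  qed
next
  case (lim f s)
  have conv: "(\<lambda>i. LINT x|lborel. norm (s i x - f x)) \<longlonglongrightarrow> (LINT (x::real)|lborel. 0)"
  proof (rule integral_dominated_convergence[where w="\<lambda>x. 3 * norm (f x)"])
    show "AE x in lborel. (\<lambda>i. norm (s i x - f x)) \<longlonglongrightarrow> 0"
      using lim.hyps(2) by (intro AE_I2 tendsto_norm_zero LIM_zero) simp
    show "AE x in lborel. norm (norm (s i x - f x)) \<le> 3 * norm (f x)" for i
    proof (rule AE_I2)
      fix x
      show "norm (norm (s i x - f x)) \<le> 3 * norm (f x)"
        using norm_triangle_ineq4[of "s i x" "f x"] lim.hyps(3)[of x i] by simp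
    qed
  qed (use lim in auto)
  show ?case
  proof (rule LIMSEQ_I)
    fix e :: real assume "0 < e"
    then obtain i where i: "norm ((LINT x|lborel. norm (s i x - f x)) - 0) < e/3"
      using LIMSEQ_D[OF conv, of "e/3"] by auto
    obtain N where N: "\<And>n. n \<ge> N \<Longrightarrow> norm ((LINT x|lborel. norm (s i (x + u n) - s i x)) - 0) < e/3"
      using LIMSEQ_D[OF lim.IH[of i], of "e/3"] \<open>0 < e\<close> by auto
    show "\<exists>no. \<forall>n\<ge>no. norm ((LINT x|lborel. norm (f (x + u n) - f x)) - 0) < e"
    proof (intro exI allI impI)
      fix n assume "N \<le> n"
      have ints: "integrable lborel (\<lambda>x. s i x - f x)" using lim by simp
      note ints' = integrable_translate[OF ints, of "u n"]
      have "(LINT x|lborel. norm (f (x + u n) - f x))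
          \<le> (LINT x|lborel. norm (s i (x + u n) - f (x + u n)) + norm (s i x - f x) + norm (s i (x + u n) - s i x))"
      proof (rule integral_mono)
        fix x
        have "f (x + u n) - f x = - (s i (x + u n) - f (x + u n)) + (s i x - f x) + (s i (x + u n) - s i x)"
          by simp
        then show "norm (f (x + u n) - f x) \<le> norm (s i (x + u n) - f (x + u n)) + norm (s i x - f x) + norm (s i (x + u n) - s i x)"
          by (metis norm_minus_cancel norm_triangle_mono norm_triangle_ineq order_refl)
      qed (use ints ints' integrable_translate[OF lim.hyps(1)[of i], of "u n"] integrable_translate[OF lim.hyps(4), of "u n"] lim in auto)
      also have "\<dots> = (LINT x|lborel. norm (s i (x + u n) - f (x + u n))) + (LINT x|lborel. norm (s i x - f x))
          + (LINT x|lborel. norm (s i (x + u n) - s i x))"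
        using ints ints' integrable_translate[OF lim.hyps(1)[of i], of "u n"] lim by simp
      also have "(LINT x|lborel. norm (s i (x + u n) - f (x + u n))) = (LINT x|lborel. norm (s i x - f x))"
        by (rule integral_translate)
      finally show "norm ((LINT x|lborel. norm (f (x + u n) - f x)) - 0) < e"
        using i N[OF \<open>N \<le> n\<close>] by simp
    qed
  qed
qed

text \<open>Truncating in height and in space at once yields functions that are bounded, integrable
  and close in L^2. Boundedness transfers L^1 continuity to L^2; integrability gives the dense class
  on which the transform is a plain integral.\<close>

lemma L2_bounded_approximation:
  assumes f: "f \<in> L2"
  defines "A \<equiv> \<lambda>n::nat. {x. norm (f x) \<le> real n \<and> \<bar>x\<bar> \<le> real n}"
  shows "A n \<in> sets borel" "eventually (\<lambda>n. x \<in> A n) sequentially"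
    "(\<lambda>n. nrm (\<lambda>x. indicator (A n) x * f x - f x)) \<longlonglongrightarrow> 0"
    "integrable lborel (\<lambda>x. indicator (A n) x * f x)"
    "norm (indicator (A n) x * f x) \<le> real n"
proof -
  note [measurable] = f[THEN L2_measurable]
  show A [measurable]: "A n \<in> sets borel" for n
    unfolding A_def by measurable
  show ev: "eventually (\<lambda>n. x \<in> A n) sequentially" for x
  proof -
    obtain N :: nat where N: "max (norm (f x)) \<bar>x\<bar> \<le> real N"
      using real_arch_simple by blast
    show ?thesis
      unfolding eventually_sequentially A_def using N by (intro exI[of _ N]) auto
  qed
  show "(\<lambda>n. nrm (\<lambda>x. indicator (A n) x * f x - f x)) \<longlonglongrightarrow> 0"
    by (rule L2_truncate[OF f A ev])
  show bd: "norm (indicator (A n) x * f x) \<le> real n" for x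
    by (auto simp: A_def indicator_def)
  have "integrable lborel (\<lambda>x. real n * indicator {- real n..real n} x)"
    by (intro integrable_mult_right integrable_real_indicator) auto
  then show "integrable lborel (\<lambda>x. indicator (A n) x * f x)"
    by (rule Bochner_Integration.integrable_bound) (auto simp: A_def indicator_def)
qed

text \<open>For a function bounded by \<open>k\<close> the squared increment is at most
  \<open>2 * k\<close> times the increment, so L^1 continuity suffices; the truncation error is the
  same before and after the shift.\<close>

lemma L2_translation_continuous:
  assumes f: "f \<in> L2" and u: "u \<longlonglongrightarrow> 0"
  shows "(\<lambda>n. nrm (\<lambda>x. f (x + u n) - f x)) \<longlonglongrightarrow> 0"
proof (rule LIMSEQ_I)
  fix e :: real assume "0 < e"
  define A where "A n = {x. norm (f x) \<le> real n \<and> \<bar>x\<bar> \<le> real n}" for n :: nat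
  note approx = L2_bounded_approximation[OF f, folded A_def]
  note [measurable] = f[THEN L2_measurable]
  obtain k where k: "norm (nrm (\<lambda>x. indicator (A k) x * f x - f x) - 0) < e/3"
    using LIMSEQ_D[OF approx(3), of "e/3"] \<open>0 < e\<close> by auto
  define g where "g x = indicator (A k) x * f x" for x
  have g: "g \<in> L2" "integrable lborel g" "\<And>x. norm (g x) \<le> real k"
    using approx L2_indicator[OF f] by (auto simp: g_def[abs_def])
  note [measurable] = g(1)[THEN L2_measurable]
  have "(\<lambda>n. sqrt (2 * real k * (LINT x|lborel. norm (g (x + u n) - g x)))) \<longlonglongrightarrow> sqrt (2 * real k * 0)"
    by (intro tendsto_intros L1_translation_continuous g u)
  then obtain N where N: "\<And>n. n \<ge> N \<Longrightarrow> norm (sqrt (2 * real k * (LINT x|lborel. norm (g (x + u n) - g x))) - 0) < e/3"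
    using LIMSEQ_D[of _ 0 "e/3"] \<open>0 < e\<close> by fastforce
  show "\<exists>no. \<forall>n\<ge>no. norm (nrm (\<lambda>x. f (x + u n) - f x) - 0) < e"
  proof (intro exI allI impI)
    fix n assume n: "N \<le> n"
    have tr: "(\<lambda>x. h (x + u n)) \<in> L2" if "h \<in> L2" for h
      using L2_affine[OF that, of 1 "u n"] by (simp add: add.commute)
    have gt: "integrable lborel (\<lambda>x. g (x + u n) - g x)"
      using g integrable_translate[OF g(2)] by simp
    have "(nrm (\<lambda>x. g (x + u n) - g x))\<^sup>2 \<le> (LINT x|lborel. 2 * real k * norm (g (x + u n) - g x))"
      unfolding nrm_square
    proof (rule integral_mono)
      show "integrable lborel (\<lambda>x. (norm (g (x + u n) - g x))\<^sup>2)"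
        using L2_diff[OF tr g(1)] g(1) by (simp add: L2_iff)
      show "integrable lborel (\<lambda>x. 2 * real k * norm (g (x + u n) - g x))"
        using gt by simp
      show "(norm (g (x + u n) - g x))\<^sup>2 \<le> 2 * real k * norm (g (x + u n) - g x)" for x
        unfolding power2_eq_square
        using norm_triangle_ineq4[of "g (x + u n)" "g x"] g(3)[of x] g(3)[of "x + u n"]
        by (intro mult_right_mono) auto
    qed
    also have "\<dots> = 2 * real k * (LINT x|lborel. norm (g (x + u n) - g x))" by simp
    finally have "nrm (\<lambda>x. g (x + u n) - g x) \<le> sqrt (2 * real k * (LINT x|lborel. norm (g (x + u n) - g x)))"
      by (rule real_le_rsqrt)
    also have "\<dots> < e/3" using N[OF n] by simp
    finally have g3: "nrm (\<lambda>x. g (x + u n) - g x) < e/3" .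
    have "nrm (\<lambda>x. f (x + u n) - f x) \<le> nrm (\<lambda>x. f (x + u n) - g (x + u n)) + nrm (\<lambda>x. g (x + u n) - f x)"
      by (intro nrm_triangle_diff tr f g)
    also have "nrm (\<lambda>x. g (x + u n) - f x) \<le> nrm (\<lambda>x. g (x + u n) - g x) + nrm (\<lambda>x. g x - f x)"
      by (intro nrm_triangle_diff tr f g)
    also have "nrm (\<lambda>x. f (x + u n) - g (x + u n)) = nrm (\<lambda>x. g x - f x)"
      using nrm_translate[of "\<lambda>x. f x - g x" "u n"] nrm_minus_commute[of f g] by simp
    finally show "norm (nrm (\<lambda>x. f (x + u n) - f x) - 0) < e"
      using g3 k by (simp add: g_def)
  qed
qed

section \<open>The Plancherel identity\<close>

definition FT :: "(real \<Rightarrow> complex) \<Rightarrow> real \<Rightarrow> complex" where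
  "FT f \<xi> = (LINT x|lborel. exp (- (\<i> * complex_of_real (x * \<xi>))) * f x)"

lemma norm_exp_minus_i [simp]: "norm (exp (- (\<i> * complex_of_real t))) = 1"
  using norm_exp_i_times[of "- t"] by simp

lemma integrable_exp_mult:
  assumes "integrable lborel f"
  shows "integrable lborel (\<lambda>x. exp (- (\<i> * complex_of_real (x * \<xi>))) * f x)"
  by (rule Bochner_Integration.integrable_bound[OF assms]) (use assms in \<open>auto simp: norm_mult\<close>)

lemma norm_FT_le: "norm (FT f \<xi>) \<le> (LINT x|lborel. norm (f x))"
  unfolding FT_def by (rule integral_norm_bound[THEN order_trans]) (simp add: norm_mult)

lemma FT_measurable [measurable]:
  assumes [measurable]: "f \<in> borel_measurable borel"
  shows "FT f \<in> borel_measurable borel"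
  unfolding FT_def[abs_def] by measurable

lemma FT_diff:
  "integrable lborel f \<Longrightarrow> integrable lborel g \<Longrightarrow> FT (\<lambda>x. f x - g x) = (\<lambda>\<xi>. FT f \<xi> - FT g \<xi>)"
  unfolding FT_def right_diff_distrib by (intro ext Bochner_Integration.integral_diff integrable_exp_mult)

lemma FT_cmult: "FT (\<lambda>x. c * f x) \<xi> = c * FT f \<xi>"
  unfolding FT_def by (subst integral_mult_right_zero[symmetric]) (simp add: mult.left_commute)

lemma FT_cnj: "cnj (FT f \<xi>) = FT (\<lambda>x. cnj (f x)) (- \<xi>)"
proof -
  have "FT (\<lambda>x. cnj (f x)) (- \<xi>) = (LINT x|lborel. cnj (exp (- (\<i> * complex_of_real (x * \<xi>))) * f x))"
    unfolding FT_def by (simp add: exp_cnj)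
  then show ?thesis
    unfolding FT_def by (simp only: Bochner_Integration.integral_cnj)
qed

lemma FT_reflect: "FT (\<lambda>x. f (- x)) \<xi> = FT f (- \<xi>)"
  unfolding FT_def
  using integral_reflect[of "\<lambda>x. exp (- (\<i> * complex_of_real (x * - \<xi>))) * f x"] by simp

lemma integrable_pair_mult:
  fixes f g :: "real \<Rightarrow> 'a :: {real_normed_field, banach, second_countable_topology}"
  assumes "integrable lborel f" "integrable lborel g"
  shows "integrable (lborel \<Otimes>\<^sub>M lborel) (\<lambda>(x, y). f x * g y)"
proof -
  have [measurable]: "f \<in> borel_measurable borel" "g \<in> borel_measurable borel"
    using assms by auto
  show ?thesis
    by (rule lborel_pair.Fubini_integrable) (use assms in \<open>auto simp: norm_mult\<close>)
qed

lemma integrable_pair_kernel: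
  fixes f g :: "real \<Rightarrow> complex" and k :: "real \<Rightarrow> real \<Rightarrow> complex"
  assumes "integrable lborel f" "integrable lborel g"
    and [measurable]: "(\<lambda>(x, y). k x y) \<in> borel_measurable (lborel \<Otimes>\<^sub>M lborel)"
    and "\<And>x y. norm (k x y) \<le> 1"
  shows "integrable (lborel \<Otimes>\<^sub>M lborel) (\<lambda>(x, y). k x y * f x * g y)"
proof (rule Bochner_Integration.integrable_bound[OF integrable_pair_mult[OF assms(1,2)]])
  have [measurable]: "f \<in> borel_measurable borel" "g \<in> borel_measurable borel"
    using assms by auto
  show "(\<lambda>(x, y). k x y * f x * g y) \<in> borel_measurable (lborel \<Otimes>\<^sub>M lborel)"
    by measurable
  have "norm (k x y) * (norm (f x) * norm (g y)) \<le> 1 * (norm (f x) * norm (g y))" for x y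
    by (intro mult_right_mono assms) auto
  then show "AE p in lborel \<Otimes>\<^sub>M lborel. norm (case p of (x, y) \<Rightarrow> k x y * f x * g y) \<le> norm (case p of (x, y) \<Rightarrow> f x * g y)"
    by (intro AE_I2) (auto simp: norm_mult mult.assoc)
qed

text \<open>Fubini moves the transform from one factor to the other, since the kernel is symmetric.
  Plancherel and inversion both rest on this identity.\<close>

lemma integral_FT_mult:
  assumes "integrable lborel f" "integrable lborel g"
  shows "(LINT \<xi>|lborel. FT f \<xi> * g \<xi>) = (LINT x|lborel. f x * FT g x)"
proof -
  have int: "integrable (lborel \<Otimes>\<^sub>M lborel) (\<lambda>(x, y). exp (- (\<i> * complex_of_real (x * y))) * f x * g y)"
    by (rule integrable_pair_kernel[OF assms]) auto
  have "(LINT \<xi>|lborel. FT f \<xi> * g \<xi>) = (LINT \<xi>|lborel. LINT x|lborel. exp (- (\<i> * complex_of_real (x * \<xi>))) * f x * g \<xi>)"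
    unfolding FT_def by simp
  also have "\<dots> = (LINT x|lborel. LINT \<xi>|lborel. exp (- (\<i> * complex_of_real (x * \<xi>))) * f x * g \<xi>)"
    by (rule lborel_pair.Fubini_integral[OF int])
  also have "\<dots> = (LINT x|lborel. LINT \<xi>|lborel. f x * (exp (- (\<i> * complex_of_real (\<xi> * x))) * g \<xi>))"
    by (simp add: ac_simps)
  also have "\<dots> = (LINT x|lborel. f x * FT g x)"
    unfolding FT_def by simp
  finally show ?thesis .
qed

text \<open>A rescaling of the characteristic function of the standard normal distribution. Writing
  the result with \<open>std_normal_density\<close> exhibits an approximate identity of total mass
  \<open>2 * pi\<close>.\<close>

lemma FT_gaussian:
  assumes "0 < \<sigma>"
  shows "FT (\<lambda>x. complex_of_real (exp (- (\<sigma> * x)\<^sup>2 / 2))) s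
    = complex_of_real (2 * pi / \<sigma> * std_normal_density (s / \<sigma>))"
proof -
  define t where "t = - s / \<sigma>"
  have "complex_of_real (exp (- t\<^sup>2 / 2)) = char std_normal_distribution t"
    by (simp add: char_std_normal_distribution)
  also have "\<dots> = (LINT x|lborel. std_normal_density x *\<^sub>R iexp (t * x))"
    unfolding char_def by (subst integral_density) auto
  also have "\<dots> = (LINT x|lborel. complex_of_real (1 / sqrt (2 * pi)) * (exp (- (\<i> * complex_of_real (x / \<sigma> * s))) * complex_of_real (exp (- x\<^sup>2 / 2))))"
    unfolding std_normal_density_def t_def
    by (intro Bochner_Integration.integral_cong refl) (simp add: scaleR_conv_of_real field_simps)
  also have "\<dots> = complex_of_real (1 / sqrt (2 * pi)) * (LINT x|lborel. exp (- (\<i> * complex_of_real (x / \<sigma> * s))) * complex_of_real (exp (- x\<^sup>2 / 2)))"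
    by (rule integral_mult_right_zero)
  also have "(LINT x|lborel. exp (- (\<i> * complex_of_real (x / \<sigma> * s))) * complex_of_real (exp (- x\<^sup>2 / 2)))
     = \<bar>\<sigma>\<bar> *\<^sub>R FT (\<lambda>x. complex_of_real (exp (- (\<sigma> * x)\<^sup>2 / 2))) s"
    unfolding FT_def
    by (subst lborel_integral_real_affine[where c=\<sigma> and t=0]) (use assms in simp_all)
  finally have "complex_of_real (exp (- t\<^sup>2 / 2)) = complex_of_real (\<sigma> / sqrt (2 * pi)) * FT (\<lambda>x. complex_of_real (exp (- (\<sigma> * x)\<^sup>2 / 2))) s"
    using assms by (simp add: scaleR_conv_of_real)
  then have "FT (\<lambda>x. complex_of_real (exp (- (\<sigma> * x)\<^sup>2 / 2))) s = complex_of_real (sqrt (2 * pi) / \<sigma> * exp (- t\<^sup>2 / 2))"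
    using assms by (simp add: field_simps)
  also have "sqrt (2 * pi) / \<sigma> * exp (- t\<^sup>2 / 2) = 2 * pi / \<sigma> * std_normal_density (s / \<sigma>)"
  proof -
    have "sqrt (2 * pi) / \<sigma> * exp (- t\<^sup>2 / 2) = 2 * pi / sqrt (2 * pi) / \<sigma> * exp (- t\<^sup>2 / 2)"
      by (subst real_div_sqrt) simp_all
    also have "\<dots> = 2 * pi / \<sigma> * std_normal_density (s / \<sigma>)"
      unfolding std_normal_density_def t_def by (simp add: power_divide)
    finally show ?thesis .
  qed
  finally show ?thesis .
qed

lemma integrable_gaussian:
  assumes "0 < \<sigma>" shows "integrable lborel (\<lambda>x::real. complex_of_real (exp (- (\<sigma> * x)\<^sup>2 / 2)))"
proof -
  have "integrable lborel (\<lambda>x. sqrt (2 * pi) * std_normal_density x)"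
    by (intro integrable_mult_right) simp
  then have "integrable lborel (\<lambda>x::real. exp (- x\<^sup>2 / 2))"
    by (simp add: std_normal_density_def)
  from lborel_integrable_real_affine[OF this, of \<sigma> 0] assms
  have "integrable lborel (\<lambda>x::real. exp (- (\<sigma> * x)\<^sup>2 / 2))" by simp
  then show ?thesis by (rule integrable_of_real)
qed

text \<open>The square of \<open>FT f\<close> need not be known to be integrable; with a Gaussian
  weight everything converges absolutely, and the weighted integral becomes an average of
  autocorrelations of \<open>f\<close> at lags \<open>\<sigma> * v\<close>. As
  \<open>\<sigma>\<close> tends to 0 these approach the squared norm of \<open>f\<close>.\<close>

lemma gaussian_mean_FT:
  assumes f: "integrable lborel f" "f \<in> L2" and "0 < \<sigma>"
  shows "(LINT x|lborel. (norm (FT f x))\<^sup>2 * exp (- (\<sigma> * x)\<^sup>2 / 2))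
    = 2 * pi * Re (LINT v|lborel. std_normal_density v * (LINT s|lborel. f s * cnj (f (s + \<sigma> * v))))"
proof -
  note [measurable] = f(2)[THEN L2_measurable]
  define w where "w x = complex_of_real (exp (- (\<sigma> * x)\<^sup>2 / 2))" for x
  have w: "integrable lborel w"
    using integrable_gaussian[OF \<open>0 < \<sigma>\<close>] by (simp add: w_def[abs_def])
  have [measurable]: "w \<in> borel_measurable borel" using w by auto
  \<comment> \<open>With this \<open>g\<close> the weighted square of \<open>FT f\<close> is
    \<open>FT f x * g x\<close>, so the multiplication formula moves the transform onto
    \<open>g\<close>, which the Gaussian makes integrable.\<close>
  define g where "g x = cnj (FT f x) * w x" for x
  have g: "integrable lborel g"
  proof (rule Bochner_Integration.integrable_bound)
    show "integrable lborel (\<lambda>x. (LINT x|lborel. norm (f x)) *\<^sub>R norm (w x))"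
      using w by simp
    show "AE x in lborel. norm (g x) \<le> norm ((LINT x|lborel. norm (f x)) *\<^sub>R norm (w x))"
      by (intro AE_I2) (auto simp: g_def norm_mult intro!: mult_right_mono norm_FT_le)
  qed (simp add: g_def[abs_def])
  have FTg: "FT g s = 2 * pi * (LINT v|lborel. std_normal_density v * cnj (f (s + \<sigma> * v)))" for s
  proof -
    have "g x = w x * FT (\<lambda>t. cnj (f t)) (- x)" for x
      by (simp add: g_def FT_cnj)
    then have "FT g s = (LINT x|lborel. FT (\<lambda>t. cnj (f (- t))) x * (exp (- (\<i> * complex_of_real (x * s))) * w x))"
      unfolding FT_def[of g] by (simp add: FT_reflect[of "\<lambda>t. cnj (f t)"] ac_simps)
    also have "\<dots> = (LINT t|lborel. cnj (f (- t)) * FT (\<lambda>x. exp (- (\<i> * complex_of_real (x * s))) * w x) t)"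
    proof (rule integral_FT_mult)
      show "integrable lborel (\<lambda>t. cnj (f (- t)))"
        using lborel_integrable_real_affine[OF f(1), of "-1" 0] by simp
      show "integrable lborel (\<lambda>x. exp (- (\<i> * complex_of_real (x * s))) * w x)"
        using w by (rule integrable_exp_mult)
    qed
    also have "\<dots> = (LINT t|lborel. cnj (f (- t)) * FT w (t + s))"
    proof -
      have "exp (- (\<i> * complex_of_real (x * t))) * exp (- (\<i> * complex_of_real (x * s)))
          = exp (- (\<i> * complex_of_real (x * (t + s))))" for x t
        by (subst exp_add[symmetric]) (simp add: distrib_left)
      then show ?thesis
        unfolding FT_def by (simp only: mult.assoc[symmetric])
    qed
    also have "\<dots> = (LINT t|lborel. cnj (f (- t)) * complex_of_real (2 * pi / \<sigma> * std_normal_density ((t + s) / \<sigma>)))"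
      using FT_gaussian[OF \<open>0 < \<sigma>\<close>] by (simp add: w_def[abs_def])
    \<comment> \<open>The substitution \<open>t = - s - \<sigma> * v\<close> removes
      \<open>\<sigma>\<close> from the density and puts it into the argument of \<open>f\<close>,
      where the limit becomes continuity of translation.\<close>
    also have "(LINT t|lborel. cnj (f (- t)) * complex_of_real (2 * pi / \<sigma> * std_normal_density ((t + s) / \<sigma>)))
        = (LINT v|lborel. complex_of_real (2 * pi) * (std_normal_density v * cnj (f (s + \<sigma> * v))))"
    proof -
      have "(- s + - \<sigma> * v + s) / \<sigma> = - v" for v
        using \<open>0 < \<sigma>\<close> by simp
      moreover have "std_normal_density (- v) = std_normal_density v" for v
        by (simp add: std_normal_density_def)
      ultimately have eq: "\<bar>- \<sigma>\<bar> *\<^sub>R (cnj (f (- (- s + - \<sigma> * v))) * complex_of_real (2 * pi / \<sigma> * std_normal_density ((- s + - \<sigma> * v + s) / \<sigma>)))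
        = complex_of_real (2 * pi) * (std_normal_density v * cnj (f (s + \<sigma> * v)))" for v
        using \<open>0 < \<sigma>\<close> by (simp add: scaleR_conv_of_real add.commute)
      have "(LINT t|lborel. cnj (f (- t)) * complex_of_real (2 * pi / \<sigma> * std_normal_density ((t + s) / \<sigma>)))
        = \<bar>- \<sigma>\<bar> *\<^sub>R (LINT v|lborel. cnj (f (- (- s + - \<sigma> * v))) * complex_of_real (2 * pi / \<sigma> * std_normal_density ((- s + - \<sigma> * v + s) / \<sigma>)))"
        by (rule lborel_integral_real_affine) (use \<open>0 < \<sigma>\<close> in simp)
      also have "\<dots> = (LINT v|lborel. \<bar>- \<sigma>\<bar> *\<^sub>R (cnj (f (- (- s + - \<sigma> * v))) * complex_of_real (2 * pi / \<sigma> * std_normal_density ((- s + - \<sigma> * v + s) / \<sigma>))))"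
        by (rule Bochner_Integration.integral_scaleR_right[symmetric])
      finally show ?thesis by (simp only: eq)
    qed
    finally show ?thesis by simp
  qed
  have "(LINT x|lborel. (norm (FT f x))\<^sup>2 * exp (- (\<sigma> * x)\<^sup>2 / 2))
    = Re (LINT x|lborel. complex_of_real ((norm (FT f x))\<^sup>2 * exp (- (\<sigma> * x)\<^sup>2 / 2)))"
    by (simp only: integral_complex_of_real Re_complex_of_real)
  also have "(LINT x|lborel. complex_of_real ((norm (FT f x))\<^sup>2 * exp (- (\<sigma> * x)\<^sup>2 / 2))) = (LINT x|lborel. FT f x * g x)"
    by (simp only: g_def w_def complex_norm_square of_real_mult mult.assoc)
  also have "\<dots> = (LINT s|lborel. f s * FT g s)"
    by (rule integral_FT_mult[OF f(1) g])
  also have "\<dots> = 2 * pi * (LINT s|lborel. LINT v|lborel. f s * (std_normal_density v * cnj (f (s + \<sigma> * v))))"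
    unfolding FTg by (simp add: mult.left_commute[of _ "2 * complex_of_real pi"])
  also have "(LINT s|lborel. LINT v|lborel. f s * (std_normal_density v * cnj (f (s + \<sigma> * v))))
     = (LINT v|lborel. LINT s|lborel. f s * (std_normal_density v * cnj (f (s + \<sigma> * v))))"
  proof (rule lborel_pair.Fubini_integral[symmetric])
    have "integrable (lborel \<Otimes>\<^sub>M lborel) (\<lambda>(s, v). f s * cnj (f (s + \<sigma> * v)))"
    proof (rule lborel_pair.Fubini_integrable)
      have "(LINT v|lborel. norm (f (s + \<sigma> * v))) = (LINT x|lborel. norm (f x)) / \<sigma>" for s
        using lborel_integral_real_affine[of \<sigma> "\<lambda>x. norm (f x)" s] \<open>0 < \<sigma>\<close> by simp
      then show "integrable lborel (\<lambda>s. LINT v|lborel. norm (case (s, v) of (s, v) \<Rightarrow> f s * cnj (f (s + \<sigma> * v))))"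
        using f by (simp add: norm_mult)
      show "AE s in lborel. integrable lborel (\<lambda>v. case (s, v) of (s, v) \<Rightarrow> f s * cnj (f (s + \<sigma> * v)))"
        using lborel_integrable_real_affine[OF f(1), of \<sigma>] \<open>0 < \<sigma>\<close> by simp
    qed simp
    then show "integrable (lborel \<Otimes>\<^sub>M lborel) (\<lambda>(s, v). f s * (std_normal_density v * cnj (f (s + \<sigma> * v))))"
    proof (rule Bochner_Integration.integrable_bound)
      have "std_normal_density v * c \<le> 1 * c" if "0 \<le> c" for v c
      proof (rule mult_right_mono)
        have "1 * exp (- v\<^sup>2 / 2) \<le> sqrt (2 * pi) * 1"
          using pi_gt3 by (intro mult_mono) auto
        then show "std_normal_density v \<le> 1"
          unfolding std_normal_density_def by (simp add: field_simps)
      qed fact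
      from this[of "norm (f s) * norm (f (s + \<sigma> * v))" for s v]
      show "AE x in lborel \<Otimes>\<^sub>M lborel. norm (case x of (s, v) \<Rightarrow> f s * (std_normal_density v * cnj (f (s + \<sigma> * v))))
         \<le> norm (case x of (s, v) \<Rightarrow> f s * cnj (f (s + \<sigma> * v)))"
        by (intro AE_I2) (auto simp: norm_mult ac_simps)
    qed simp
  qed
  also have "\<dots> = (LINT v|lborel. std_normal_density v * (LINT s|lborel. f s * cnj (f (s + \<sigma> * v))))"
    by (simp add: mult.left_commute[of _ "complex_of_real (std_normal_density v)" for v])
  finally show ?thesis by simp
qed

text \<open>Cauchy-Schwarz bounds the deviation by the L^2 modulus of continuity under
  translation.\<close>

lemma tendsto_autocorrelation:
  assumes f: "f \<in> L2" and u: "u \<longlonglongrightarrow> 0"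
  shows "(\<lambda>n. LINT s|lborel. f s * cnj (f (s + u n))) \<longlonglongrightarrow> complex_of_real ((nrm f)\<^sup>2)"
proof (rule LIM_zero_cancel, rule Lim_null_comparison)
  show "(\<lambda>n. nrm f * nrm (\<lambda>x. f (x + u n) - f x)) \<longlonglongrightarrow> 0"
    by (intro tendsto_mult_right_zero L2_translation_continuous assms)
  have "norm ((LINT s|lborel. f s * cnj (f (s + t))) - complex_of_real ((nrm f)\<^sup>2)) \<le> nrm f * nrm (\<lambda>x. f (x + t) - f x)" for t
  proof -
    have ft: "(\<lambda>x. f (x + t)) \<in> L2"
      using L2_affine[OF f, of 1 t] by (simp add: add.commute)
    have "complex_of_real ((nrm f)\<^sup>2) = (LINT s|lborel. complex_of_real ((norm (f s))\<^sup>2))"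
      by (simp only: nrm_square integral_complex_of_real)
    also have "\<dots> = (LINT s|lborel. f s * cnj (f s))"
      by (simp only: complex_norm_square)
    finally have "(LINT s|lborel. f s * cnj (f (s + t))) - complex_of_real ((nrm f)\<^sup>2)
      = (LINT s|lborel. f s * cnj (f (s + t) - f s))"
      using L2_mult_integrable[OF f L2_cnj[OF ft]] L2_mult_integrable[OF f L2_cnj[OF f]]
      by (simp add: right_diff_distrib)
    also have "norm \<dots> \<le> nrm f * nrm (\<lambda>s. cnj (f (s + t) - f s))"
      by (intro L2_Cauchy_Schwarz f L2_cnj L2_diff ft)
    finally show ?thesis by (simp only: nrm_cnj)
  qed
  then show "\<forall>\<^sub>F n in sequentially. norm ((LINT s|lborel. f s * cnj (f (s + u n))) - complex_of_real ((nrm f)\<^sup>2))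
     \<le> nrm f * nrm (\<lambda>x. f (x + u n) - f x)"
    by simp
qed

text \<open>The Gaussian means have a known limit, but exchanging it with the integral needs an
  integrable bound. Fatou's lemma first shows \<open>FT f \<in> L2\<close>; then the square of
  \<open>FT f\<close> itself serves as the dominating function and gives the exact norm.\<close>

theorem Plancherel_L1_L2:
  assumes f: "integrable lborel f" "f \<in> L2"
  shows "FT f \<in> L2" "nrm (FT f) = sqrt (2 * pi) * nrm f"
proof -
  note [measurable] = f(2)[THEN L2_measurable]
  define \<sigma> where "\<sigma> n = 1 / real (Suc n)" for n
  have \<sigma>: "0 < \<sigma> n" "\<sigma> \<longlonglongrightarrow> 0" for n
    using LIMSEQ_inverse_real_of_nat by (auto simp: \<sigma>_def[abs_def] inverse_eq_divide)
  let ?G = "\<lambda>n x. (norm (FT f x))\<^sup>2 * exp (- (\<sigma> n * x)\<^sup>2 / 2)"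
  have intG: "integrable lborel (?G n)" for n
  proof (rule Bochner_Integration.integrable_bound)
    show "integrable lborel (\<lambda>x. (LINT x|lborel. norm (f x))\<^sup>2 * norm (complex_of_real (exp (- (\<sigma> n * x)\<^sup>2 / 2))))"
      using integrable_gaussian[OF \<sigma>(1)[of n]] by (intro integrable_mult_right integrable_norm)
    show "AE x in lborel. norm (?G n x) \<le> norm ((LINT x|lborel. norm (f x))\<^sup>2 * norm (complex_of_real (exp (- (\<sigma> n * x)\<^sup>2 / 2))))"
      by (intro AE_I2) (auto simp: norm_mult intro!: mult_right_mono power_mono norm_FT_le)
  qed simp
  have lim: "(\<lambda>n. LINT x|lborel. ?G n x) \<longlonglongrightarrow> 2 * pi * (nrm f)\<^sup>2"
  proof -
    have "(\<lambda>n. LINT v|lborel. std_normal_density v * (LINT s|lborel. f s * cnj (f (s + \<sigma> n * v))))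
       \<longlonglongrightarrow> (LINT v|lborel. std_normal_density v * complex_of_real ((nrm f)\<^sup>2))"
    proof (rule integral_dominated_convergence[where w="\<lambda>v. std_normal_density v * (nrm f)\<^sup>2"])
      show "AE v in lborel. (\<lambda>n. std_normal_density v * (LINT s|lborel. f s * cnj (f (s + \<sigma> n * v))))
          \<longlonglongrightarrow> std_normal_density v * complex_of_real ((nrm f)\<^sup>2)"
        using \<sigma>(2) by (intro AE_I2 tendsto_mult tendsto_const tendsto_autocorrelation f tendsto_mult_left_zero)
      have "norm (LINT s|lborel. f s * cnj (f (s + t))) \<le> (nrm f)\<^sup>2" for t
        using L2_Cauchy_Schwarz[OF f(2) L2_cnj[of "\<lambda>s. f (s + t)"]] L2_affine[OF f(2), of 1 t]
        by (simp add: nrm_cnj nrm_translate power2_eq_square add.commute)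
      then show "AE v in lborel. norm (std_normal_density v * (LINT s|lborel. f s * cnj (f (s + \<sigma> n * v))))
          \<le> std_normal_density v * (nrm f)\<^sup>2" for n
        by (intro AE_I2) (auto simp: norm_mult intro!: mult_left_mono)
    qed auto
    also have "(LINT v|lborel. std_normal_density v * complex_of_real ((nrm f)\<^sup>2)) = complex_of_real ((nrm f)\<^sup>2)"
      by (simp add: integral_std_normal_moment_even[of 0, simplified])
    finally have "(\<lambda>n. 2 * pi * Re (LINT v|lborel. std_normal_density v * (LINT s|lborel. f s * cnj (f (s + \<sigma> n * v)))))
       \<longlonglongrightarrow> 2 * pi * Re (complex_of_real ((nrm f)\<^sup>2))"
      by (intro tendsto_intros)
    then show ?thesis
      by (simp only: gaussian_mean_FT[OF f \<sigma>(1)] Re_complex_of_real)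
  qed
  have G1: "?G n x \<le> (norm (FT f x))\<^sup>2" for n x
    by (intro mult_left_le) auto
  have Glim: "(\<lambda>n. ?G n x) \<longlonglongrightarrow> (norm (FT f x))\<^sup>2" for x
  proof -
    have "(\<lambda>n. ?G n x) \<longlonglongrightarrow> (norm (FT f x))\<^sup>2 * exp (- (0 * x)\<^sup>2 / 2)"
      by (intro tendsto_intros \<sigma>) auto
    then show ?thesis by simp
  qed
  have "(\<integral>\<^sup>+x. ennreal ((norm (FT f x))\<^sup>2) \<partial>lborel) = (\<integral>\<^sup>+x. liminf (\<lambda>n. ennreal (?G n x)) \<partial>lborel)"
    by (intro nn_integral_cong lim_imp_Liminf[symmetric] tendsto_ennrealI Glim) simp
  also have "\<dots> \<le> liminf (\<lambda>n. \<integral>\<^sup>+x. ennreal (?G n x) \<partial>lborel)"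
    by (rule nn_integral_liminf) measurable
  also have "\<dots> = liminf (\<lambda>n. ennreal (LINT x|lborel. ?G n x))"
    by (subst nn_integral_eq_integral[OF intG]) auto
  also have "\<dots> = ennreal (2 * pi * (nrm f)\<^sup>2)"
    by (intro lim_imp_Liminf tendsto_ennrealI lim) simp
  finally show FT: "FT f \<in> L2"
    by (intro L2I_nn_integral) (auto simp: less_top[symmetric] top_unique)
  have "(\<lambda>n. LINT x|lborel. ?G n x) \<longlonglongrightarrow> (LINT x|lborel. (norm (FT f x))\<^sup>2)"
  proof (rule integral_dominated_convergence[where w="\<lambda>x. (norm (FT f x))\<^sup>2"])
    show "integrable lborel (\<lambda>x. (norm (FT f x))\<^sup>2)"
      using FT by (simp add: L2_iff)
  qed (use Glim G1 in auto)
  with lim have "(nrm (FT f))\<^sup>2 = 2 * pi * (nrm f)\<^sup>2"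
    unfolding nrm_square[of "FT f"] by (rule LIMSEQ_unique[symmetric])
  also have "\<dots> = (sqrt (2 * pi) * nrm f)\<^sup>2"
    by (simp add: power_mult_distrib)
  finally show "nrm (FT f) = sqrt (2 * pi) * nrm f"
    by (rule power2_eq_imp_eq) simp_all
qed

section \<open>The Fourier transform on square-integrable functions\<close>

lemma tendsto_nrm_diff:
  assumes "\<And>n. f n \<in> L2" "g \<in> L2" "h \<in> L2" "((\<lambda>n. nrm (\<lambda>x. f n x - g x)) \<longlongrightarrow> 0) F"
  shows "((\<lambda>n. nrm (\<lambda>x. f n x - h x)) \<longlongrightarrow> nrm (\<lambda>x. g x - h x)) F"
  by (rule tendsto_nrm) (use assms in \<open>auto intro: L2_diff\<close>)

lemma L2_limit_unique:
  assumes "\<And>n. f n \<in> L2" "g \<in> L2" "h \<in> L2"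
    and "(\<lambda>n. nrm (\<lambda>x. f n x - g x)) \<longlonglongrightarrow> 0" "(\<lambda>n. nrm (\<lambda>x. f n x - h x)) \<longlonglongrightarrow> 0"
  shows "AE x in lborel. g x = h x"
proof -
  have "nrm (\<lambda>x. g x - h x) = 0"
    using tendsto_nrm_diff[OF assms(1-4)] assms(5) by (rule LIMSEQ_unique)
  then show ?thesis
    using nrm_eq_0_iff[OF L2_diff[OF assms(2,3)]] by simp
qed

lemma tendsto_L2_integral:
  assumes "\<And>n. f n \<in> L2" "\<And>n. g n \<in> L2" "a \<in> L2" "b \<in> L2"
    and lim: "(\<lambda>n. nrm (\<lambda>x. f n x - a x)) \<longlonglongrightarrow> 0" "(\<lambda>n. nrm (\<lambda>x. g n x - b x)) \<longlonglongrightarrow> 0"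
  shows "(\<lambda>n. LINT x|lborel. f n x * g n x) \<longlonglongrightarrow> (LINT x|lborel. a x * b x)"
proof (rule LIM_zero_cancel, rule Lim_null_comparison)
  have "norm ((LINT x|lborel. f n x * g n x) - (LINT x|lborel. a x * b x))
    \<le> nrm (\<lambda>x. f n x - a x) * nrm (g n) + nrm a * nrm (\<lambda>x. g n x - b x)" for n
  proof -
    have "(LINT x|lborel. f n x * g n x) - (LINT x|lborel. a x * b x)
      = (LINT x|lborel. (f n x - a x) * g n x) + (LINT x|lborel. a x * (g n x - b x))"
      by (simp add: left_diff_distrib right_diff_distrib L2_mult_integrable assms)
    also have "norm \<dots> \<le> nrm (\<lambda>x. f n x - a x) * nrm (g n) + nrm a * nrm (\<lambda>x. g n x - b x)"
      by (intro norm_triangle_mono L2_Cauchy_Schwarz L2_diff assms)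
    finally show ?thesis .
  qed
  then show "\<forall>\<^sub>F n in sequentially. norm ((LINT x|lborel. f n x * g n x) - (LINT x|lborel. a x * b x))
    \<le> nrm (\<lambda>x. f n x - a x) * nrm (g n) + nrm a * nrm (\<lambda>x. g n x - b x)"
    by simp
  have "(\<lambda>n. nrm (\<lambda>x. f n x - a x) * nrm (g n) + nrm a * nrm (\<lambda>x. g n x - b x)) \<longlonglongrightarrow> 0 * nrm b + nrm a * 0"
    by (intro tendsto_intros lim tendsto_nrm assms)
  then show "(\<lambda>n. nrm (\<lambda>x. f n x - a x) * nrm (g n) + nrm a * nrm (\<lambda>x. g n x - b x)) \<longlonglongrightarrow> 0"
    by simp
qed

lemma complex_nrm_square: "f \<in> L2 \<Longrightarrow> complex_of_real ((nrm f)\<^sup>2) = (LINT x|lborel. f x * cnj (f x))"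
  unfolding nrm_square integral_complex_of_real[symmetric] complex_norm_square ..

lemma nrm_diff_square:
  assumes "f \<in> L2" "g \<in> L2"
  shows "(nrm (\<lambda>x. f x - g x))\<^sup>2 = (nrm f)\<^sup>2 - 2 * Re (LINT x|lborel. f x * cnj (g x)) + (nrm g)\<^sup>2"
proof -
  have "complex_of_real ((nrm (\<lambda>x. f x - g x))\<^sup>2) = (LINT x|lborel. (f x - g x) * cnj (f x - g x))"
    by (intro complex_nrm_square L2_diff assms)
  also have "\<dots> = (LINT x|lborel. f x * cnj (f x) - f x * cnj (g x) - (cnj (f x * cnj (g x))) + g x * cnj (g x))"
    by (simp add: algebra_simps)
  also have "\<dots> = (LINT x|lborel. f x * cnj (f x)) - (LINT x|lborel. f x * cnj (g x))
      - (LINT x|lborel. cnj (f x * cnj (g x))) + (LINT x|lborel. g x * cnj (g x))"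
    using assms by (simp add: L2_mult_integrable L2_cnj)
  also have "\<dots> = complex_of_real ((nrm f)\<^sup>2) - (LINT x|lborel. f x * cnj (g x))
      - cnj (LINT x|lborel. f x * cnj (g x)) + complex_of_real ((nrm g)\<^sup>2)"
    using assms by (simp only: complex_nrm_square Bochner_Integration.integral_cnj)
  finally have "Re (complex_of_real ((nrm (\<lambda>x. f x - g x))\<^sup>2)) = Re (complex_of_real ((nrm f)\<^sup>2) - (LINT x|lborel. f x * cnj (g x))
      - cnj (LINT x|lborel. f x * cnj (g x)) + complex_of_real ((nrm g)\<^sup>2))"
    by (rule arg_cong)
  then show ?thesis by (simp only: minus_complex.sel plus_complex.sel Re_complex_of_real cnj.sel)
qed

text \<open>The L^2 transform characterised by distances alone: \<open>g\<close> is the transform of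
  \<open>f\<close> when every integrable \<open>h\<close> in \<open>L2\<close> satisfies the scaled
  isometry against the pair. No limit occurs, so uniqueness, passage to limits and the norm identity
  (take \<open>h = 0\<close>) are immediate.\<close>

definition fourier_pair :: "(real \<Rightarrow> complex) \<Rightarrow> (real \<Rightarrow> complex) \<Rightarrow> bool" where
  "fourier_pair f g \<longleftrightarrow> f \<in> L2 \<and> g \<in> L2 \<and>
    (\<forall>h. integrable lborel h \<longrightarrow> h \<in> L2 \<longrightarrow> nrm (\<lambda>\<xi>. FT h \<xi> - g \<xi>) = sqrt (2 * pi) * nrm (\<lambda>x. h x - f x))"

lemma fourier_pair_L2: "fourier_pair f g \<Longrightarrow> f \<in> L2" "fourier_pair f g \<Longrightarrow> g \<in> L2"
  by (auto simp: fourier_pair_def)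

lemma fourier_pair_FT:
  assumes "integrable lborel f" "f \<in> L2" shows "fourier_pair f (FT f)"
  unfolding fourier_pair_def
proof (intro conjI allI impI assms Plancherel_L1_L2)
  fix h assume "integrable lborel h" "h \<in> L2"
  then show "nrm (\<lambda>\<xi>. FT h \<xi> - FT f \<xi>) = sqrt (2 * pi) * nrm (\<lambda>x. h x - f x)"
    using Plancherel_L1_L2(2)[of "\<lambda>x. h x - f x"] assms by (simp add: FT_diff L2_diff)
qed

lemma L1_L2_dense:
  assumes "f \<in> L2"
  obtains h where "\<And>n. integrable lborel (h n)" "\<And>n. h n \<in> L2" "(\<lambda>n. nrm (\<lambda>x. h n x - f x)) \<longlonglongrightarrow> 0"
proof -
  note approx = L2_bounded_approximation[OF assms]
  show thesis
    by (rule that[OF approx(4) L2_indicator[OF assms approx(1)] approx(3)])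
qed

lemma fourier_pair_nrm:
  assumes "fourier_pair f g" shows "nrm g = sqrt (2 * pi) * nrm f"
proof -
  have "nrm (\<lambda>\<xi>. FT (\<lambda>_. 0) \<xi> - g \<xi>) = sqrt (2 * pi) * nrm (\<lambda>x. 0 - f x)"
    using assms L2_zero by (simp add: fourier_pair_def)
  then show ?thesis
    by (simp add: FT_def nrm_eq)
qed

lemma fourier_pair_approx:
  assumes "fourier_pair f g" "\<And>n. integrable lborel (h n)" "\<And>n. h n \<in> L2"
    and "((\<lambda>n. nrm (\<lambda>x. h n x - f x)) \<longlongrightarrow> 0) F"
  shows "((\<lambda>n. nrm (\<lambda>x. FT (h n) x - g x)) \<longlongrightarrow> 0) F"
  using assms tendsto_mult_right_zero[OF assms(4), of "sqrt (2 * pi)"] by (simp add: fourier_pair_def)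

text \<open>The relation is closed in L^2 because both sides of the isometry are continuous in the
  distances. Statements about the transform can hence be checked on integrable functions.\<close>

lemma fourier_pairI_limit:
  assumes pair: "\<And>n. fourier_pair (f n) (g n)" and L2: "a \<in> L2" "b \<in> L2"
    and lim: "(\<lambda>n. nrm (\<lambda>x. f n x - a x)) \<longlonglongrightarrow> 0" "(\<lambda>n. nrm (\<lambda>x. g n x - b x)) \<longlonglongrightarrow> 0"
  shows "fourier_pair a b"
  unfolding fourier_pair_def
proof (intro conjI allI impI L2)
  fix h assume h: "integrable lborel h" "h \<in> L2"
  have "nrm (\<lambda>x. g n x - FT h x) = sqrt (2 * pi) * nrm (\<lambda>x. f n x - h x)" for n
    using pair[of n] h by (simp add: fourier_pair_def nrm_minus_commute[of "g n"] nrm_minus_commute[of "f n"])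
  moreover have "(\<lambda>n. nrm (\<lambda>x. g n x - FT h x)) \<longlonglongrightarrow> nrm (\<lambda>x. b x - FT h x)"
    by (intro tendsto_nrm_diff lim L2 Plancherel_L1_L2 h fourier_pair_L2[OF pair])
  ultimately have "(\<lambda>n. sqrt (2 * pi) * nrm (\<lambda>x. f n x - h x)) \<longlonglongrightarrow> nrm (\<lambda>x. b x - FT h x)"
    by simp
  moreover have "(\<lambda>n. sqrt (2 * pi) * nrm (\<lambda>x. f n x - h x)) \<longlonglongrightarrow> sqrt (2 * pi) * nrm (\<lambda>x. a x - h x)"
    by (intro tendsto_mult tendsto_const tendsto_nrm_diff lim L2 h fourier_pair_L2[OF pair])
  ultimately have "nrm (\<lambda>x. b x - FT h x) = sqrt (2 * pi) * nrm (\<lambda>x. a x - h x)"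
    by (rule LIMSEQ_unique)
  then show "nrm (\<lambda>\<xi>. FT h \<xi> - b \<xi>) = sqrt (2 * pi) * nrm (\<lambda>x. h x - a x)"
    by (simp add: nrm_minus_commute[of "FT h"] nrm_minus_commute[of h])
qed

lemma fourier_pair_exists:
  assumes f: "f \<in> L2" obtains g where "fourier_pair f g"
proof -
  obtain h where h: "\<And>n. integrable lborel (h n)" "\<And>n. h n \<in> L2" "(\<lambda>n. nrm (\<lambda>x. h n x - f x)) \<longlonglongrightarrow> 0"
    using L1_L2_dense[OF f] by blast
  have eq: "nrm (\<lambda>x. FT (h m) x - FT (h n) x) = sqrt (2 * pi) * nrm (\<lambda>x. h m x - h n x)" for m n
    using fourier_pair_FT[OF h(1,2), of n] h by (simp add: fourier_pair_def)
  have FT: "FT (h n) \<in> L2" for n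
    by (intro Plancherel_L1_L2 h)
  obtain g where g: "g \<in> L2" "(\<lambda>n. nrm (\<lambda>x. FT (h n) x - g x)) \<longlonglongrightarrow> 0"
  proof (rule L2_complete[OF FT])
    fix e :: real assume "0 < e"
    then have "0 < e / sqrt (2 * pi) / 2" by simp
    then obtain N where N: "\<And>n. n \<ge> N \<Longrightarrow> nrm (\<lambda>x. h n x - f x) < e / sqrt (2 * pi) / 2"
      using LIMSEQ_D[OF h(3)] by fastforce
    show "\<exists>N. \<forall>m\<ge>N. \<forall>n\<ge>N. nrm (\<lambda>x. FT (h m) x - FT (h n) x) \<le> e"
    proof (intro exI allI impI)
      fix m n assume mn: "N \<le> m" "N \<le> n"
      have "nrm (\<lambda>x. h m x - h n x) \<le> nrm (\<lambda>x. h m x - f x) + nrm (\<lambda>x. f x - h n x)"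
        by (intro nrm_triangle_diff h f)
      also have "\<dots> \<le> e / sqrt (2 * pi)"
        using N[OF mn(1)] N[OF mn(2)] nrm_minus_commute[of f "h n"] by simp
      finally show "nrm (\<lambda>x. FT (h m) x - FT (h n) x) \<le> e"
        unfolding eq by (simp add: pos_le_divide_eq mult.commute)
    qed
  qed
  have "fourier_pair f g"
    by (rule fourier_pairI_limit[OF fourier_pair_FT[OF h(1,2)] f g(1) h(3) g(2)])
  then show thesis by (rule that)
qed

lemma fourier_pair_approx_seq:
  assumes "fourier_pair f g"
  obtains h where "\<And>n. integrable lborel (h n)" "\<And>n. h n \<in> L2" "\<And>n. FT (h n) \<in> L2"
    "(\<lambda>n. nrm (\<lambda>x. h n x - f x)) \<longlonglongrightarrow> 0" "(\<lambda>n. nrm (\<lambda>x. FT (h n) x - g x)) \<longlonglongrightarrow> 0"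
proof -
  obtain h where h: "\<And>n. integrable lborel (h n)" "\<And>n. h n \<in> L2" "(\<lambda>n. nrm (\<lambda>x. h n x - f x)) \<longlonglongrightarrow> 0"
    using L1_L2_dense[OF fourier_pair_L2(1)[OF assms]] by blast
  show thesis
    by (rule that[OF h(1,2) Plancherel_L1_L2(1)[OF h(1,2)] h(3) fourier_pair_approx[OF assms h]])
qed

lemma fourier_pair_unique:
  assumes "fourier_pair f g" "fourier_pair f g'" shows "AE \<xi> in lborel. g \<xi> = g' \<xi>"
proof -
  obtain h where h: "\<And>n. integrable lborel (h n)" "\<And>n. h n \<in> L2" "\<And>n. FT (h n) \<in> L2"
    "(\<lambda>n. nrm (\<lambda>x. h n x - f x)) \<longlonglongrightarrow> 0" "(\<lambda>n. nrm (\<lambda>x. FT (h n) x - g x)) \<longlonglongrightarrow> 0"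
    using fourier_pair_approx_seq[OF assms(1)] by blast
  show ?thesis
    by (rule L2_limit_unique[OF h(3) fourier_pair_L2(2)[OF assms(1)] fourier_pair_L2(2)[OF assms(2)] h(5)
          fourier_pair_approx[OF assms(2) h(1,2,4)]])
qed

lemma fourier_pair_cong_AE:
  assumes "fourier_pair f g" and [measurable]: "f' \<in> borel_measurable borel" "g' \<in> borel_measurable borel"
    and AE: "AE x in lborel. f x = f' x" "AE x in lborel. g x = g' x"
  shows "fourier_pair f' g'"
proof -
  note L2 = fourier_pair_L2[OF assms(1)]
  note [measurable] = L2[THEN L2_measurable]
  have L2': "f' \<in> L2" "g' \<in> L2"
    using L2 AE by (auto intro: L2_cong_AE)
  moreover have "nrm (\<lambda>\<xi>. FT h \<xi> - g \<xi>) = nrm (\<lambda>\<xi>. FT h \<xi> - g' \<xi>)" "nrm (\<lambda>x. h x - f x) = nrm (\<lambda>x. h x - f' x)"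
    if h: "h \<in> L2" for h
  proof -
    note [measurable] = h[THEN L2_measurable]
    show "nrm (\<lambda>\<xi>. FT h \<xi> - g \<xi>) = nrm (\<lambda>\<xi>. FT h \<xi> - g' \<xi>)"
      by (rule nrm_cong_AE) (use AE in auto)
    show "nrm (\<lambda>x. h x - f x) = nrm (\<lambda>x. h x - f' x)"
      by (rule nrm_cong_AE) (use AE in auto)
  qed
  ultimately show ?thesis
    using assms(1) by (simp add: fourier_pair_def)
qed

lemma fourier_pair_cmult:
  assumes "fourier_pair f F" shows "fourier_pair (\<lambda>x. c * f x) (\<lambda>x. c * F x)"
proof -
  obtain h where h: "\<And>n. integrable lborel (h n)" "\<And>n. h n \<in> L2" "\<And>n. FT (h n) \<in> L2"
    "(\<lambda>n. nrm (\<lambda>x. h n x - f x)) \<longlonglongrightarrow> 0" "(\<lambda>n. nrm (\<lambda>x. FT (h n) x - F x)) \<longlonglongrightarrow> 0"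
    using fourier_pair_approx_seq[OF assms(1)] by blast
  have mult0: "(\<lambda>n. nrm (\<lambda>x. c * a n x - c * b x)) \<longlonglongrightarrow> 0" if "(\<lambda>n. nrm (\<lambda>x. a n x - b x)) \<longlonglongrightarrow> 0" for a b
    using tendsto_mult_right_zero[OF that, of "norm c"] by (simp flip: nrm_cmult add: right_diff_distrib)
  show ?thesis
  proof (rule fourier_pairI_limit[where f="\<lambda>n x. c * h n x" and g="\<lambda>n x. c * FT (h n) x"])
    show "fourier_pair (\<lambda>x. c * h n x) (\<lambda>x. c * FT (h n) x)" for n
      using fourier_pair_FT[of "\<lambda>x. c * h n x"] h by (simp add: FT_cmult[abs_def] L2_cmult)
  qed (intro mult0 L2_cmult h fourier_pair_L2[OF assms])+
qed

lemma fourier_pair_cnj_reflect: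
  assumes "fourier_pair f F" shows "fourier_pair (\<lambda>x. cnj (f (- x))) (\<lambda>x. cnj (F x))"
proof -
  obtain h where h: "\<And>n. integrable lborel (h n)" "\<And>n. h n \<in> L2" "\<And>n. FT (h n) \<in> L2"
    "(\<lambda>n. nrm (\<lambda>x. h n x - f x)) \<longlonglongrightarrow> 0" "(\<lambda>n. nrm (\<lambda>x. FT (h n) x - F x)) \<longlonglongrightarrow> 0"
    using fourier_pair_approx_seq[OF assms(1)] by blast
  note L2 = fourier_pair_L2[OF assms(1)]
  show ?thesis
  proof (rule fourier_pairI_limit)
    fix n
    have "FT (\<lambda>x. cnj (h n (- x))) = (\<lambda>x. cnj (FT (h n) x))"
      using FT_reflect[of "\<lambda>x. cnj (h n x)"] by (simp add: FT_cnj fun_eq_iff)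
    then show "fourier_pair (\<lambda>x. cnj (h n (- x))) (\<lambda>x. cnj (FT (h n) x))"
      using fourier_pair_FT[of "\<lambda>x. cnj (h n (- x))"] L2_cnj[OF L2_reflect[OF h(2)[of n]]]
        lborel_integrable_real_affine[OF h(1)[of n], of "-1" 0] by simp
  next
    have "nrm (\<lambda>x. cnj (h n (- x)) - cnj (f (- x))) = nrm (\<lambda>x. h n x - f x)" for n
      using nrm_cnj[of "\<lambda>x. h n (- x) - f (- x)"] nrm_reflect[of "\<lambda>x. h n x - f x"] by simp
    then show "(\<lambda>n. nrm (\<lambda>x. cnj (h n (- x)) - cnj (f (- x)))) \<longlonglongrightarrow> 0"
      using h by simp
    have "nrm (\<lambda>x. cnj (FT (h n) x) - cnj (F x)) = nrm (\<lambda>x. FT (h n) x - F x)" for n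
      using nrm_cnj[of "\<lambda>x. FT (h n) x - F x"] by simp
    then show "(\<lambda>n. nrm (\<lambda>x. cnj (FT (h n) x) - cnj (F x))) \<longlonglongrightarrow> 0"
      using h by simp
  qed (intro L2_cnj L2_reflect[of f] L2)+
qed

lemma fourier_pair_mult:
  assumes "fourier_pair f F" "fourier_pair g G"
  shows "(LINT x|lborel. F x * g x) = (LINT x|lborel. f x * G x)"
proof -
  obtain h where h: "\<And>n. integrable lborel (h n)" "\<And>n. h n \<in> L2" "\<And>n. FT (h n) \<in> L2"
    "(\<lambda>n. nrm (\<lambda>x. h n x - f x)) \<longlonglongrightarrow> 0" "(\<lambda>n. nrm (\<lambda>x. FT (h n) x - F x)) \<longlonglongrightarrow> 0"
    using fourier_pair_approx_seq[OF assms(1)] by blast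
  obtain k where k: "\<And>n. integrable lborel (k n)" "\<And>n. k n \<in> L2" "\<And>n. FT (k n) \<in> L2"
    "(\<lambda>n. nrm (\<lambda>x. k n x - g x)) \<longlonglongrightarrow> 0" "(\<lambda>n. nrm (\<lambda>x. FT (k n) x - G x)) \<longlonglongrightarrow> 0"
    using fourier_pair_approx_seq[OF assms(2)] by blast
  note L2 = fourier_pair_L2[OF assms(1)] fourier_pair_L2[OF assms(2)]
  have "(\<lambda>n. LINT x|lborel. FT (h n) x * k n x) \<longlonglongrightarrow> (LINT x|lborel. F x * g x)"
    by (intro tendsto_L2_integral h k L2)
  moreover have "(\<lambda>n. LINT x|lborel. h n x * FT (k n) x) \<longlonglongrightarrow> (LINT x|lborel. f x * G x)"
    by (intro tendsto_L2_integral h k L2)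
  ultimately show ?thesis
    unfolding integral_FT_mult[OF h(1) k(1)] by (rule LIMSEQ_unique)
qed

text \<open>Let \<open>H\<close> be the transform of \<open>F\<close> and expand the squared
  distance from \<open>H\<close> to the claimed function. The cross term is evaluated by the
  multiplication formula applied to the conjugate reflection of \<open>f\<close>, whose transform is
  the conjugate of \<open>F\<close>. In units of \<open>2 * pi * (nrm F)^2\<close> the three terms
  are 1, -2 and 1, so the distance is 0.\<close>

theorem fourier_pair_inversion:
  assumes "fourier_pair f F" shows "fourier_pair F (\<lambda>x. complex_of_real (2 * pi) * f (- x))"
proof -
  note L2 = fourier_pair_L2[OF assms]
  note [measurable] = L2[THEN L2_measurable]
  obtain H where H: "fourier_pair F H"
    using fourier_pair_exists[OF L2(2)] .
  have HL: "H \<in> L2" using fourier_pair_L2(2)[OF H] .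
  have rL: "(\<lambda>x. complex_of_real (2 * pi) * f (- x)) \<in> L2"
    by (intro L2_cmult L2_reflect L2)
  have nF: "(nrm F)\<^sup>2 = 2 * pi * (nrm f)\<^sup>2" and nH: "(nrm H)\<^sup>2 = 2 * pi * (nrm F)\<^sup>2"
    using fourier_pair_nrm[OF assms] fourier_pair_nrm[OF H] by (simp_all add: power_mult_distrib)
  have "(LINT x|lborel. H x * cnj (complex_of_real (2 * pi) * f (- x)))
      = (LINT x|lborel. complex_of_real (2 * pi) * (H x * cnj (f (- x))))"
    by (simp add: ac_simps)
  also have "\<dots> = complex_of_real (2 * pi) * (LINT x|lborel. H x * cnj (f (- x)))"
    by (rule integral_mult_right_zero)
  also have "(LINT x|lborel. H x * cnj (f (- x))) = (LINT x|lborel. F x * cnj (F x))"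
    by (rule fourier_pair_mult[OF H fourier_pair_cnj_reflect[OF assms]])
  also have "\<dots> = complex_of_real ((nrm F)\<^sup>2)"
    by (rule complex_nrm_square[OF L2(2), symmetric])
  finally have cross: "Re (LINT x|lborel. H x * cnj (complex_of_real (2 * pi) * f (- x))) = 2 * pi * (nrm F)\<^sup>2"
    by (simp only: of_real_mult[symmetric] Re_complex_of_real)
  have "(nrm (\<lambda>x. H x - complex_of_real (2 * pi) * f (- x)))\<^sup>2 = 0"
    unfolding nrm_diff_square[OF HL rL] cross nH nrm_cmult nrm_reflect
    by (simp add: nF norm_mult power_mult_distrib power2_eq_square[of pi])
  then have "AE x in lborel. H x = complex_of_real (2 * pi) * f (- x)"
    using nrm_eq_0_iff[OF L2_diff[OF HL rL]] by simp
  then show ?thesis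
    by (intro fourier_pair_cong_AE[OF H]) auto
qed

text \<open>Conjugate reflection turns inversion into a preimage. Surjectivity is what shows that
  the choice in \<open>fourier_multiplier\<close> has a candidate.\<close>

lemma fourier_pair_surj:
  assumes "F \<in> L2" obtains f where "fourier_pair f F"
proof -
  obtain G where G: "fourier_pair F G"
    using fourier_pair_exists[OF assms] .
  have "fourier_pair (\<lambda>x. cnj (F (- x))) (\<lambda>x. cnj (G x))"
    by (rule fourier_pair_cnj_reflect[OF G])
  from fourier_pair_inversion[OF this]
  have "fourier_pair (\<lambda>x. cnj (G x)) (\<lambda>x. complex_of_real (2 * pi) * cnj (F x))" by simp
  from fourier_pair_cmult[OF fourier_pair_cnj_reflect[OF this], of "1 / (2 * pi)"]
  have "fourier_pair (\<lambda>x. complex_of_real (1 / (2 * pi)) * G (- x)) F" by simp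
  then show thesis by (rule that)
qed

section \<open>Agreement with the transform defined by truncated integrals\<close>

lemma L2_indicator_Icc: "(\<lambda>x. complex_of_real (indicator {a..b} x)) \<in> L2"
proof -
  have "(\<lambda>x. (norm (complex_of_real (indicator {a..b} x)))\<^sup>2) = indicator {a..b}"
    by (auto simp: fun_eq_iff split: split_indicator)
  then show ?thesis
    using integrable_real_indicator[of "{a..b}" lborel] by (simp add: L2_iff emeasure_lborel_Icc_eq)
qed

lemma fourier_truncated_eq: "fourier_truncated R f = FT (\<lambda>x. indicator {-R..R} x * f x)"
  unfolding fourier_truncated_def[abs_def] FT_def[abs_def] set_lebesgue_integral_def
  by (simp add: scaleR_conv_of_real of_real_indicator mult.left_commute fun_eq_iff)

text \<open>A function cut to \<open>{-R..R}\<close> is integrable because it is a product of two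
  functions in \<open>L2\<close>, and it approaches \<open>f\<close> as \<open>R\<close> grows; the
  isometry carries this convergence to the transforms. Limits at infinity are tested along sequences
  to allow dominated convergence.\<close>

lemma fourier_pair_imp_is_fourier_L2:
  assumes "fourier_pair f g" shows "is_fourier_L2 f g"
  unfolding is_fourier_L2_def
proof (intro conjI tendsto_at_topI_sequentially)
  note L2 = fourier_pair_L2[OF assms]
  show "g \<in> L2" by fact
  fix X :: "nat \<Rightarrow> real" assume X: "filterlim X at_top sequentially"
  let ?h = "\<lambda>n x. indicator {- X n..X n} x * f x"
  have h: "integrable lborel (?h n)" "?h n \<in> L2" for n
  proof -
    show "?h n \<in> L2" by (intro L2_indicator L2) auto
    from L2_mult_integrable[OF L2_indicator_Icc L2(1)] show "integrable lborel (?h n)"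
      by (simp add: of_real_indicator)
  qed
  have "(\<lambda>n. nrm (\<lambda>x. ?h n x - f x)) \<longlonglongrightarrow> 0"
  proof (rule L2_truncate[OF L2(1)])
    show "eventually (\<lambda>n. x \<in> {- X n..X n}) sequentially" for x
      using X[unfolded filterlim_at_top, rule_format, of "\<bar>x\<bar>"] by eventually_elim auto
  qed simp
  from fourier_pair_approx[OF assms h this]
  have "(\<lambda>n. (nrm (\<lambda>x. FT (?h n) x - g x))\<^sup>2) \<longlonglongrightarrow> 0\<^sup>2"
    by (intro tendsto_power)
  then have "(\<lambda>n. ennreal ((nrm (\<lambda>x. FT (?h n) x - g x))\<^sup>2)) \<longlonglongrightarrow> ennreal 0"
    by (intro tendsto_ennrealI) simp
  then show "(\<lambda>n. \<integral>\<^sup>+ \<xi>. ennreal ((norm (fourier_truncated (X n) f \<xi> - g \<xi>))\<^sup>2) \<partial>lborel) \<longlonglongrightarrow> 0"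
    unfolding fourier_truncated_eq
    by (subst nn_integral_L2[OF L2_diff[OF Plancherel_L1_L2(1)[OF h] L2(2)]]) simp
qed

text \<open>Two L^2 limits of the same truncated integrals coincide. The triangle inequality is used
  on extended integrals, so that finiteness of the distances is never presupposed.\<close>

lemma is_fourier_L2_imp_fourier_pair:
  assumes "f \<in> L2" "is_fourier_L2 f g" shows "fourier_pair f g"
proof -
  obtain g' where g': "fourier_pair f g'"
    using fourier_pair_exists[OF assms(1)] .
  let ?h = "\<lambda>n x. indicator {- real n..real n} x * f x"
  have gL: "g \<in> L2" and lim: "((\<lambda>R. \<integral>\<^sup>+ \<xi>. ennreal ((norm (fourier_truncated R f \<xi> - g \<xi>))\<^sup>2) \<partial>lborel) \<longlongrightarrow> 0) at_top"
    using assms by (auto simp: is_fourier_L2_def)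
  have lim': "((\<lambda>R. \<integral>\<^sup>+ \<xi>. ennreal ((norm (fourier_truncated R f \<xi> - g' \<xi>))\<^sup>2) \<partial>lborel) \<longlongrightarrow> 0) at_top"
    using fourier_pair_imp_is_fourier_L2[OF g'] by (simp add: is_fourier_L2_def)
  note [measurable] = fourier_pair_L2(2)[OF g', THEN L2_measurable] gL[THEN L2_measurable] assms(1)[THEN L2_measurable]
  have [measurable]: "fourier_truncated R f \<in> borel_measurable borel" for R
    unfolding fourier_truncated_eq by measurable
  have "(\<integral>\<^sup>+ \<xi>. ennreal ((norm (g \<xi> - g' \<xi>))\<^sup>2) \<partial>lborel)
    \<le> 2 * (\<integral>\<^sup>+ \<xi>. ennreal ((norm (fourier_truncated R f \<xi> - g \<xi>))\<^sup>2) \<partial>lborel)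
      + 2 * (\<integral>\<^sup>+ \<xi>. ennreal ((norm (fourier_truncated R f \<xi> - g' \<xi>))\<^sup>2) \<partial>lborel)" (is "_ \<le> ?B R") for R
  proof -
    have "(norm (a - b))\<^sup>2 \<le> 2 * (norm (c - a))\<^sup>2 + 2 * (norm (c - b))\<^sup>2" for a b c :: complex
    proof -
      have "norm (a - b) \<le> norm (c - a) + norm (c - b)"
        using norm_triangle_ineq4[of "c - b" "c - a"] by simp
      then have "(norm (a - b))\<^sup>2 \<le> (norm (c - a) + norm (c - b))\<^sup>2"
        by (intro power_mono) auto
      also have "\<dots> \<le> 2 * (norm (c - a))\<^sup>2 + 2 * (norm (c - b))\<^sup>2"
        using sum_squares_bound[of "norm (c - a)" "norm (c - b)"] by (simp add: power2_sum)
      finally show ?thesis .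
    qed
    then have "(\<integral>\<^sup>+ \<xi>. ennreal ((norm (g \<xi> - g' \<xi>))\<^sup>2) \<partial>lborel)
      \<le> (\<integral>\<^sup>+ \<xi>. ennreal (2 * (norm (fourier_truncated R f \<xi> - g \<xi>))\<^sup>2 + 2 * (norm (fourier_truncated R f \<xi> - g' \<xi>))\<^sup>2) \<partial>lborel)"
      by (intro nn_integral_mono ennreal_leI)
    also have "\<dots> = (\<integral>\<^sup>+ \<xi>. 2 * ennreal ((norm (fourier_truncated R f \<xi> - g \<xi>))\<^sup>2) + 2 * ennreal ((norm (fourier_truncated R f \<xi> - g' \<xi>))\<^sup>2) \<partial>lborel)"
      by (intro nn_integral_cong) (simp add: ennreal_mult)
    also have "\<dots> = ?B R"
      by (simp add: nn_integral_add nn_integral_cmult)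
    finally show ?thesis .
  qed
  moreover have "(?B \<longlongrightarrow> 2 * 0 + 2 * 0) at_top"
    by (intro tendsto_add ennreal_tendsto_cmult lim lim') auto
  ultimately have "(\<integral>\<^sup>+ \<xi>. ennreal ((norm (g \<xi> - g' \<xi>))\<^sup>2) \<partial>lborel) \<le> 0"
    by (intro tendsto_lowerbound[of ?B _ at_top]) auto
  then have "nrm (\<lambda>\<xi>. g \<xi> - g' \<xi>) \<le> 0"
    by (intro L2I_nn_integral_le(2)) auto
  then have "AE \<xi> in lborel. g \<xi> = g' \<xi>"
    using nrm_eq_0_iff[OF L2_diff[OF gL fourier_pair_L2(2)[OF g']]] nrm_nonneg[of "\<lambda>\<xi>. g \<xi> - g' \<xi>"] by simp
  then show ?thesis
    by (intro fourier_pair_cong_AE[OF g']) auto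
qed

theorem fourier_pair_fourier_L2:
  assumes "f \<in> L2" shows "fourier_pair f (fourier_L2 f)"
proof -
  obtain g where "fourier_pair f g"
    using fourier_pair_exists[OF assms] .
  then have "is_fourier_L2 f (fourier_L2 f)"
    unfolding fourier_L2_def by (rule someI[of "is_fourier_L2 f", OF fourier_pair_imp_is_fourier_L2])
  then show ?thesis by (rule is_fourier_L2_imp_fourier_pair[OF assms])
qed

lemma fourier_L2_AE_eq: "fourier_pair f g \<Longrightarrow> AE \<xi> in lborel. fourier_L2 f \<xi> = g \<xi>"
  using fourier_pair_unique fourier_pair_fourier_L2 fourier_pair_L2(1) by blast

text \<open>\<open>half_deriv f\<close> is a Hilbert choice, so a witness is first obtained from
  surjectivity; whatever is chosen has the prescribed transform almost everywhere, and that
  determines its norm.\<close>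

lemma nrm_half_deriv:
  assumes f: "fourier_pair f F" and L2: "(\<lambda>\<xi>. complex_of_real (sqrt \<bar>\<xi>\<bar>) * F \<xi>) \<in> L2"
  shows "2 * pi * (nrm (half_deriv f))\<^sup>2 = (nrm (\<lambda>\<xi>. complex_of_real (sqrt \<bar>\<xi>\<bar>) * F \<xi>))\<^sup>2"
proof -
  let ?m = "\<lambda>\<xi>. complex_of_real (sqrt \<bar>\<xi>\<bar>)"
  let ?P = "\<lambda>g. g \<in> L2 \<and> (AE \<xi> in lborel. fourier_L2 g \<xi> = ?m \<xi> * fourier_L2 f \<xi>)"
  have Ff: "AE \<xi> in lborel. fourier_L2 f \<xi> = F \<xi>"
    by (rule fourier_L2_AE_eq[OF f])
  obtain g where g: "fourier_pair g (\<lambda>\<xi>. ?m \<xi> * F \<xi>)"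
    using fourier_pair_surj[OF L2] .
  have "AE \<xi> in lborel. fourier_L2 g \<xi> = ?m \<xi> * fourier_L2 f \<xi>"
    using fourier_L2_AE_eq[OF g] Ff by eventually_elim simp
  then have "?P g" using fourier_pair_L2(1)[OF g] by simp
  then have P: "?P (half_deriv f)"
    unfolding half_deriv_def fourier_multiplier_def by (rule someI[of ?P])
  then have pair: "fourier_pair (half_deriv f) (fourier_L2 (half_deriv f))"
    by (intro fourier_pair_fourier_L2) simp
  have "AE \<xi> in lborel. fourier_L2 (half_deriv f) \<xi> = ?m \<xi> * F \<xi>"
    using conjunct2[OF P] Ff by eventually_elim simp
  then have "nrm (fourier_L2 (half_deriv f)) = nrm (\<lambda>\<xi>. ?m \<xi> * F \<xi>)"
    using fourier_pair_L2(2)[OF pair] fourier_pair_L2(2)[OF g] by (intro nrm_cong_AE L2_measurable)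
  then show ?thesis
    using fourier_pair_nrm[OF pair] by (simp add: power_mult_distrib flip: \<open>nrm _ = nrm _\<close>)
qed

section \<open>Weak derivatives\<close>

lemma nrm_mono:
  assumes "g \<in> L2" and [measurable]: "f \<in> borel_measurable borel"
    and "\<And>x. norm (f x) \<le> c * norm (g x)" "0 \<le> c"
  shows "nrm f \<le> c * nrm g"
proof (rule power2_le_imp_le)
  have "(nrm f)\<^sup>2 \<le> (LINT x|lborel. c\<^sup>2 * (norm (g x))\<^sup>2)"
    unfolding nrm_square
  proof (rule integral_mono)
    show "integrable lborel (\<lambda>x. (norm (f x))\<^sup>2)"
      using L2_dominated[OF assms(1-3)] by (simp add: L2_iff)
    show "integrable lborel (\<lambda>x. c\<^sup>2 * (norm (g x))\<^sup>2)"
      using assms(1) by (simp add: L2_iff)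
    show "(norm (f x))\<^sup>2 \<le> c\<^sup>2 * (norm (g x))\<^sup>2" for x
      using power_mono[OF assms(3)[of x], of 2] by (simp add: power_mult_distrib)
  qed
  then show "(nrm f)\<^sup>2 \<le> (c * nrm g)\<^sup>2"
    by (simp add: nrm_square power_mult_distrib)
qed (use assms(4) in simp)

section \<open>A C^1 cut-off and its modulations\<close>

lemma DERIV_max_0_square: "((\<lambda>y. (max 0 y)\<^sup>2) has_real_derivative 2 * max 0 y) (at y)"
proof -
  consider "y > 0" | "y < 0" | "y = 0" by linarith
  then show ?thesis
  proof cases
    case 1
    have "((\<lambda>y. y\<^sup>2) has_real_derivative 2 * y) (at y)"
      by (auto intro!: derivative_eq_intros)
    then have "((\<lambda>y. (max 0 y)\<^sup>2) has_real_derivative 2 * y) (at y)"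
      by (rule has_field_derivative_transform_within_open[of _ _ _ "{0<..}"]) (use 1 in auto)
    then show ?thesis using 1 by simp
  next
    case 2
    have "((\<lambda>y::real. 0::real) has_real_derivative 0) (at y)" by simp
    then have "((\<lambda>y. (max 0 y)\<^sup>2) has_real_derivative 0) (at y)"
      by (rule has_field_derivative_transform_within_open[of _ _ _ "{..<0}"]) (use 2 in auto)
    then show ?thesis using 2 by simp
  next
    case 3
    have "((\<lambda>h::real. max 0 h) \<longlongrightarrow> 0) (at 0)"
      by (auto intro!: tendsto_eq_intros)
    then have "((\<lambda>h::real. (max 0 h)\<^sup>2 / h) \<longlongrightarrow> 0) (at 0)"
      by (rule Lim_transform_eventually) (auto simp: eventually_at_filter power2_eq_square max_def)
    then show ?thesis
      by (simp add: has_field_derivative_iff 3)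
  qed
qed

text \<open>Test functions are only required to be C^1, so the square of a truncated parabola is an
  admissible cut-off with elementary bounds; squaring removes the corners at -1 and 1.\<close>

definition bump :: "real \<Rightarrow> real" where "bump x = (max 0 (1 - x\<^sup>2))\<^sup>2"
definition bump' :: "real \<Rightarrow> real" where "bump' x = 2 * max 0 (1 - x\<^sup>2) * (- 2 * x)"

lemma DERIV_bump: "(bump has_real_derivative bump' x) (at x)"
proof -
  have "((\<lambda>x::real. 1 - x\<^sup>2) has_real_derivative (- 2 * x)) (at x)"
    by (auto intro!: derivative_eq_intros)
  from DERIV_chain2[OF DERIV_max_0_square this] show ?thesis
    by (simp add: bump_def[abs_def] bump'_def)
qed

lemma continuous_bump [continuous_intros]:
  "continuous_on S f \<Longrightarrow> continuous_on S (\<lambda>x. bump (f x))"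
  "continuous_on S f \<Longrightarrow> continuous_on S (\<lambda>x. bump' (f x))"
  unfolding bump_def bump'_def by (intro continuous_intros; assumption)+

lemma bump_measurable [measurable]: "bump \<in> borel_measurable borel" "bump' \<in> borel_measurable borel"
  unfolding bump_def[abs_def] bump'_def[abs_def] by measurable

lemma bump_outside: "1 \<le> \<bar>x\<bar> \<Longrightarrow> bump x = 0" "1 \<le> \<bar>x\<bar> \<Longrightarrow> bump' x = 0"
  using power_mono[of 1 "\<bar>x\<bar>" 2] by (auto simp: bump_def bump'_def)

lemma bump_bounds: "0 \<le> bump x" "bump x \<le> 1" "\<bar>bump' x\<bar> \<le> 4"
proof -
  show "0 \<le> bump x" by (simp add: bump_def)
  have m: "max 0 (1 - x\<^sup>2) \<le> 1" "0 \<le> max 0 (1 - x\<^sup>2)" by auto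
  then show "bump x \<le> 1" by (simp add: bump_def power_le_one)
  show "\<bar>bump' x\<bar> \<le> 4"
  proof (cases "1 \<le> \<bar>x\<bar>")
    case False
    have "max 0 (1 - x\<^sup>2) * \<bar>x\<bar> \<le> 1 * 1"
      using m False by (intro mult_mono) auto
    then show ?thesis using m by (simp add: bump'_def abs_mult)
  qed (simp add: bump_outside)
qed

lemma bump_0: "bump 0 = 1" by (simp add: bump_def)

text \<open>Testing a weak derivative against an exponential times a cut-off computes the transform
  of the cut-off function at \<open>\<xi>\<close>.\<close>

lemma test_function_modulated_bump:
  fixes R \<xi> :: real
  assumes "0 < R"
  defines "\<phi> \<equiv> \<lambda>x. exp (- (\<i> * complex_of_real (x * \<xi>))) * complex_of_real (bump (x / R))"
  shows "test_function \<phi>"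
    and "vector_derivative \<phi> (at x) = exp (- (\<i> * complex_of_real (x * \<xi>))) *
      (complex_of_real (bump' (x / R) / R) - \<i> * complex_of_real \<xi> * complex_of_real (bump (x / R)))"
proof -
  let ?D = "\<lambda>x. exp (- (\<i> * complex_of_real (x * \<xi>))) *
      (complex_of_real (bump' (x / R) / R) - \<i> * complex_of_real \<xi> * complex_of_real (bump (x / R)))"
  have D: "(\<phi> has_vector_derivative ?D x) (at x)" for x
  proof -
    have "((\<lambda>x. bump (x / R)) has_real_derivative bump' (x / R) * (1 / R)) (at x)"
      by (rule DERIV_chain2[OF DERIV_bump]) (use assms in \<open>auto intro!: derivative_eq_intros\<close>)
    then have b: "((\<lambda>x. complex_of_real (bump (x / R))) has_vector_derivative complex_of_real (bump' (x / R) / R)) (at x)"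
      by (intro has_vector_derivative_of_real) (simp add: has_real_derivative_iff_has_vector_derivative)
    have "((\<lambda>z. exp (- (\<i> * (z * complex_of_real \<xi>)))) has_field_derivative
        exp (- (\<i> * (complex_of_real x * complex_of_real \<xi>))) * - (\<i> * complex_of_real \<xi>)) (at (complex_of_real x))"
      by (auto intro!: derivative_eq_intros)
    then have e: "((\<lambda>x. exp (- (\<i> * complex_of_real (x * \<xi>)))) has_vector_derivative
        exp (- (\<i> * complex_of_real (x * \<xi>))) * - (\<i> * complex_of_real \<xi>)) (at x)"
      using field_vector_diff_chain_at[of complex_of_real 1 x]
      by (auto dest!: has_vector_derivative_real_field simp: o_def)
    from has_vector_derivative_mult[OF e b] show ?thesis
      unfolding \<phi>_def by (simp add: algebra_simps)
  qed
  then show "vector_derivative \<phi> (at x) = ?D x"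
    by (rule vector_derivative_at)
  have "\<phi> C1_differentiable_on UNIV"
    unfolding C1_differentiable_on_def using D
    by (intro exI[of _ ?D] conjI ballI continuous_intros) (use assms in auto)
  moreover have "{x. \<phi> x \<noteq> 0} \<subseteq> {- R..R}"
  proof
    fix x assume "x \<in> {x. \<phi> x \<noteq> 0}"
    then have "\<bar>x / R\<bar> < 1"
      using bump_outside(1)[of "x / R"] by (auto simp: \<phi>_def not_less[symmetric])
    then show "x \<in> {- R..R}"
      using assms by (auto simp: abs_less_iff field_simps)
  qed
  then have "compact (closure {x. \<phi> x \<noteq> 0})"
    by (meson bounded_closed_interval bounded_subset compact_closure)
  ultimately show "test_function \<phi>"
    by (simp add: test_function_def)
qed

text \<open>Testing with modulated bumps gives the classical rule for the cut-off functions with an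
  error \<open>e n\<close>, which comes from the derivative of the cut-off and has L^2 norm of order
  \<open>1 / R n\<close>.\<close>

theorem fourier_pair_weak_deriv:
  assumes f: "fourier_pair f F" and g: "fourier_pair g G" and weak: "is_weak_deriv_L2 f g"
  shows "AE \<xi> in lborel. G \<xi> = \<i> * complex_of_real \<xi> * F \<xi>"
proof -
  note L2 = fourier_pair_L2[OF f] fourier_pair_L2[OF g]
  note [measurable] = L2[THEN L2_measurable]
  define R where "R n = real (Suc n)" for n
  have R: "0 < R n" "1 \<le> R n" for n by (auto simp: R_def)
  have Rlim: "(\<lambda>n. x / R n) \<longlonglongrightarrow> 0" for x
    using tendsto_mult_right_zero[OF LIMSEQ_inverse_real_of_nat, of x]
    by (simp add: R_def divide_inverse)
  define a where "a n x = complex_of_real (bump (x / R n))" for n x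
  define e where "e n x = complex_of_real (bump' (x / R n) / R n) * f x" for n x
  have [measurable]: "a n \<in> borel_measurable borel" "e n \<in> borel_measurable borel" for n
    unfolding a_def[abs_def] e_def[abs_def] by measurable
  have a1: "norm (a n x) \<le> 1" for n x
    using bump_bounds by (simp add: a_def)
  have alim: "(\<lambda>n. a n x) \<longlonglongrightarrow> 1" for x
  proof -
    have "isCont bump 0"
      using DERIV_bump DERIV_isCont by blast
    from isCont_tendsto_compose[OF this Rlim[of x]]
    have "(\<lambda>n. bump (x / R n)) \<longlonglongrightarrow> 1" by (simp add: bump_0)
    then show ?thesis
      unfolding a_def using tendsto_of_real by fastforce
  qed
  have supp: "x \<notin> {- R n..R n} \<Longrightarrow> 1 \<le> \<bar>x / R n\<bar>" for n x
    using R(1)[of n] by (auto simp: abs_if field_simps)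
  have aL2: "a n \<in> L2" and bL2: "(\<lambda>x. complex_of_real (bump' (x / R n) / R n)) \<in> L2" for n
  proof -
    show "a n \<in> L2"
    proof (rule L2_dominated[OF L2_indicator_Icc])
      show "norm (a n x) \<le> 1 * norm (complex_of_real (indicator {- R n..R n} x))" for x
        using a1 supp[of x n] bump_outside(1)[of "x / R n"] by (cases "x \<in> {- R n..R n}") (auto simp: a_def)
    qed simp
    show "(\<lambda>x. complex_of_real (bump' (x / R n) / R n)) \<in> L2"
    proof (rule L2_dominated[OF L2_indicator_Icc])
      have "\<bar>bump' (x / R n)\<bar> / R n \<le> 4" for x
        using bump_bounds(3)[of "x / R n"] R(2)[of n] frac_le[of 4 "\<bar>bump' (x / R n)\<bar>" 1 "R n"] by simp
      then show "norm (complex_of_real (bump' (x / R n) / R n)) \<le> 4 * norm (complex_of_real (indicator {- R n..R n} x))" for x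
        using supp[of x n] bump_outside(2)[of "x / R n"] R(1)[of n]
        by (cases "x \<in> {- R n..R n}") (auto simp: norm_divide)
    qed simp
  qed
  let ?f = "\<lambda>n x. a n x * f x" and ?g = "\<lambda>n x. a n x * g x"
  have f1: "integrable lborel (?f n)" and g1: "integrable lborel (?g n)" and e1: "integrable lborel (e n)" for n
    using L2_mult_integrable[OF aL2[of n]] L2_mult_integrable[OF bL2[of n]] L2 by (auto simp: e_def[abs_def])
  have f2: "?f n \<in> L2" and g2: "?g n \<in> L2" for n
  proof -
    have "norm (a n x * z) \<le> 1 * norm z" for x z
      using mult_right_mono[OF a1, of "norm z"] by (simp add: norm_mult)
    then show "?f n \<in> L2" "?g n \<in> L2"
      by (intro L2_dominated[OF L2(1), of _ 1] L2_dominated[OF L2(3), of _ 1]; simp)+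
  qed
  have e4: "norm (e n x) \<le> 4 / R n * norm (f x)" for n x
  proof -
    have "norm (complex_of_real (bump' (x / R n) / R n)) \<le> 4 / R n"
      using bump_bounds(3)[of "x / R n"] R(1)[of n] by (simp add: norm_divide divide_right_mono)
    from mult_right_mono[OF this, of "norm (f x)"] show ?thesis
      by (simp only: e_def norm_mult norm_ge_zero)
  qed
  have e2: "e n \<in> L2" for n
    by (rule L2_dominated[OF L2(1) _ e4]) simp
  have flim: "(\<lambda>n. nrm (\<lambda>x. FT (?f n) x - F x)) \<longlonglongrightarrow> 0"
    by (intro fourier_pair_approx[OF f f1 f2] L2_cutoff L2 a1 alim) simp
  have glim: "(\<lambda>n. nrm (\<lambda>x. FT (?g n) x - G x)) \<longlonglongrightarrow> 0"
    by (intro fourier_pair_approx[OF g g1 g2] L2_cutoff L2 a1 alim) simp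
  have elim: "(\<lambda>n. nrm (FT (e n))) \<longlonglongrightarrow> 0"
  proof (rule Lim_null_comparison)
    have "nrm (e n) \<le> 4 / R n * nrm f" for n
      using R(1)[of n] by (intro nrm_mono[OF L2(1) _ e4]) auto
    then show "\<forall>\<^sub>F n in sequentially. norm (nrm (FT (e n))) \<le> sqrt (2 * pi) * (4 / R n * nrm f)"
      unfolding Plancherel_L1_L2(2)[OF e1 e2]
      by (intro always_eventually allI) (simp only: real_norm_def abs_of_nonneg mult_nonneg_nonneg real_sqrt_ge_zero
          nrm_nonneg pi_ge_zero zero_le_numeral mult_left_mono)
    show "(\<lambda>n. sqrt (2 * pi) * (4 / R n * nrm f)) \<longlonglongrightarrow> 0"
      by (intro tendsto_mult_right_zero tendsto_mult_left_zero Rlim)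
  qed
  have id: "FT (?g n) \<xi> = \<i> * complex_of_real \<xi> * FT (?f n) \<xi> - FT (e n) \<xi>" for n \<xi>
  proof -
    let ?k = "\<lambda>x. exp (- (\<i> * complex_of_real (x * \<xi>)))"
    note test = test_function_modulated_bump[OF R(1)[of n], of \<xi>]
    have "(LINT x|lborel. f x * (?k x * (complex_of_real (bump' (x / R n) / R n) - \<i> * complex_of_real \<xi> * complex_of_real (bump (x / R n)))))
        = - (LINT x|lborel. g x * (?k x * complex_of_real (bump (x / R n))))"
      using weak test(1) unfolding is_weak_deriv_L2_def test(2)[symmetric] by blast
    also have "(\<lambda>x. f x * (?k x * (complex_of_real (bump' (x / R n) / R n) - \<i> * complex_of_real \<xi> * complex_of_real (bump (x / R n)))))
        = (\<lambda>x. ?k x * e n x - \<i> * complex_of_real \<xi> * (?k x * ?f n x))"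
      by (simp add: a_def e_def algebra_simps fun_eq_iff)
    also have "(LINT x|lborel. ?k x * e n x - \<i> * complex_of_real \<xi> * (?k x * ?f n x))
        = FT (e n) \<xi> - \<i> * complex_of_real \<xi> * FT (?f n) \<xi>"
      unfolding FT_def integral_mult_right_zero[symmetric]
      by (intro Bochner_Integration.integral_diff integrable_exp_mult integrable_mult_right e1 f1)
    also have "(LINT x|lborel. g x * (?k x * complex_of_real (bump (x / R n)))) = FT (?g n) \<xi>"
      unfolding FT_def a_def by (simp add: ac_simps)
    finally show ?thesis by (simp add: algebra_simps)
  qed
  \<comment> \<open>Multiplication by \<open>\<xi>\<close> is unbounded on L^2, so the limit is
    taken on the window \<open>{- real K..real K}\<close>, where it costs a factor \<open>K\<close>;
    countably many windows exhaust the line.\<close>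
  have "AE \<xi> in lborel. \<xi> \<in> {- real K..real K} \<longrightarrow> G \<xi> = \<i> * complex_of_real \<xi> * F \<xi>" for K
  proof -
    let ?I = "\<lambda>\<xi>. indicator {- real K..real K} \<xi> :: complex"
    let ?d = "\<lambda>\<xi>. ?I \<xi> * (G \<xi> - \<i> * complex_of_real \<xi> * F \<xi>)"
    have bnd: "nrm ?d \<le> nrm (\<lambda>x. FT (?g n) x - G x) + real K * nrm (\<lambda>x. FT (?f n) x - F x) + nrm (FT (e n))"
      and dL2: "?d \<in> L2" for n
    proof -
      note FL2 = Plancherel_L1_L2(1)[OF f1 f2, of n] Plancherel_L1_L2(1)[OF g1 g2, of n] Plancherel_L1_L2(1)[OF e1 e2, of n]
      note [measurable] = FL2[THEN L2_measurable]
      let ?A = "\<lambda>\<xi>. ?I \<xi> * (FT (?g n) \<xi> - G \<xi>)" and ?C = "\<lambda>\<xi>. ?I \<xi> * FT (e n) \<xi>"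
        and ?B = "\<lambda>\<xi>. ?I \<xi> * (\<i> * complex_of_real \<xi> * (FT (?f n) \<xi> - F \<xi>))"
      have Ab: "norm (?A \<xi>) \<le> 1 * norm (FT (?g n) \<xi> - G \<xi>)" and Cb: "norm (?C \<xi>) \<le> 1 * norm (FT (e n) \<xi>)"
        and Bb: "norm (?B \<xi>) \<le> real K * norm (FT (?f n) \<xi> - F \<xi>)" for \<xi>
        by (auto simp: norm_mult intro!: mult_right_mono split: split_indicator)
      have A: "?A \<in> L2" "nrm ?A \<le> 1 * nrm (\<lambda>x. FT (?g n) x - G x)"
        using L2_dominated[OF L2_diff[OF FL2(2) L2(4)] _ Ab] nrm_mono[OF L2_diff[OF FL2(2) L2(4)] _ Ab] by auto
      have B: "?B \<in> L2" "nrm ?B \<le> real K * nrm (\<lambda>x. FT (?f n) x - F x)"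
        using L2_dominated[OF L2_diff[OF FL2(1) L2(2)] _ Bb] nrm_mono[OF L2_diff[OF FL2(1) L2(2)] _ Bb] by auto
      have C: "?C \<in> L2" "nrm ?C \<le> 1 * nrm (FT (e n))"
        using L2_dominated[OF FL2(3) _ Cb] nrm_mono[OF FL2(3) _ Cb] by auto
      \<comment> \<open>By \<open>id\<close> the approximating transforms cancel. What remains does
        not depend on \<open>n\<close>, yet its norm is bounded by quantities tending to 0.\<close>
      have eq: "(\<lambda>\<xi>. ?B \<xi> - ?A \<xi> - ?C \<xi>) = ?d"
        unfolding id by (simp add: fun_eq_iff algebra_simps)
      have "?B \<in> L2 \<Longrightarrow> (\<lambda>\<xi>. ?B \<xi> - ?A \<xi> - ?C \<xi>) \<in> L2"
        by (intro L2_diff A B C)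
      then show "?d \<in> L2" using B(1) unfolding eq by simp
      have "nrm (\<lambda>\<xi>. ?B \<xi> - ?A \<xi> - ?C \<xi>) \<le> nrm (\<lambda>\<xi>. ?B \<xi> - ?A \<xi>) + nrm ?C"
        using nrm_triangle_diff[OF L2_diff[OF B(1) A(1)] L2_zero C(1)] nrm_minus_commute[of "\<lambda>_. 0" ?C] by simp
      moreover have "nrm (\<lambda>\<xi>. ?B \<xi> - ?A \<xi>) \<le> nrm ?B + nrm ?A"
        using nrm_triangle_diff[OF B(1) L2_zero A(1)] nrm_minus_commute[of "\<lambda>_. 0" ?A] by simp
      ultimately show "nrm ?d \<le> nrm (\<lambda>x. FT (?g n) x - G x) + real K * nrm (\<lambda>x. FT (?f n) x - F x) + nrm (FT (e n))"
        unfolding eq using A(2) B(2) C(2) by linarith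
    qed
    have "(\<lambda>n. nrm (\<lambda>x. FT (?g n) x - G x) + real K * nrm (\<lambda>x. FT (?f n) x - F x) + nrm (FT (e n))) \<longlonglongrightarrow> 0 + real K * 0 + 0"
      by (intro tendsto_intros flim glim elim)
    then have "nrm ?d \<le> 0 + real K * 0 + 0"
      using bnd by (intro tendsto_lowerbound) auto
    then have "nrm ?d = 0" using nrm_nonneg[of ?d] by linarith
    then have "AE \<xi> in lborel. ?d \<xi> = 0"
      using nrm_eq_0_iff[OF dL2] by simp
    then show ?thesis by eventually_elim (auto simp: indicator_def split: if_splits)
  qed
  then have "AE \<xi> in lborel. \<forall>K. \<xi> \<in> {- real K..real K} \<longrightarrow> G \<xi> = \<i> * complex_of_real \<xi> * F \<xi>"
    unfolding AE_all_countable ..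
  then show ?thesis
  proof eventually_elim
    fix \<xi> :: real assume *: "\<forall>K. \<xi> \<in> {- real K..real K} \<longrightarrow> G \<xi> = \<i> * complex_of_real \<xi> * F \<xi>"
    obtain K :: nat where "\<bar>\<xi>\<bar> \<le> real K" using real_arch_simple by blast
    then show "G \<xi> = \<i> * complex_of_real \<xi> * F \<xi>" using * by (auto simp: abs_le_iff)
  qed
qed

text \<open>Integration by parts on an interval large enough for the test function to vanish at both
  ends.\<close>

lemma is_weak_deriv_L2_classical:
  assumes D: "\<And>x. (f has_vector_derivative f' x) (at x)" and cont: "continuous_on UNIV f'" and L2: "f' \<in> L2"
  shows "is_weak_deriv_L2 f f'"
  unfolding is_weak_deriv_L2_def
proof (intro conjI allI impI L2)
  fix \<phi> assume "test_function \<phi>"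
  then obtain \<phi>' where \<phi>': "\<And>x. (\<phi> has_vector_derivative \<phi>' x) (at x)" "continuous_on UNIV \<phi>'"
    and comp: "compact (closure {x. \<phi> x \<noteq> 0})"
    by (auto simp: test_function_def C1_differentiable_on_def)
  obtain K where K: "0 < K" "\<And>x. \<phi> x \<noteq> 0 \<Longrightarrow> \<bar>x\<bar> \<le> K"
  proof -
    have "bounded {x. \<phi> x \<noteq> 0}"
      using compact_imp_bounded[OF comp] by (rule bounded_subset) (rule closure_subset)
    then show thesis
      using that by (auto simp: bounded_pos)
  qed
  have vd: "vector_derivative \<phi> (at x) = \<phi>' x" for x
    using \<phi>'(1) by (rule vector_derivative_at)
  have \<phi>'0: "\<phi>' x = 0" if "\<bar>x\<bar> > K" for x
  proof -
    have "((\<lambda>_. 0) has_vector_derivative 0) (at x)" by simp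
    then have "(\<phi> has_vector_derivative 0) (at x)"
      by (rule has_vector_derivative_transform_within_open[of _ _ _ "{x. K < \<bar>x\<bar>}"])
        (use that K(2) in \<open>auto intro!: open_Collect_less continuous_intros simp: not_less[symmetric]\<close>)
    then show ?thesis
      using \<phi>'(1)[of x] vector_derivative_unique_at by blast
  qed
  \<comment> \<open>\<open>K\<close> only bounds the points where \<open>\<phi>\<close> is nonzero;
    at distance \<open>K + 1\<close> the boundary values are certainly 0.\<close>
  let ?S = "{- (K + 1)..K + 1}"
  have contf: "continuous_on UNIV f" and cont\<phi>: "continuous_on UNIV \<phi>"
    using D \<phi>'(1) by (auto intro!: continuous_at_imp_continuous_on has_vector_derivative_continuous)
  have ind: "(\<lambda>x. f x * \<phi>' x) = (\<lambda>x. indicator ?S x *\<^sub>R (f x * \<phi>' x))"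
      "(\<lambda>x. f' x * \<phi> x) = (\<lambda>x. indicator ?S x *\<^sub>R (f' x * \<phi> x))"
    using \<phi>'0 K by (fastforce simp: indicator_def fun_eq_iff)+
  have int: "integrable lborel (\<lambda>x. indicator ?S x *\<^sub>R (f x * \<phi>' x))" "integrable lborel (\<lambda>x. indicator ?S x *\<^sub>R (f' x * \<phi> x))"
    by (intro borel_integrable_compact compact_Icc continuous_intros
        continuous_on_subset[OF contf] continuous_on_subset[OF cont] continuous_on_subset[OF cont\<phi>] continuous_on_subset[OF \<phi>'(2)] subset_UNIV)+
  have "(LINT x|lborel. indicator ?S x *\<^sub>R (f x * \<phi>' x + f' x * \<phi> x)) = f (K + 1) * \<phi> (K + 1) - f (- (K + 1)) * \<phi> (- (K + 1))"
  proof (rule integral_FTC_Icc)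
    show "((\<lambda>x. f x * \<phi> x) has_vector_derivative f x * \<phi>' x + f' x * \<phi> x) (at x within ?S)" for x
      by (rule has_vector_derivative_at_within[OF has_vector_derivative_mult[OF D \<phi>'(1)]])
    show "continuous_on ?S (\<lambda>x. f x * \<phi>' x + f' x * \<phi> x)"
      by (intro continuous_intros
        continuous_on_subset[OF contf] continuous_on_subset[OF cont] continuous_on_subset[OF cont\<phi>] continuous_on_subset[OF \<phi>'(2)] subset_UNIV)
  qed (use K in simp)
  also have "\<dots> = 0"
  proof -
    have "\<phi> (K + 1) = 0" "\<phi> (- (K + 1)) = 0"
      using K(2)[of "K + 1"] K(2)[of "- (K + 1)"] K(1) by linarith+
    then show ?thesis by simp
  qed
  also have "(LINT x|lborel. indicator ?S x *\<^sub>R (f x * \<phi>' x + f' x * \<phi> x))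
      = (LINT x|lborel. indicator ?S x *\<^sub>R (f x * \<phi>' x)) + (LINT x|lborel. indicator ?S x *\<^sub>R (f' x * \<phi> x))"
    unfolding scaleR_add_right by (rule Bochner_Integration.integral_add[OF int])
  finally show "(LINT x|lborel. f x * vector_derivative \<phi> (at x)) = - (LINT x|lborel. f' x * \<phi> x)"
    unfolding vd ind[symmetric] by (simp add: eq_neg_iff_add_eq_0)
qed

section \<open>Triple convolutions and slices\<close>

abbreviation lborel2 :: "(real \<times> real) measure" where "lborel2 \<equiv> lborel \<Otimes>\<^sub>M lborel"

interpretation lborel_triple: pair_sigma_finite "lborel :: real measure" lborel2
  by (intro pair_sigma_finite.intro sigma_finite_lborel lborel_pair.P.sigma_finite_measure_axioms)

text \<open>Coordinates adapted to convolution: \<open>\<xi>\<close> is the total frequency and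
  \<open>p\<close> holds the last two of the three frequencies, so integrating over \<open>p\<close>
  gives the triple convolution at \<open>\<xi>\<close>. The type is generic because both complex
  spectra and real moment densities are inserted.\<close>

definition triple :: "(real \<Rightarrow> 'a::times) \<Rightarrow> (real \<Rightarrow> 'a) \<Rightarrow> (real \<Rightarrow> 'a) \<Rightarrow> real \<Rightarrow> real \<times> real \<Rightarrow> 'a" where
  "triple A B C \<xi> p = A (\<xi> - fst p - snd p) * B (fst p) * C (snd p)"

lemma measurable_triple [measurable]:
  fixes A B C :: "real \<Rightarrow> 'a :: {real_normed_field, banach, second_countable_topology}"
  assumes [measurable]: "A \<in> borel_measurable borel" "B \<in> borel_measurable borel" "C \<in> borel_measurable borel"
  shows "(\<lambda>(\<xi>, p). triple A B C \<xi> p) \<in> borel_measurable (lborel \<Otimes>\<^sub>M lborel2)"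
    "triple A B C \<xi> \<in> borel_measurable lborel2"
  unfolding triple_def[abs_def] by measurable

lemma integral_pair_mult:
  fixes f g :: "real \<Rightarrow> 'a :: {real_normed_field, banach, second_countable_topology}"
  assumes "integrable lborel f" "integrable lborel g"
  shows "(LINT p|lborel2. f (fst p) * g (snd p)) = (LINT x|lborel. f x) * (LINT y|lborel. g y)"
proof -
  have "(LINT p|lborel2. f (fst p) * g (snd p)) = (LINT x|lborel. LINT y|lborel. f x * g y)"
    using lborel_pair.integral_fst[of "\<lambda>x y. f x * g y"] integrable_pair_mult[OF assms]
    by (simp add: case_prod_beta')
  then show ?thesis by simp
qed

text \<open>Integrating over \<open>\<xi>\<close> first decouples the factors: for fixed
  \<open>p\<close> the first factor is a translate, whose integral does not depend on
  \<open>p\<close>.\<close>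

lemma
  fixes A B C :: "real \<Rightarrow> 'a :: {real_normed_field, banach, second_countable_topology}"
  assumes A: "integrable lborel A" and B: "integrable lborel B" and C: "integrable lborel C"
  shows integrable_triple: "integrable (lborel \<Otimes>\<^sub>M lborel2) (\<lambda>(\<xi>, p). triple A B C \<xi> p)"
    and integral_triple: "integral\<^sup>L (lborel \<Otimes>\<^sub>M lborel2) (\<lambda>(\<xi>, p). triple A B C \<xi> p)
      = (LINT x|lborel. A x) * (LINT x|lborel. B x) * (LINT x|lborel. C x)"
proof -
  have [measurable]: "A \<in> borel_measurable borel" "B \<in> borel_measurable borel" "C \<in> borel_measurable borel"
    using A B C by auto
  interpret swap: pair_sigma_finite lborel2 "lborel :: real measure"
    by (intro pair_sigma_finite.intro sigma_finite_lborel lborel_pair.P.sigma_finite_measure_axioms)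
  have shift: "(LINT \<xi>|lborel. f (\<xi> - a - b)) = (LINT \<xi>|lborel. f \<xi>)"
    for f :: "real \<Rightarrow> 'b :: {banach, second_countable_topology}" and a b
    using integral_translate[of f "- a - b"] by (simp add: algebra_simps)
  have BC: "integrable lborel2 (\<lambda>p. B (fst p) * C (snd p))"
    using integrable_pair_mult[OF B C] by (simp add: case_prod_beta')
  have shifti: "integrable lborel (\<lambda>\<xi>. A (\<xi> - a - b))" for a b
    using integrable_translate[OF A, of "- a - b"] by (simp add: algebra_simps)
  have int: "integrable (lborel2 \<Otimes>\<^sub>M lborel) (\<lambda>(p, \<xi>). triple A B C \<xi> p)"
  proof (rule swap.Fubini_integrable)
    have "(LINT \<xi>|lborel. norm (triple A B C \<xi> p)) = (LINT x|lborel. norm (A x)) * norm (B (fst p) * C (snd p))" for p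
      using shift[of "\<lambda>x. norm (A x)"] by (simp add: triple_def norm_mult mult.assoc)
    then show "integrable lborel2 (\<lambda>p. LINT \<xi>|lborel. norm (case (p, \<xi>) of (p, \<xi>) \<Rightarrow> triple A B C \<xi> p))"
      using BC by simp
    show "AE p in lborel2. integrable lborel (\<lambda>\<xi>. case (p, \<xi>) of (p, \<xi>) \<Rightarrow> triple A B C \<xi> p)"
      using shifti by (simp add: triple_def)
  qed (simp add: triple_def[abs_def])
  then show int': "integrable (lborel \<Otimes>\<^sub>M lborel2) (\<lambda>(\<xi>, p). triple A B C \<xi> p)"
    using swap.integrable_product_swap[OF int] by (simp add: case_prod_beta')
  have "integral\<^sup>L (lborel \<Otimes>\<^sub>M lborel2) (\<lambda>(\<xi>, p). triple A B C \<xi> p) = (LINT p|lborel2. LINT \<xi>|lborel. triple A B C \<xi> p)"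
    using lborel_triple.integral_snd[OF int'] by simp
  also have "\<dots> = (LINT p|lborel2. (LINT x|lborel. A x) * (B (fst p) * C (snd p)))"
    using shift[of A] by (simp add: triple_def mult.assoc)
  also have "\<dots> = (LINT x|lborel. A x) * ((LINT x|lborel. B x) * (LINT x|lborel. C x))"
    using integral_pair_mult[OF B C] by simp
  finally show "integral\<^sup>L (lborel \<Otimes>\<^sub>M lborel2) (\<lambda>(\<xi>, p). triple A B C \<xi> p)
      = (LINT x|lborel. A x) * (LINT x|lborel. B x) * (LINT x|lborel. C x)"
    by (simp add: mult.assoc)
qed

text \<open>The exponential at \<open>\<xi>\<close> splits along
  \<open>\<xi> = (\<xi> - s - t) + s + t\<close>, so it can be absorbed into the three factors
  before the integral is factorised.\<close>

lemma FT_triple: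
  assumes A: "integrable lborel A" and B: "integrable lborel B" and C: "integrable lborel C"
  shows "integrable lborel (\<lambda>\<xi>. LINT p|lborel2. triple A B C \<xi> p)"
    and "FT (\<lambda>\<xi>. LINT p|lborel2. triple A B C \<xi> p) x = FT A x * FT B x * FT C x"
proof -
  show "integrable lborel (\<lambda>\<xi>. LINT p|lborel2. triple A B C \<xi> p)"
    by (rule lborel_triple.integrable_fst[OF integrable_triple[OF assms]])
  let ?e = "\<lambda>x y. exp (- (\<i> * complex_of_real (y * x)))"
  have "FT (\<lambda>\<xi>. LINT p|lborel2. triple A B C \<xi> p) x
      = (LINT \<xi>|lborel. LINT p|lborel2. triple (\<lambda>y. ?e x y * A y) (\<lambda>y. ?e x y * B y) (\<lambda>y. ?e x y * C y) \<xi> p)"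
  proof -
    have "?e x \<xi> * triple A B C \<xi> p = triple (\<lambda>y. ?e x y * A y) (\<lambda>y. ?e x y * B y) (\<lambda>y. ?e x y * C y) \<xi> p" for \<xi> p
    proof -
      have "?e x \<xi> = ?e x (\<xi> - fst p - snd p) * ?e x (fst p) * ?e x (snd p)"
        unfolding exp_add[symmetric] by (simp add: algebra_simps)
      then show ?thesis unfolding triple_def by (simp only: ac_simps)
    qed
    then show ?thesis
      unfolding FT_def integral_mult_right_zero[symmetric] by simp
  qed
  also have "\<dots> = FT A x * FT B x * FT C x"
    using lborel_triple.integral_fst[OF integrable_triple[OF assms[THEN integrable_exp_mult, of x]]]
      integral_triple[OF assms[THEN integrable_exp_mult, of x]]
    by (simp add: FT_def)
  finally show "FT (\<lambda>\<xi>. LINT p|lborel2. triple A B C \<xi> p) x = FT A x * FT B x * FT C x" .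
qed

definition slice :: "real \<Rightarrow> (real \<times> real) set" where
  "slice \<xi> = {p. 0 < fst p \<and> 0 < snd p \<and> fst p + snd p < \<xi>}"

lemma slice_measurable [measurable]: "slice \<xi> \<in> sets lborel2"
proof -
  have "slice \<xi> = {p \<in> space lborel2. 0 < fst p \<and> 0 < snd p \<and> fst p + snd p < \<xi>}"
    by (simp add: slice_def space_pair_measure)
  also have "\<dots> \<in> sets lborel2" by measurable
  finally show ?thesis .
qed

lemma emeasure_slice: "emeasure lborel2 (slice \<xi>) = ennreal ((max 0 \<xi>)\<^sup>2 / 2)"
proof -
  have "emeasure lborel2 (slice \<xi>) = (\<integral>\<^sup>+s. emeasure lborel (Pair s -` slice \<xi>) \<partial>lborel)"
    by (rule lborel.emeasure_pair_measure_alt) measurable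
  also have "\<dots> = (\<integral>\<^sup>+s. ennreal (max 0 \<xi> - s) * indicator {0..max 0 \<xi>} s \<partial>lborel)"
  proof (rule nn_integral_cong_AE)
    \<comment> \<open>The closed interval on the right disagrees with the open triangle at
      \<open>s = 0\<close>, hence the equality almost everywhere; \<open>max 0 \<xi>\<close> covers
      the empty triangle.\<close>
    show "AE s in lborel. emeasure lborel (Pair s -` slice \<xi>) = ennreal (max 0 \<xi> - s) * indicator {0..max 0 \<xi>} s"
      using AE_lborel_singleton[of 0]
    proof eventually_elim
      fix s :: real assume "s \<noteq> 0"
      have "Pair s -` slice \<xi> = (if 0 < s \<and> s < \<xi> then {0<..<\<xi> - s} else {})"
        by (auto simp: slice_def)
      with \<open>s \<noteq> 0\<close> show "emeasure lborel (Pair s -` slice \<xi>) = ennreal (max 0 \<xi> - s) * indicator {0..max 0 \<xi>} s"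
        by (auto simp: indicator_def max_def)
    qed
  qed
  also have "\<dots> = ennreal ((\<lambda>s. max 0 \<xi> * s - s\<^sup>2 / 2) (max 0 \<xi>) - (\<lambda>s. max 0 \<xi> * s - s\<^sup>2 / 2) 0)"
    by (intro nn_integral_FTC_Icc) (auto intro!: derivative_eq_intros)
  also have "\<dots> = ennreal ((max 0 \<xi>)\<^sup>2 / 2)"
    by (simp add: power2_eq_square)
  finally show ?thesis .
qed

lemma triple_outside_slice:
  fixes A B C :: "real \<Rightarrow> 'a :: mult_zero"
  assumes "\<And>x. x \<le> 0 \<Longrightarrow> A x = 0" "\<And>x. x \<le> 0 \<Longrightarrow> B x = 0" "\<And>x. x \<le> 0 \<Longrightarrow> C x = 0" "p \<notin> slice \<xi>"
  shows "triple A B C \<xi> p = 0"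
  using assms by (auto simp: triple_def slice_def not_less)

text \<open>The equality case of the Cauchy--Schwarz inequality on a set of finite measure, in the form
  of a variance identity.\<close>

lemma integral_variance:
  fixes \<phi> :: "'a \<Rightarrow> complex"
  assumes [measurable]: "\<phi> \<in> borel_measurable M" "S \<in> sets M" and m: "emeasure M S = ennreal m" "0 < m"
    and supp: "\<And>x. x \<notin> S \<Longrightarrow> \<phi> x = 0" and sq: "integrable M (\<lambda>x. (norm (\<phi> x))\<^sup>2)"
  defines "k \<equiv> (LINT x|M. \<phi> x) / complex_of_real m"
  shows "integrable M (\<lambda>x. (norm (\<phi> x - k * indicator S x))\<^sup>2)"
    and "(norm (LINT x|M. \<phi> x))\<^sup>2 + m * (LINT x|M. (norm (\<phi> x - k * indicator S x))\<^sup>2) = m * (LINT x|M. (norm (\<phi> x))\<^sup>2)"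
proof -
  have S: "integrable M (indicator S :: 'a \<Rightarrow> real)"
    using m by (intro integrable_real_indicator) auto
  have \<phi>: "integrable M \<phi>"
  proof (rule Bochner_Integration.integrable_bound)
    show "integrable M (\<lambda>x. (norm (\<phi> x))\<^sup>2 + indicator S x)"
      using sq S by simp
    have "norm (\<phi> x) \<le> (norm (\<phi> x))\<^sup>2 + indicator S x" for x
    proof (cases "x \<in> S")
      case True
      have "norm (\<phi> x) \<le> (norm (\<phi> x))\<^sup>2 + 1"
        using sum_squares_bound[of "norm (\<phi> x)" 1, unfolded power_one mult_1_right] zero_le_power2[of "norm (\<phi> x)"] norm_ge_zero[of "\<phi> x"] by linarith
      then show ?thesis using True by simp
    qed (simp add: supp)
    then show "AE x in M. norm (\<phi> x) \<le> norm ((norm (\<phi> x))\<^sup>2 + indicator S x)"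
      by (intro AE_I2) (auto simp: indicator_def)
  qed simp
  define I where "I = (LINT x|M. \<phi> x)"
  \<comment> \<open>Since \<open>k\<close> is the mean over \<open>S\<close>, integrating the last
    two terms gives \<open>- 2 * |I|^2 / m + |I|^2 / m\<close>, which leaves the squared mean to be
    moved to the other side.\<close>
  have ptw: "(norm (\<phi> x - k * indicator S x))\<^sup>2 = (norm (\<phi> x))\<^sup>2 - 2 * Re (\<phi> x * cnj k) + (norm k)\<^sup>2 * indicator S x" for x
  proof (cases "x \<in> S")
    case True
    have "complex_of_real ((norm (\<phi> x - k))\<^sup>2) = complex_of_real ((norm (\<phi> x))\<^sup>2) - (\<phi> x * cnj k + cnj (\<phi> x * cnj k)) + complex_of_real ((norm k)\<^sup>2)"
      unfolding complex_norm_square by (simp add: algebra_simps)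
    also have "\<phi> x * cnj k + cnj (\<phi> x * cnj k) = complex_of_real (2 * Re (\<phi> x * cnj k))"
      by (rule complex_add_cnj)
    finally have "(norm (\<phi> x - k))\<^sup>2 = (norm (\<phi> x))\<^sup>2 - 2 * Re (\<phi> x * cnj k) + (norm k)\<^sup>2"
      by (simp only: of_real_diff[symmetric] of_real_add[symmetric] of_real_eq_iff)
    then show ?thesis using True by simp
  qed (simp add: supp)
  have int: "integrable M (\<lambda>x. 2 * Re (\<phi> x * cnj k))" "integrable M (\<lambda>x. (norm k)\<^sup>2 * indicator S x)"
    using \<phi> S by simp_all
  then show "integrable M (\<lambda>x. (norm (\<phi> x - k * indicator S x))\<^sup>2)"
    unfolding ptw using sq by simp
  have "(LINT x|M. (norm (\<phi> x - k * indicator S x))\<^sup>2)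
      = (LINT x|M. (norm (\<phi> x))\<^sup>2) - (LINT x|M. 2 * Re (\<phi> x * cnj k)) + (LINT x|M. (norm k)\<^sup>2 * indicator S x)"
    unfolding ptw using sq int by simp
  also have "(LINT x|M. 2 * Re (\<phi> x * cnj k)) = 2 * Re (I * cnj k)"
    using \<phi> by (simp add: I_def)
  also have "I * cnj k = complex_of_real ((norm I)\<^sup>2 / m)"
    unfolding k_def I_def[symmetric] of_real_divide complex_norm_square by simp
  also have "(LINT x|M. (norm k)\<^sup>2 * indicator S x) = (norm k)\<^sup>2 * m"
    using m by (simp add: measure_def)
  also have "(norm k)\<^sup>2 * m = (norm I)\<^sup>2 / m"
    using m by (simp add: k_def I_def norm_divide power_divide power2_eq_square)
  finally show "(norm (LINT x|M. \<phi> x))\<^sup>2 + m * (LINT x|M. (norm (\<phi> x - k * indicator S x))\<^sup>2) = m * (LINT x|M. (norm (\<phi> x))\<^sup>2)"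
    using m by (simp add: I_def right_diff_distrib distrib_left)
qed

section \<open>The sharp inequality\<close>

text \<open>The support condition holds at every point and includes 0, so products over
  non-admissible frequencies vanish exactly and not merely almost everywhere. Integrability of
  \<open>F\<close> makes \<open>FT F\<close> a pointwise object.\<close>

locale positive_spectrum =
  fixes F :: "real \<Rightarrow> complex"
  assumes F_integrable: "integrable lborel F" and F_L2: "F \<in> L2"
    and F_supp: "x \<le> 0 \<Longrightarrow> F x = 0"
    and F_moment: "integrable lborel (\<lambda>x. x\<^sup>2 * (norm (F x))\<^sup>2)"
begin

lemma F_measurable [measurable]: "F \<in> borel_measurable borel"
  using F_L2 by (rule L2_measurable)

definition moment :: "nat \<Rightarrow> real" where "moment k = (LINT x|lborel. x ^ k * (norm (F x))\<^sup>2)"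

definition \<Phi> :: "real \<Rightarrow> real \<times> real \<Rightarrow> complex" where "\<Phi> = triple F F F"

text \<open>The triple convolution of \<open>F\<close> with itself. Its transform is the cube of
  \<open>FT F\<close>, so its L^2 norm carries the sixth power of the L^6 norm.\<close>

definition H :: "real \<Rightarrow> complex" where "H \<xi> = (LINT p|lborel2. \<Phi> \<xi> p)"

definition total :: real where "total = 3 * moment 2 * (moment 0)\<^sup>2 + 6 * (moment 1)\<^sup>2 * moment 0"

lemma integrable_moment:
  assumes "k \<le> 2" shows "integrable lborel (\<lambda>x. x ^ k * (norm (F x))\<^sup>2)"
proof (rule Bochner_Integration.integrable_bound)
  show "integrable lborel (\<lambda>x. (norm (F x))\<^sup>2 + x\<^sup>2 * (norm (F x))\<^sup>2)"
    using F_L2 F_moment by (simp add: L2_iff)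
  have "\<bar>x\<bar> ^ k \<le> 1 + x\<^sup>2" for x :: real
  proof (cases "\<bar>x\<bar> \<le> 1")
    case True
    then have "\<bar>x\<bar> ^ k \<le> 1" by (simp add: power_le_one)
    then show ?thesis by (simp add: add_increasing2)
  next
    case False
    then have "\<bar>x\<bar> ^ k \<le> \<bar>x\<bar> ^ 2" using assms by (intro power_increasing) auto
    then show ?thesis by simp
  qed
  from mult_right_mono[OF this, of "(norm (F x))\<^sup>2" for x]
  show "AE x in lborel. norm (x ^ k * (norm (F x))\<^sup>2) \<le> norm ((norm (F x))\<^sup>2 + x\<^sup>2 * (norm (F x))\<^sup>2)"
    by (intro AE_I2) (simp add: abs_mult power_abs distrib_right)
qed simp

lemma \<Phi>_measurable [measurable]: "(\<lambda>(\<xi>, p). \<Phi> \<xi> p) \<in> borel_measurable (lborel \<Otimes>\<^sub>M lborel2)" "\<Phi> \<xi> \<in> borel_measurable lborel2"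
  unfolding \<Phi>_def by measurable

lemma \<Phi>_outside: "p \<notin> slice \<xi> \<Longrightarrow> \<Phi> \<xi> p = 0"
  unfolding \<Phi>_def by (rule triple_outside_slice) (auto intro: F_supp)

lemma H_integrable: "integrable lborel H" and FT_H: "FT H x = FT F x ^ 3"
  using FT_triple[OF F_integrable F_integrable F_integrable]
  by (auto simp: H_def[abs_def] \<Phi>_def power3_eq_cube)

text \<open>Writing \<open>\<xi>\<close> as the sum of the three frequencies and squaring turns the
  weight into six products of moment densities, each of which factorises by
  \<open>integral_triple\<close>.\<close>

lemma
  shows integrable_weighted: "integrable (lborel \<Otimes>\<^sub>M lborel2) (\<lambda>(\<xi>, p). \<xi>\<^sup>2 * (norm (\<Phi> \<xi> p))\<^sup>2)"
    and integral_weighted: "integral\<^sup>L (lborel \<Otimes>\<^sub>M lborel2) (\<lambda>(\<xi>, p). \<xi>\<^sup>2 * (norm (\<Phi> \<xi> p))\<^sup>2) = total"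
proof -
  define G where "G k x = x ^ k * (norm (F x))\<^sup>2" for k x
  have G: "integrable lborel (G k)" if "k \<le> 2" for k
    using integrable_moment[OF that] by (simp add: G_def[abs_def])
  let ?T = "\<lambda>i j k (\<xi>, p). triple (G i) (G j) (G k) \<xi> p"
  have T: "integrable (lborel \<Otimes>\<^sub>M lborel2) (?T i j k)"
      "integral\<^sup>L (lborel \<Otimes>\<^sub>M lborel2) (?T i j k) = moment i * moment j * moment k"
    if "i \<le> 2" "j \<le> 2" "k \<le> 2" for i j k
    using integrable_triple[OF that[THEN G]] integral_triple[OF that[THEN G]] by (simp_all add: moment_def G_def)
  have eq: "(\<lambda>(\<xi>, p). \<xi>\<^sup>2 * (norm (\<Phi> \<xi> p))\<^sup>2) = (\<lambda>x. ?T 2 0 0 x + ?T 0 2 0 x + ?T 0 0 2 x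
      + 2 * ?T 1 1 0 x + 2 * ?T 0 1 1 x + 2 * ?T 1 0 1 x)"
  proof -
    have "\<xi>\<^sup>2 * (norm (\<Phi> \<xi> (s, t)))\<^sup>2 = (\<lambda>x. ?T 2 0 0 x + ?T 0 2 0 x + ?T 0 0 2 x
      + 2 * ?T 1 1 0 x + 2 * ?T 0 1 1 x + 2 * ?T 1 0 1 x) (\<xi>, s, t)" for \<xi> s t
      unfolding \<Phi>_def triple_def G_def norm_mult power_mult_distrib
      by (simp add: power2_eq_square algebra_simps)
    then show ?thesis by (auto simp: fun_eq_iff)
  qed
  show "integrable (lborel \<Otimes>\<^sub>M lborel2) (\<lambda>(\<xi>, p). \<xi>\<^sup>2 * (norm (\<Phi> \<xi> p))\<^sup>2)"
    unfolding eq by (intro Bochner_Integration.integrable_add integrable_mult_right T) auto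
  have "integral\<^sup>L (lborel \<Otimes>\<^sub>M lborel2) (\<lambda>x. ?T 2 0 0 x + ?T 0 2 0 x + ?T 0 0 2 x
      + 2 * ?T 1 1 0 x + 2 * ?T 0 1 1 x + 2 * ?T 1 0 1 x)
      = integral\<^sup>L (lborel \<Otimes>\<^sub>M lborel2) (?T 2 0 0) + integral\<^sup>L (lborel \<Otimes>\<^sub>M lborel2) (?T 0 2 0) + integral\<^sup>L (lborel \<Otimes>\<^sub>M lborel2) (?T 0 0 2)
      + 2 * integral\<^sup>L (lborel \<Otimes>\<^sub>M lborel2) (?T 1 1 0) + 2 * integral\<^sup>L (lborel \<Otimes>\<^sub>M lborel2) (?T 0 1 1) + 2 * integral\<^sup>L (lborel \<Otimes>\<^sub>M lborel2) (?T 1 0 1)"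
    using T by simp
  also have "\<dots> = total"
    using T by (simp add: total_def power2_eq_square)
  finally show "integral\<^sup>L (lborel \<Otimes>\<^sub>M lborel2) (\<lambda>(\<xi>, p). \<xi>\<^sup>2 * (norm (\<Phi> \<xi> p))\<^sup>2) = total"
    unfolding eq .
qed

definition Q :: "real \<Rightarrow> real" where "Q \<xi> = (LINT p|lborel2. (norm (\<Phi> \<xi> p))\<^sup>2)"

lemma
  shows Q_integrable: "integrable lborel (\<lambda>\<xi>. \<xi>\<^sup>2 / 2 * Q \<xi>)"
    and Q_integral: "(LINT \<xi>|lborel. \<xi>\<^sup>2 / 2 * Q \<xi>) = total / 2"
    and AE_slice_integrable: "AE \<xi> in lborel. integrable lborel2 (\<lambda>p. (norm (\<Phi> \<xi> p))\<^sup>2)"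
proof -
  have "integrable lborel (\<lambda>\<xi>. \<xi>\<^sup>2 * Q \<xi>)"
    using lborel_triple.integrable_fst[OF integrable_weighted] by (simp add: Q_def)
  then show "integrable lborel (\<lambda>\<xi>. \<xi>\<^sup>2 / 2 * Q \<xi>)" by simp
  have "(LINT \<xi>|lborel. \<xi>\<^sup>2 * Q \<xi>) = total"
    using lborel_triple.integral_fst[OF integrable_weighted] integral_weighted by (simp add: Q_def)
  then show "(LINT \<xi>|lborel. \<xi>\<^sup>2 / 2 * Q \<xi>) = total / 2" by simp
  \<comment> \<open>Fubini gives integrability of the slice with the weight \<open>\<xi>^2\<close>;
    the weight can be divided out except at \<open>\<xi> = 0\<close>, a null set.\<close>
  show "AE \<xi> in lborel. integrable lborel2 (\<lambda>p. (norm (\<Phi> \<xi> p))\<^sup>2)"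
    using lborel_triple.AE_integrable_fst[OF integrable_weighted] AE_lborel_singleton[of 0]
    by eventually_elim simp
qed

text \<open>Both claims are read off one identity: the deficit in Cauchy-Schwarz equals the area
  times the integrated squared distance of \<open>\<Phi> \<xi>\<close> from its mean on the
  triangle.\<close>

lemma AE_slice_identity:
  "AE \<xi> in lborel. (norm (H \<xi>))\<^sup>2 \<le> \<xi>\<^sup>2 / 2 * Q \<xi> \<and>
    ((norm (H \<xi>))\<^sup>2 = \<xi>\<^sup>2 / 2 * Q \<xi> \<longrightarrow> (\<exists>k. AE p in lborel2. \<Phi> \<xi> p = k * indicator (slice \<xi>) p))"
  using AE_slice_integrable
proof eventually_elim
  fix \<xi> assume sq: "integrable lborel2 (\<lambda>p. (norm (\<Phi> \<xi> p))\<^sup>2)"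
  show "(norm (H \<xi>))\<^sup>2 \<le> \<xi>\<^sup>2 / 2 * Q \<xi> \<and>
    ((norm (H \<xi>))\<^sup>2 = \<xi>\<^sup>2 / 2 * Q \<xi> \<longrightarrow> (\<exists>k. AE p in lborel2. \<Phi> \<xi> p = k * indicator (slice \<xi>) p))"
  proof (cases "0 < \<xi>")
    case False
    then have "slice \<xi> = {}" by (auto simp: slice_def)
    then have "\<Phi> \<xi> p = 0" for p using \<Phi>_outside[of p \<xi>] by simp
    then show ?thesis by (auto simp: H_def Q_def)
  next
    case True
    let ?m = "\<xi>\<^sup>2 / 2" and ?k = "H \<xi> / complex_of_real (\<xi>\<^sup>2 / 2)"
    have m: "emeasure lborel2 (slice \<xi>) = ennreal ?m" "0 < ?m"
      using True by (simp_all add: emeasure_slice)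
    note var = integral_variance[OF _ slice_measurable m \<Phi>_outside sq, folded H_def Q_def]
    have int: "integrable lborel2 (\<lambda>p. (norm (\<Phi> \<xi> p - ?k * indicator (slice \<xi>) p))\<^sup>2)"
      by (rule var(1)) measurable
    have id: "(norm (H \<xi>))\<^sup>2 + ?m * (LINT p|lborel2. (norm (\<Phi> \<xi> p - ?k * indicator (slice \<xi>) p))\<^sup>2) = ?m * Q \<xi>"
      by (rule var(2)) measurable
    have nn: "0 \<le> (LINT p|lborel2. (norm (\<Phi> \<xi> p - ?k * indicator (slice \<xi>) p))\<^sup>2)"
      by simp
    have "(norm (H \<xi>))\<^sup>2 \<le> ?m * Q \<xi>"
      using id mult_nonneg_nonneg[OF less_imp_le[OF m(2)] nn] by linarith
    moreover have "AE p in lborel2. \<Phi> \<xi> p = ?k * indicator (slice \<xi>) p" if eq: "(norm (H \<xi>))\<^sup>2 = ?m * Q \<xi>"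
    proof -
      have "(LINT p|lborel2. (norm (\<Phi> \<xi> p - ?k * indicator (slice \<xi>) p))\<^sup>2) = 0"
        using id eq m(2) by simp
      then have "AE p in lborel2. (norm (\<Phi> \<xi> p - ?k * indicator (slice \<xi>) p))\<^sup>2 = 0"
        using integral_nonneg_eq_0_iff_AE[OF int] by simp
      then show ?thesis by eventually_elim simp
    qed
    ultimately show ?thesis by blast
  qed
qed

lemma H_L2: "H \<in> L2" and nrm_H_le: "(nrm H)\<^sup>2 \<le> total / 2"
proof -
  have [measurable]: "H \<in> borel_measurable borel" using H_integrable by auto
  have "integrable lborel (\<lambda>\<xi>. (norm (H \<xi>))\<^sup>2)"
    by (rule Bochner_Integration.integrable_bound[OF Q_integrable])
      (use AE_slice_identity in \<open>auto elim!: eventually_mono intro: order_trans[OF _ abs_ge_self]\<close>)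
  then show "H \<in> L2" by (simp add: L2_iff)
  then have "(nrm H)\<^sup>2 \<le> (LINT \<xi>|lborel. \<xi>\<^sup>2 / 2 * Q \<xi>)"
    unfolding nrm_square using AE_slice_identity Q_integrable
    by (intro integral_mono_AE) (auto simp: L2_iff elim!: eventually_mono)
  then show "(nrm H)\<^sup>2 \<le> total / 2" by (simp only: Q_integral)
qed

text \<open>The deficit is nonnegative with integral 0, so almost every slice is an equality case;
  \<open>k\<close> is then selected slice by slice by choice.\<close>

lemma equality_imp_factor:
  assumes eq: "(nrm H)\<^sup>2 = total / 2"
  obtains k where "AE \<xi> in lborel. AE p in lborel2. \<Phi> \<xi> p = k \<xi> * indicator (slice \<xi>) p"
proof -
  have int: "integrable lborel (\<lambda>\<xi>. \<xi>\<^sup>2 / 2 * Q \<xi> - (norm (H \<xi>))\<^sup>2)"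
    using Q_integrable L2_integrable_square[OF H_L2] by simp
  have "(LINT \<xi>|lborel. \<xi>\<^sup>2 / 2 * Q \<xi> - (norm (H \<xi>))\<^sup>2) = 0"
    using Q_integrable L2_integrable_square[OF H_L2] Q_integral eq by (simp add: nrm_square)
  then have "AE \<xi> in lborel. \<xi>\<^sup>2 / 2 * Q \<xi> - (norm (H \<xi>))\<^sup>2 = 0"
    using integral_nonneg_eq_0_iff_AE[OF int] AE_slice_identity by (auto elim!: eventually_mono)
  with AE_slice_identity have "AE \<xi> in lborel. \<exists>k. AE p in lborel2. \<Phi> \<xi> p = k * indicator (slice \<xi>) p"
    by eventually_elim simp
  then have "AE \<xi> in lborel. AE p in lborel2. \<Phi> \<xi> p = (SOME k. AE p in lborel2. \<Phi> \<xi> p = k * indicator (slice \<xi>) p) * indicator (slice \<xi>) p"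
    by eventually_elim (rule someI_ex)
  then show thesis by (rule that)
qed

text \<open>The converse, used to see that the candidates attain the bound: for a constant slice
  both sides of Cauchy-Schwarz are \<open>|k \<xi>|^2\<close> times the squared area.\<close>

lemma factor_imp_equality:
  assumes k: "\<And>\<xi> p. \<Phi> \<xi> p = k \<xi> * indicator (slice \<xi>) p"
  shows "(nrm H)\<^sup>2 = total / 2"
proof -
  have m: "measure lborel2 (slice \<xi>) = (max 0 \<xi>)\<^sup>2 / 2" for \<xi>
    by (simp add: measure_def emeasure_slice)
  have sp: "slice \<xi> \<inter> space lborel2 = slice \<xi>" for \<xi>
    by (simp add: space_pair_measure)
  have Hk: "H \<xi> = k \<xi> * complex_of_real (measure lborel2 (slice \<xi>))" for \<xi>
  proof -
    have "H \<xi> = k \<xi> * (LINT p|lborel2. complex_of_real (indicator (slice \<xi>) p))"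
      unfolding H_def k by (simp add: of_real_indicator)
    then show ?thesis by (simp add: sp)
  qed
  have Qk: "Q \<xi> = (norm (k \<xi>))\<^sup>2 * measure lborel2 (slice \<xi>)" for \<xi>
  proof -
    have "(norm (\<Phi> \<xi> p))\<^sup>2 = (norm (k \<xi>))\<^sup>2 * indicator (slice \<xi>) p" for p
      unfolding k by (simp add: norm_mult indicator_def)
    then show ?thesis unfolding Q_def by (simp add: sp)
  qed
  have "(norm (H \<xi>))\<^sup>2 = \<xi>\<^sup>2 / 2 * Q \<xi>" for \<xi>
  proof (cases "0 \<le> \<xi>")
    case True
    then show ?thesis
      unfolding Hk Qk norm_mult m by (simp add: power2_eq_square norm_mult norm_divide)
  next
    case False
    then show ?thesis unfolding Hk Qk m by simp
  qed
  then show ?thesis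
    unfolding nrm_square by (simp only: Q_integral)
qed

text \<open>The sixth power of \<open>FT F\<close> is the square of the transform of
  \<open>H\<close>, so Plancherel applies to \<open>H\<close>.\<close>

lemma integral_FT_power6:
  shows "integrable lborel (\<lambda>x. norm (FT F x) ^ 6)" "(LINT x|lborel. norm (FT F x) ^ 6) = 2 * pi * (nrm H)\<^sup>2"
proof -
  have eq: "norm (FT F x) ^ 6 = (norm (FT H x))\<^sup>2" for x
    by (simp add: FT_H norm_power flip: power_mult)
  show "integrable lborel (\<lambda>x. norm (FT F x) ^ 6)"
    unfolding eq by (intro L2_integrable_square Plancherel_L1_L2 H_integrable H_L2)
  show "(LINT x|lborel. norm (FT F x) ^ 6) = 2 * pi * (nrm H)\<^sup>2"
    unfolding eq nrm_square[symmetric] Plancherel_L1_L2(2)[OF H_integrable H_L2]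
    by (simp add: power_mult_distrib)
qed

end

section \<open>The equality case\<close>

text \<open>For fixed \<open>s\<close> put \<open>\<eta> = \<xi> - s\<close>: up to the constant
  \<open>r s\<close> the integrand in \<open>t\<close> is the derivative of
  \<open>- p (\<eta> - t) * q t\<close>. The boundary terms vanish, at \<open>t = 0\<close> because
  \<open>q 0 = 0\<close> and at \<open>t = \<eta>\<close> because \<open>p 0 = 0\<close>.\<close>

lemma integral_slice_commutator:
  fixes p q p' q' r :: "real \<Rightarrow> complex"
  assumes p: "\<And>x. (p has_vector_derivative p' x) (at x)" "continuous_on UNIV p'" "p 0 = 0"
    and q: "\<And>x. (q has_vector_derivative q' x) (at x)" "continuous_on UNIV q'" "q 0 = 0"
    and r: "r \<in> borel_measurable borel"
    and bound: "\<And>x. norm (p x) \<le> B" "\<And>x. norm (p' x) \<le> B" "\<And>x. norm (q x) \<le> B" "\<And>x. norm (q' x) \<le> B" "\<And>x. norm (r x) \<le> B"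
  shows "(LINT z|lborel2. indicator (slice \<xi>) z * (triple p' r q \<xi> z - triple p r q' \<xi> z)) = 0"
proof -
  have cont: "continuous_on UNIV p" "continuous_on UNIV q"
    using p(1) q(1) by (auto intro!: continuous_at_imp_continuous_on has_vector_derivative_continuous)
  note [measurable] = r cont[THEN borel_measurable_continuous_onI] p(2)[THEN borel_measurable_continuous_onI] q(2)[THEN borel_measurable_continuous_onI]
  have "0 \<le> B" using bound(1)[of 0] norm_ge_zero order_trans by blast
  let ?g = "\<lambda>z. indicator (slice \<xi>) z * (triple p' r q \<xi> z - triple p r q' \<xi> z)"
  have "integrable lborel2 (\<lambda>z. (B * B * B + B * B * B) * indicator (slice \<xi>) z)"
    by (intro integrable_mult_right integrable_real_indicator slice_measurable) (simp add: emeasure_slice)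
  then have int: "integrable lborel2 ?g"
  proof (rule Bochner_Integration.integrable_bound)
    have "norm (triple p' r q \<xi> z - triple p r q' \<xi> z) \<le> B * B * B + B * B * B" for z
    proof -
      have "norm (triple a r b \<xi> z) \<le> B * B * B" if "\<And>x. norm (a x) \<le> B" "\<And>x. norm (b x) \<le> B" for a b
        unfolding triple_def norm_mult by (intro mult_mono that bound mult_nonneg_nonneg \<open>0 \<le> B\<close>) auto
      then show ?thesis
        using bound by (intro norm_triangle_le_diff add_mono) auto
    qed
    then show "AE z in lborel2. norm (?g z) \<le> norm ((B * B * B + B * B * B) * indicator (slice \<xi>) z)"
      by (intro AE_I2) (auto simp: indicator_def intro: order_trans[OF _ abs_ge_self])
  qed measurable
  have zero: "(LINT t|lborel. ?g (s, t)) = 0" for s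
  proof (cases "0 < s \<and> s < \<xi>")
    case False
    then have "(s, t) \<notin> slice \<xi>" for t by (auto simp: slice_def)
    then show ?thesis by simp
  next
    case True
    define \<eta> where "\<eta> = \<xi> - s"
    have "0 < \<eta>" using True by (simp add: \<eta>_def)
    let ?h = "\<lambda>t. p' (\<eta> - t) * q t - p (\<eta> - t) * q' t"
    have "(LINT t|lborel. ?g (s, t)) = (LINT t|lborel. r s * (indicator {0..\<eta>} t *\<^sub>R ?h t))"
    proof (rule integral_cong_AE)
      show "AE t in lborel. ?g (s, t) = r s * (indicator {0..\<eta>} t *\<^sub>R ?h t)"
        using AE_lborel_singleton[of 0] AE_lborel_singleton[of \<eta>]
      proof eventually_elim
        fix t assume t: "t \<noteq> 0" "t \<noteq> \<eta>"
        then have "(s, t) \<in> slice \<xi> \<longleftrightarrow> t \<in> {0..\<eta>}"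
          using True by (auto simp: slice_def \<eta>_def)
        then show "?g (s, t) = r s * (indicator {0..\<eta>} t *\<^sub>R ?h t)"
          by (auto simp: indicator_def triple_def \<eta>_def algebra_simps)
      qed
      show "(\<lambda>t. ?g (s, t)) \<in> borel_measurable lborel"
        by measurable
    qed measurable
    also have "\<dots> = r s * (LINT t|lborel. indicator {0..\<eta>} t *\<^sub>R ?h t)"
      by (rule integral_mult_right_zero)
    also have "(LINT t|lborel. indicator {0..\<eta>} t *\<^sub>R ?h t) = (\<lambda>t. - (p (\<eta> - t) * q t)) \<eta> - (\<lambda>t. - (p (\<eta> - t) * q t)) 0"
    proof (rule integral_FTC_Icc)
      show "((\<lambda>t. - (p (\<eta> - t) * q t)) has_vector_derivative ?h t) (at t within {0..\<eta>})" for t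
      proof -
        have "((\<lambda>t. \<eta> - t) has_vector_derivative - 1) (at t)"
          by (auto intro!: derivative_eq_intros)
        from vector_diff_chain_at[OF this p(1)]
        have "((\<lambda>t. p (\<eta> - t)) has_vector_derivative - p' (\<eta> - t)) (at t)"
          by (simp add: o_def)
        from has_vector_derivative_minus[OF has_vector_derivative_mult[OF this q(1)]]
        have "((\<lambda>t. - (p (\<eta> - t) * q t)) has_vector_derivative ?h t) (at t)"
          by (simp add: algebra_simps)
        then show ?thesis by (rule has_vector_derivative_at_within)
      qed
      show "continuous_on {0..\<eta>} ?h"
        by (intro continuous_intros continuous_on_compose2[OF cont(1)] continuous_on_compose2[OF p(2)]
            continuous_on_subset[OF cont(2)] continuous_on_subset[OF q(2)]) auto
    qed (use \<open>0 < \<eta>\<close> in simp)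
    also have "\<dots> = 0" using p(3) q(3) by simp
    finally show ?thesis by simp
  qed
  have "(LINT z|lborel2. ?g z) = (LINT s|lborel. LINT t|lborel. ?g (s, t))"
    by (rule lborel_pair.integral_fst'[symmetric, OF int])
  then show ?thesis by (simp only: zero Bochner_Integration.integral_zero)
qed

context positive_spectrum
begin

text \<open>The integral of \<open>\<Phi>\<close> against the commutator is evaluated in two ways.
  Over all frequencies it splits into products of one-dimensional integrals against
  \<open>F\<close>; slice by slice it is 0. The factor \<open>k \<xi>\<close> only multiplies a
  vanishing slice integral and is never integrated in \<open>\<xi>\<close>.\<close>

lemma integral_commutator:
  fixes p q p' q' r :: "real \<Rightarrow> complex"
  assumes factor: "AE \<xi> in lborel. AE z in lborel2. \<Phi> \<xi> z = k \<xi> * indicator (slice \<xi>) z"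
    and p: "\<And>x. (p has_vector_derivative p' x) (at x)" "continuous_on UNIV p'" "p 0 = 0"
    and q: "\<And>x. (q has_vector_derivative q' x) (at x)" "continuous_on UNIV q'" "q 0 = 0"
    and r [measurable]: "r \<in> borel_measurable borel"
    and bound: "\<And>x. norm (p x) \<le> B" "\<And>x. norm (p' x) \<le> B" "\<And>x. norm (q x) \<le> B" "\<And>x. norm (q' x) \<le> B" "\<And>x. norm (r x) \<le> B"
  shows "(LINT x|lborel. p' x * F x) * (LINT x|lborel. r x * F x) * (LINT x|lborel. q x * F x)
    = (LINT x|lborel. p x * F x) * (LINT x|lborel. r x * F x) * (LINT x|lborel. q' x * F x)"
proof -
  have cont: "continuous_on UNIV p" "continuous_on UNIV q"
    using p(1) q(1) by (auto intro!: continuous_at_imp_continuous_on has_vector_derivative_continuous)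
  note [measurable] = cont[THEN borel_measurable_continuous_onI] p(2)[THEN borel_measurable_continuous_onI] q(2)[THEN borel_measurable_continuous_onI]
  have int: "integrable lborel (\<lambda>x. a x * F x)" if [measurable]: "a \<in> borel_measurable borel" and a: "\<And>x. norm (a x) \<le> B" for a
  proof (rule Bochner_Integration.integrable_bound)
    show "integrable lborel (\<lambda>x. B * norm (F x))"
      using F_integrable by simp
    have "norm (a x) * norm (F x) \<le> B * norm (F x)" for x
      by (intro mult_right_mono a) simp
    then show "AE x in lborel. norm (a x * F x) \<le> norm (B * norm (F x))"
      by (intro AE_I2) (auto simp: norm_mult intro: order_trans[OF _ abs_ge_self])
  qed measurable
  note ints = int[OF _ bound(1)] int[OF _ bound(2)] int[OF _ bound(3)] int[OF _ bound(4)] int[OF _ bound(5)]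
  let ?T = "triple (\<lambda>x. p' x * F x) (\<lambda>x. r x * F x) (\<lambda>x. q x * F x)"
    and ?U = "triple (\<lambda>x. p x * F x) (\<lambda>x. r x * F x) (\<lambda>x. q' x * F x)"
  have T: "integrable (lborel \<Otimes>\<^sub>M lborel2) (\<lambda>(\<xi>, z). ?T \<xi> z)" and U: "integrable (lborel \<Otimes>\<^sub>M lborel2) (\<lambda>(\<xi>, z). ?U \<xi> z)"
    by (intro integrable_triple ints; measurable)+
  have "integral\<^sup>L (lborel \<Otimes>\<^sub>M lborel2) (\<lambda>(\<xi>, z). ?T \<xi> z) - integral\<^sup>L (lborel \<Otimes>\<^sub>M lborel2) (\<lambda>(\<xi>, z). ?U \<xi> z)
     = (LINT \<xi>|lborel. LINT z|lborel2. ?T \<xi> z) - (LINT \<xi>|lborel. LINT z|lborel2. ?U \<xi> z)"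
    using lborel_triple.integral_fst[OF T] lborel_triple.integral_fst[OF U] by simp
  also have "\<dots> = (LINT \<xi>|lborel. (LINT z|lborel2. ?T \<xi> z) - (LINT z|lborel2. ?U \<xi> z))"
    by (rule Bochner_Integration.integral_diff[symmetric]) (intro lborel_triple.integrable_fst T U)+
  also have "\<dots> = (LINT (\<xi>::real)|lborel. 0)"
  proof (rule integral_cong_AE)
    show "AE \<xi> in lborel. (LINT z|lborel2. ?T \<xi> z) - (LINT z|lborel2. ?U \<xi> z) = 0"
      using factor lborel_triple.AE_integrable_fst[OF T] lborel_triple.AE_integrable_fst[OF U]
    proof eventually_elim
      fix \<xi> assume \<Phi>: "AE z in lborel2. \<Phi> \<xi> z = k \<xi> * indicator (slice \<xi>) z"
        and TU: "integrable lborel2 (?T \<xi>)" "integrable lborel2 (?U \<xi>)"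
      have "(LINT z|lborel2. ?T \<xi> z) - (LINT z|lborel2. ?U \<xi> z) = (LINT z|lborel2. ?T \<xi> z - ?U \<xi> z)"
        using TU by simp
      also have "\<dots> = (LINT z|lborel2. k \<xi> * (indicator (slice \<xi>) z * (triple p' r q \<xi> z - triple p r q' \<xi> z)))"
      proof (rule integral_cong_AE)
        show "AE z in lborel2. ?T \<xi> z - ?U \<xi> z = k \<xi> * (indicator (slice \<xi>) z * (triple p' r q \<xi> z - triple p r q' \<xi> z))"
          using \<Phi>
        proof eventually_elim
          fix z assume *: "\<Phi> \<xi> z = k \<xi> * indicator (slice \<xi>) z"
          have "?T \<xi> z - ?U \<xi> z = \<Phi> \<xi> z * (triple p' r q \<xi> z - triple p r q' \<xi> z)"
            by (simp add: triple_def \<Phi>_def algebra_simps)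
          then show "?T \<xi> z - ?U \<xi> z = k \<xi> * (indicator (slice \<xi>) z * (triple p' r q \<xi> z - triple p r q' \<xi> z))"
            by (simp add: *)
        qed
      qed measurable
      also have "\<dots> = k \<xi> * (LINT z|lborel2. indicator (slice \<xi>) z * (triple p' r q \<xi> z - triple p r q' \<xi> z))"
        by (rule integral_mult_right_zero)
      also have "\<dots> = 0"
        using integral_slice_commutator[OF p q r bound] by simp
      finally show "(LINT z|lborel2. ?T \<xi> z) - (LINT z|lborel2. ?U \<xi> z) = 0" .
    qed
  qed measurable
  finally show ?thesis
    using integral_triple[of "\<lambda>x. p' x * F x" "\<lambda>x. r x * F x" "\<lambda>x. q x * F x"] integral_triple[of "\<lambda>x. p x * F x" "\<lambda>x. r x * F x" "\<lambda>x. q' x * F x"]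
    by (simp add: ints)
qed

text \<open>Subtracting 1 from the exponential secures \<open>p 0 = 0\<close> and produces the
  differences with \<open>FT F 0\<close>, while its derivative produces the factor \<open>x\<close>.
  The exponential at \<open>w\<close> as third function gives \<open>FT F w\<close>, which can be
  cancelled at any point where it is nonzero.\<close>

lemma FT_functional_equation:
  assumes factor: "AE \<xi> in lborel. AE z in lborel2. \<Phi> \<xi> z = k \<xi> * indicator (slice \<xi>) z"
  shows "FT F w * (complex_of_real x * FT F x * (FT F y - FT F 0)) = FT F w * ((FT F x - FT F 0) * (complex_of_real y * FT F y))"
proof -
  let ?e = "\<lambda>x a. exp (- (\<i> * complex_of_real (a * x)))"
  let ?p = "\<lambda>x a. ?e x a - 1" and ?p' = "\<lambda>x a. - (\<i> * complex_of_real x) * ?e x a"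
  have D: "(?p x has_vector_derivative ?p' x a) (at a)" for x a
  proof -
    have "((\<lambda>z. exp (- (\<i> * (z * complex_of_real x))) - 1) has_field_derivative
        - (\<i> * complex_of_real x) * exp (- (\<i> * (complex_of_real a * complex_of_real x)))) (at (complex_of_real a))"
      by (auto intro!: derivative_eq_intros)
    from has_vector_derivative_real_field[OF this] show ?thesis by simp
  qed
  have c: "continuous_on UNIV (?p' x)" for x by (intro continuous_intros)
  \<comment> \<open>The value 2 bounds each exponential minus 1, \<open>\<bar>x\<bar>\<close> and
    \<open>\<bar>y\<bar>\<close> bound the two derivatives.\<close>
  define B where "B = max 2 (max \<bar>x\<bar> \<bar>y\<bar>)"
  have b: "norm (?p x' a) \<le> B" for x' a
    using norm_triangle_ineq4[of "?e x' a" 1] by (simp add: B_def)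
  have b': "norm (?p' x a) \<le> B" "norm (?p' y a) \<le> B" "norm (?e w a) \<le> B" for a
    by (auto simp: norm_mult B_def simp del: of_real_mult)
  have p: "(LINT a|lborel. ?p x a * F a) = FT F x - FT F 0" for x
    using FT_def[of F 0] F_integrable integrable_exp_mult[OF F_integrable, of x]
    by (simp add: FT_def left_diff_distrib)
  have p': "(LINT a|lborel. ?p' x a * F a) = - (\<i> * complex_of_real x) * FT F x" for x
    unfolding FT_def integral_mult_right_zero[symmetric] by (simp add: mult.assoc)
  have "(LINT a|lborel. ?p' x a * F a) * (LINT a|lborel. ?e w a * F a) * (LINT a|lborel. ?p y a * F a)
    = (LINT a|lborel. ?p x a * F a) * (LINT a|lborel. ?e w a * F a) * (LINT a|lborel. ?p' y a * F a)"
    by (rule integral_commutator[OF factor D c _ D c _ _ b b'(1) b b'(2,3)]) auto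
  then have "- \<i> * (FT F w * (complex_of_real x * FT F x * (FT F y - FT F 0))) = - \<i> * (FT F w * ((FT F x - FT F 0) * (complex_of_real y * FT F y)))"
    unfolding p p' FT_def[of F w, symmetric] by (simp only: ac_simps minus_mult_left minus_mult_right)
  then show ?thesis by simp
qed

end

section \<open>Injectivity of the transform and one-sided exponentials\<close>

lemma not_L2_const: "c \<noteq> 0 \<Longrightarrow> (\<lambda>_. c) \<notin> L2"
  by (simp add: L2_iff integrable_iff_bounded ennreal_mult_top)

lemma FT_inject:
  assumes "integrable lborel f" "f \<in> L2" "integrable lborel g" "g \<in> L2" "FT f = FT g"
  shows "AE x in lborel. f x = g x"
proof -
  have "sqrt (2 * pi) * nrm (\<lambda>x. f x - g x) = nrm (\<lambda>x. FT f x - FT g x)"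
    using Plancherel_L1_L2(2)[of "\<lambda>x. f x - g x"] assms by (simp add: FT_diff L2_diff)
  then have "nrm (\<lambda>x. f x - g x) = 0"
    using assms(5) by (simp add: nrm_eq)
  then show ?thesis
    using nrm_eq_0_iff[OF L2_diff[OF assms(2,4)]] by simp
qed

text \<open>The extremal spectra up to a factor. A complex rate \<open>\<kappa>\<close> covers all
  of them: its real part sets the decay, its imaginary part a translation of the inverse transform.
  The value 0 at the origin agrees with the support condition of
  \<open>positive_spectrum\<close>.\<close>

definition exp_pos :: "complex \<Rightarrow> real \<Rightarrow> complex" where
  "exp_pos \<kappa> \<xi> = (if 0 < \<xi> then exp (- \<kappa> * complex_of_real \<xi>) else 0)"

lemma exp_pos_measurable [measurable]: "exp_pos \<kappa> \<in> borel_measurable borel"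
  unfolding exp_pos_def[abs_def] by measurable

lemma integrable_power_exp_pos:
  assumes "0 < a" shows "integrable lborel (\<lambda>\<xi>::real. if 0 < \<xi> then \<xi> ^ k * exp (- (a * \<xi>)) else 0)"
proof -
  have "integrable lborel (\<lambda>x. x ^ k * exp (- x) * indicator {0<..} x :: real)"
    using has_bochner_integral_I0i_power_exp_m by (rule integrable.intros)
  from lborel_integrable_real_affine[OF this, of a 0] assms
  have "integrable lborel (\<lambda>x. 1 / a ^ k * ((a * x) ^ k * exp (- (a * x)) * indicator {0<..} (a * x)))"
    by (intro integrable_mult_right) simp
  also have "(\<lambda>x. 1 / a ^ k * ((a * x) ^ k * exp (- (a * x)) * indicator {0<..} (a * x))) = (\<lambda>\<xi>. if 0 < \<xi> then \<xi> ^ k * exp (- (a * \<xi>)) else 0)"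
    using assms by (auto simp: fun_eq_iff indicator_def power_mult_distrib zero_less_mult_iff)
  finally show ?thesis .
qed

lemma norm_exp_pos: "norm (exp_pos \<kappa> \<xi>) = (if 0 < \<xi> then exp (- (Re \<kappa> * \<xi>)) else 0)"
  by (simp add: exp_pos_def)

lemma exp_pos_facts:
  assumes "0 < Re \<kappa>"
  shows "integrable lborel (exp_pos \<kappa>)" "exp_pos \<kappa> \<in> L2"
    "integrable lborel (\<lambda>x. x\<^sup>2 * (norm (exp_pos \<kappa> x))\<^sup>2)"
    "FT (exp_pos \<kappa>) x = 1 / (\<kappa> + \<i> * complex_of_real x)"
proof -
  show int: "integrable lborel (exp_pos \<kappa>)"
    by (rule Bochner_Integration.integrable_bound[OF integrable_power_exp_pos[OF assms, of 0]]) (auto simp: norm_exp_pos)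
  have sq: "(norm (exp_pos \<kappa> \<xi>))\<^sup>2 = (if 0 < \<xi> then exp (- (2 * Re \<kappa> * \<xi>)) else 0)" for \<xi>
    by (simp add: norm_exp_pos power2_eq_square flip: exp_add)
  show "exp_pos \<kappa> \<in> L2"
    using integrable_power_exp_pos[of "2 * Re \<kappa>" 0] assms by (simp add: L2_iff sq cong: if_cong)
  have "(\<lambda>x. x\<^sup>2 * (norm (exp_pos \<kappa> x))\<^sup>2) = (\<lambda>x. if 0 < x then x\<^sup>2 * exp (- (2 * Re \<kappa> * x)) else 0)"
    by (simp add: sq fun_eq_iff)
  then show "integrable lborel (\<lambda>x. x\<^sup>2 * (norm (exp_pos \<kappa> x))\<^sup>2)"
    using integrable_power_exp_pos[of "2 * Re \<kappa>" 2] assms by simp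
  define z where "z = \<kappa> + \<i> * complex_of_real x"
  have z: "0 < Re z" using assms by (simp add: z_def)
  then have z0: "z \<noteq> 0" by auto
  \<comment> \<open>The half-line is exhausted by \<open>{0..real n}\<close>, where the fundamental
    theorem of calculus applies; the endpoint 0, at which \<open>exp_pos\<close> is 0, is discarded
    as a null set.\<close>
  have "(\<lambda>n. LINT \<xi>|lborel. indicator {0..real n} \<xi> *\<^sub>R exp (- z * complex_of_real \<xi>)) \<longlonglongrightarrow> (LINT \<xi>|lborel. exp_pos z \<xi>)"
  proof (rule integral_dominated_convergence[where w="\<lambda>\<xi>. if 0 < \<xi> then \<xi> ^ 0 * exp (- (Re z * \<xi>)) else 0"])
    show "AE \<xi> in lborel. (\<lambda>n. indicator {0..real n} \<xi> *\<^sub>R exp (- z * complex_of_real \<xi>)) \<longlonglongrightarrow> exp_pos z \<xi>"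
      using AE_lborel_singleton[of 0]
    proof eventually_elim
      fix \<xi> :: real assume "\<xi> \<noteq> 0"
      obtain N :: nat where "\<xi> \<le> real N" using real_arch_simple by blast
      with \<open>\<xi> \<noteq> 0\<close> have "eventually (\<lambda>n. indicator {0..real n} \<xi> *\<^sub>R exp (- z * complex_of_real \<xi>) = exp_pos z \<xi>) sequentially"
        unfolding eventually_sequentially by (intro exI[of _ N]) (auto simp: exp_pos_def indicator_def)
      then show "(\<lambda>n. indicator {0..real n} \<xi> *\<^sub>R exp (- z * complex_of_real \<xi>)) \<longlonglongrightarrow> exp_pos z \<xi>"
        by (rule tendsto_eventually)
    qed
    show "AE \<xi> in lborel. norm (indicator {0..real n} \<xi> *\<^sub>R exp (- z * complex_of_real \<xi>)) \<le> (if 0 < \<xi> then \<xi> ^ 0 * exp (- (Re z * \<xi>)) else 0)" for n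
      using AE_lborel_singleton[of 0] by eventually_elim (auto simp: indicator_def)
    show "integrable lborel (\<lambda>\<xi>. if 0 < \<xi> then \<xi> ^ 0 * exp (- (Re z * \<xi>)) else 0)"
      by (rule integrable_power_exp_pos[OF z])
  qed measurable
  moreover have "(LINT \<xi>|lborel. indicator {0..real n} \<xi> *\<^sub>R exp (- z * complex_of_real \<xi>)) = (1 - exp (- z * complex_of_real (real n))) / z" for n
  proof -
    have "((\<lambda>\<xi>. - exp (- z * complex_of_real \<xi>) / z) has_vector_derivative exp (- z * complex_of_real \<xi>)) (at \<xi>)" for \<xi>
    proof -
      have "((\<lambda>w. - exp (- z * w) / z) has_field_derivative exp (- z * complex_of_real \<xi>)) (at (complex_of_real \<xi>))"
        using z0 by (auto intro!: derivative_eq_intros)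
      from has_vector_derivative_real_field[OF this] show ?thesis .
    qed
    then have "(LINT \<xi>|lborel. indicator {0..real n} \<xi> *\<^sub>R exp (- z * complex_of_real \<xi>))
        = (\<lambda>\<xi>. - exp (- z * complex_of_real \<xi>) / z) (real n) - (\<lambda>\<xi>. - exp (- z * complex_of_real \<xi>) / z) 0"
      by (intro integral_FTC_Icc continuous_intros) (auto intro: has_vector_derivative_at_within)
    then show ?thesis by (simp add: diff_divide_distrib)
  qed
  moreover have "(\<lambda>n. (1 - exp (- z * complex_of_real (real n))) / z) \<longlonglongrightarrow> (1 - 0) / z"
  proof (intro tendsto_intros z0)
    have "(\<lambda>n. exp (- Re z) ^ n) \<longlonglongrightarrow> 0"
      using z by (intro LIMSEQ_realpow_zero) auto
    then have "(\<lambda>n. norm (exp (- z * complex_of_real (real n)))) \<longlonglongrightarrow> 0"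
      by (simp add: exp_of_nat_mult[symmetric] mult.commute)
    then show "(\<lambda>n. exp (- z * complex_of_real (real n))) \<longlonglongrightarrow> 0"
      by (rule tendsto_norm_zero_cancel)
  qed
  ultimately have "(LINT \<xi>|lborel. exp_pos z \<xi>) = 1 / z"
    using LIMSEQ_unique by fastforce
  moreover have "FT (exp_pos \<kappa>) x = (LINT \<xi>|lborel. exp_pos z \<xi>)"
  proof -
    have "exp (- (\<i> * complex_of_real (\<xi> * x))) * exp_pos \<kappa> \<xi> = exp_pos z \<xi>" for \<xi>
      by (auto simp: exp_pos_def z_def algebra_simps simp flip: exp_add)
    then show ?thesis unfolding FT_def by simp
  qed
  ultimately show "FT (exp_pos \<kappa>) x = 1 / (\<kappa> + \<i> * complex_of_real x)"
    by (simp add: z_def)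
qed

context positive_spectrum
begin

text \<open>The functional equation separates the variables: fixing \<open>y\<close> makes it affine
  in the unknown value \<open>FT F x\<close>, so \<open>FT F\<close> is a simple fraction. Square
  integrability and the support of \<open>F\<close> then place the pole.\<close>

lemma equality_imp_rational:
  assumes nz: "\<not> (AE x in lborel. F x = 0)" and eq: "(nrm H)\<^sup>2 = total / 2"
  obtains c \<beta> where "c \<noteq> 0" "0 < Im \<beta>" "\<And>x. FT F x = c / (complex_of_real x - \<beta>)"
proof -
  obtain k where factor: "AE \<xi> in lborel. AE z in lborel2. \<Phi> \<xi> z = k \<xi> * indicator (slice \<xi>) z"
    using equality_imp_factor[OF eq] by blast
  note Plancherel = Plancherel_L1_L2[OF F_integrable F_L2]
  have nz': "\<not> (AE x in lborel. FT F x = 0)"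
    using nz Plancherel(2) nrm_eq_0_iff[OF F_L2] nrm_eq_0_iff[OF Plancherel(1)] by simp
  then obtain w where w: "FT F w \<noteq> 0" by (meson AE_I2)
  have fe: "complex_of_real x * FT F x * (FT F y - FT F 0) = (FT F x - FT F 0) * (complex_of_real y * FT F y)" for x y
    using FT_functional_equation[OF factor, of w x y] w by simp
  \<comment> \<open>A constant \<open>FT F\<close> would have to be 0 to lie in \<open>L2\<close>,
    contradicting the choice of \<open>w\<close>.\<close>
  obtain y where y: "FT F y \<noteq> FT F 0"
  proof (rule ccontr)
    assume "\<not> thesis"
    then have const: "FT F y = FT F 0" for y using that by blast
    then have "FT F = (\<lambda>_. FT F 0)" by (rule ext)
    then have "(\<lambda>_. FT F 0) \<in> L2" using Plancherel(1) by metis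
    then have "FT F 0 = 0" using not_L2_const by blast
    then show False using w const[of w] by simp
  qed
  define \<beta> where "\<beta> = complex_of_real y * FT F y / (FT F y - FT F 0)"
  define c where "c = - FT F 0 * \<beta>"
  have lin: "FT F x * (complex_of_real x - \<beta>) = c" for x
  proof -
    have "complex_of_real x * FT F x = (FT F x - FT F 0) * \<beta>"
      using fe[of x y] y by (simp add: \<beta>_def field_simps)
    then show ?thesis by (simp add: c_def algebra_simps)
  qed
  \<comment> \<open>At a real pole the linear relation evaluates to \<open>c = 0\<close>, and then
    \<open>FT F\<close> vanishes at all other points.\<close>
  have im: "Im \<beta> \<noteq> 0"
  proof
    assume "Im \<beta> = 0"
    then have \<beta>: "\<beta> = complex_of_real (Re \<beta>)" by (simp add: complex_eq_iff)
    then have "c = 0" using lin[of "Re \<beta>"] by simp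
    then have "FT F x = 0" if "x \<noteq> Re \<beta>" for x
      using lin[of x] that \<beta> by (metis eq_iff_diff_eq_0 mult_eq_0_iff of_real_eq_iff)
    then have "AE x in lborel. FT F x = 0"
      using AE_lborel_singleton[of "Re \<beta>"] by (auto elim: eventually_mono)
    with nz' show False by simp
  qed
  then have ne: "complex_of_real x - \<beta> \<noteq> 0" for x by (auto simp: complex_eq_iff)
  then have FT: "FT F x = c / (complex_of_real x - \<beta>)" for x
    using lin[of x] by (simp add: field_simps)
  have "c \<noteq> 0" using w FT[of w] by auto
  moreover have "0 < Im \<beta>"
  proof (rule ccontr)
    assume "\<not> 0 < Im \<beta>"
    then have re: "0 < Re (\<i> * \<beta>)" using im by simp
    note E = exp_pos_facts[OF re]
    \<comment> \<open>With a pole in the lower half-plane the same fraction is the transform of an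
      exponential living on the negative half-line. By injectivity \<open>F\<close> equals it almost
      everywhere, so the support condition forces \<open>F = 0\<close>.\<close>
    let ?E = "\<lambda>x. - \<i> * c * exp_pos (\<i> * \<beta>) (- x)"
    have "FT F = FT ?E"
    proof
      fix x
      have "FT ?E x = - \<i> * c * (1 / (\<i> * \<beta> + \<i> * complex_of_real (- x)))"
        unfolding FT_cmult FT_reflect E(4) ..
      also have "\<i> * \<beta> + \<i> * complex_of_real (- x) = - \<i> * (complex_of_real x - \<beta>)"
        by (simp add: algebra_simps)
      finally show "FT F x = FT ?E x"
        using FT[of x] ne[of x] by simp
    qed
    moreover have "integrable lborel ?E"
      using lborel_integrable_real_affine[OF E(1), of "-1" 0] by simp
    moreover have "?E \<in> L2" by (intro L2_cmult L2_reflect E)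
    ultimately have "AE x in lborel. F x = ?E x"
      by (intro FT_inject F_integrable F_L2)
    then have "AE x in lborel. F x = 0"
      by eventually_elim (use F_supp in \<open>force simp: exp_pos_def\<close>)
    with nz show False by simp
  qed
  ultimately show thesis using FT by (rule that)
qed

end

lemma positive_spectrum_exp_pos:
  assumes "0 < Re \<kappa>" shows "positive_spectrum (\<lambda>x. c * exp_pos \<kappa> x)"
proof
  note E = exp_pos_facts[OF assms]
  show "integrable lborel (\<lambda>x. c * exp_pos \<kappa> x)" "(\<lambda>x. c * exp_pos \<kappa> x) \<in> L2"
    using E by (auto intro: L2_cmult)
  show "integrable lborel (\<lambda>x. x\<^sup>2 * (norm (c * exp_pos \<kappa> x))\<^sup>2)"
    using integrable_mult_right[OF E(3), of "(norm c)\<^sup>2"]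
    by (simp add: norm_mult power_mult_distrib mult.left_commute)
qed (simp add: exp_pos_def)

text \<open>A product of exponentials sees only the sum of the frequencies, so it is constant on
  each triangle.\<close>

lemma exp_pos_equality:
  assumes "0 < Re \<kappa>"
  shows "(nrm (positive_spectrum.H (\<lambda>x. c * exp_pos \<kappa> x)))\<^sup>2 = positive_spectrum.total (\<lambda>x. c * exp_pos \<kappa> x) / 2"
proof -
  interpret positive_spectrum "\<lambda>x. c * exp_pos \<kappa> x"
    by (rule positive_spectrum_exp_pos[OF assms])
  show ?thesis
  proof (rule factor_imp_equality)
    fix \<xi> p
    show "\<Phi> \<xi> p = c ^ 3 * exp (- \<kappa> * complex_of_real \<xi>) * indicator (slice \<xi>) p"
    proof (cases "p \<in> slice \<xi>")
      case True
      have "exp (- \<kappa> * complex_of_real \<xi>) = exp (- \<kappa> * complex_of_real (\<xi> - fst p - snd p)) * exp (- \<kappa> * complex_of_real (fst p)) * exp (- \<kappa> * complex_of_real (snd p))"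
        unfolding exp_add[symmetric] by (simp add: algebra_simps)
      then show ?thesis
        using True unfolding \<Phi>_def triple_def by (simp add: exp_pos_def slice_def power3_eq_cube)
    qed (simp add: \<Phi>_outside)
  qed
qed

section \<open>The minimizers\<close>

text \<open>For integrable \<open>F\<close> the abstract transform in the inversion theorem is the
  integral \<open>FT F\<close>. This is how pointwise information on \<open>FT F\<close> reaches
  \<open>f\<close>.\<close>

lemma fourier_pair_inversion_integral:
  assumes "fourier_pair f F" "integrable lborel F"
  shows "AE x in lborel. f x = FT F (- x) / (2 * pi)"
proof -
  note [measurable] = fourier_pair_L2[OF assms(1), THEN L2_measurable]
  have "AE x in lborel. FT F x = complex_of_real (2 * pi) * f (- x)"
    by (rule fourier_pair_unique[OF fourier_pair_FT[OF assms(2) fourier_pair_L2(2)[OF assms(1)]] fourier_pair_inversion[OF assms(1)]])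
  then have "AE x in lborel. FT F (0 + - 1 * x) = complex_of_real (2 * pi) * f (- (0 + - 1 * x))"
    by (intro AE_borel_affine) auto
  then show ?thesis
    by eventually_elim simp
qed

section \<open>The functional in terms of the spectrum\<close>

context positive_spectrum
begin

lemma nrm_F_square: "(nrm F)\<^sup>2 = moment 0"
  by (simp add: nrm_square moment_def)

text \<open>On the support of \<open>F\<close> the absolute value in the symbol disappears, so its
  square contributes the first moment.\<close>

lemma half_deriv_moment:
  assumes "fourier_pair f F" shows "2 * pi * (nrm (half_deriv f))\<^sup>2 = moment 1"
proof -
  have eq: "(norm (complex_of_real (sqrt \<bar>\<xi>\<bar>) * F \<xi>))\<^sup>2 = \<xi> ^ 1 * (norm (F \<xi>))\<^sup>2" for \<xi>
    using F_supp[of \<xi>] by (cases "\<xi> \<le> 0") (auto simp: norm_mult power_mult_distrib)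
  have "(\<lambda>\<xi>. complex_of_real (sqrt \<bar>\<xi>\<bar>) * F \<xi>) \<in> L2"
    unfolding L2_iff eq using integrable_moment[of 1] by simp
  from nrm_half_deriv[OF assms this] show ?thesis
    unfolding nrm_square[of "\<lambda>\<xi>. complex_of_real (sqrt \<bar>\<xi>\<bar>) * F \<xi>"] eq moment_def .
qed

lemma weak_deriv_moment:
  assumes f: "fourier_pair f F" and "f \<in> H1" shows "2 * pi * (nrm (weak_deriv f))\<^sup>2 = moment 2"
proof -
  have weak: "is_weak_deriv_L2 f (weak_deriv f)"
    using assms(2) someI_ex[of "is_weak_deriv_L2 f"] by (simp add: H1_def weak_deriv_def)
  then have "weak_deriv f \<in> L2" by (simp add: is_weak_deriv_L2_def)
  then obtain G where G: "fourier_pair (weak_deriv f) G"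
    using fourier_pair_exists by blast
  note [measurable] = fourier_pair_L2(2)[OF G, THEN L2_measurable]
  have "2 * pi * (nrm (weak_deriv f))\<^sup>2 = (nrm G)\<^sup>2"
    using fourier_pair_nrm[OF G] by (simp add: power_mult_distrib)
  also have "\<dots> = (nrm (\<lambda>\<xi>. \<i> * complex_of_real \<xi> * F \<xi>))\<^sup>2"
    by (subst nrm_cong_AE[OF _ _ fourier_pair_weak_deriv[OF f G weak]]) auto
  also have "\<dots> = moment 2"
    by (simp add: nrm_square moment_def norm_mult power_mult_distrib)
  finally show ?thesis .
qed

text \<open>Inversion contributes \<open>(2 * pi) ^ 6\<close> and Plancherel for \<open>H\<close>
  gives one factor back.\<close>

lemma Lp_norm_6:
  assumes "fourier_pair f F" shows "(2 * pi) ^ 5 * Lp_norm 6 f ^ 6 = (nrm H)\<^sup>2"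
proof -
  note [measurable] = fourier_pair_L2(1)[OF assms, THEN L2_measurable]
  have "(LINT x|lborel. norm (f x) powr 6) = (LINT x|lborel. norm (FT F (- x)) ^ 6 / (2 * pi) ^ 6)"
  proof (rule integral_cong_AE)
    show "AE x in lborel. norm (f x) powr 6 = norm (FT F (- x)) ^ 6 / (2 * pi) ^ 6"
      using fourier_pair_inversion_integral[OF assms F_integrable]
      by eventually_elim (simp add: norm_divide norm_mult power_divide power_mult_distrib)
  qed measurable
  also have "\<dots> = (LINT x|lborel. norm (FT F x) ^ 6) / (2 * pi) ^ 6"
    using integral_reflect[of "\<lambda>x. norm (FT F x) ^ 6"] by simp
  also have "\<dots> = (nrm H)\<^sup>2 / (2 * pi) ^ 5"
    unfolding integral_FT_power6 by (simp add: eval_nat_numeral)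
  finally have eq: "(LINT x|lborel. norm (f x) powr 6) = (nrm H)\<^sup>2 / (2 * pi) ^ 5" .
  have root: "(a powr (1 / 6)) ^ 6 = a" if "0 \<le> a" for a :: real
    using that by (cases "a = 0") (simp_all add: powr_power)
  have "Lp_norm 6 f ^ 6 = (nrm H)\<^sup>2 / (2 * pi) ^ 5"
    unfolding Lp_norm_def eq by (rule root) simp
  then show ?thesis by simp
qed

text \<open>Each squared norm in the numerator carries one \<open>1 / (2 * pi)\<close>, hence the
  cube; against the fifth power in the denominator \<open>(2 * pi)^2\<close> remains. The numerator
  is a third of \<open>total\<close>, and \<open>(2 * pi)^2 / 3 * total\<close> is regrouped so that
  \<open>total / 2\<close>, the bound for \<open>(nrm H)^2\<close>, appears.\<close>

lemma I22_eq:
  assumes f: "fourier_pair f F" and "f \<in> H1"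
  shows "I22 f = 8 * pi\<^sup>2 / 3 * (total / 2) / (nrm H)\<^sup>2"
proof -
  define P where "P = 2 * pi"
  have P: "0 < P" by (simp add: P_def)
  have m0: "(nrm f)\<^sup>2 = moment 0 / P"
    using fourier_pair_nrm[OF f] P by (simp add: P_def power_mult_distrib flip: nrm_F_square)
  have m1: "(nrm (half_deriv f))\<^sup>2 = moment 1 / P"
    using half_deriv_moment[OF f] P by (simp add: P_def field_simps)
  have m2: "(nrm (weak_deriv f))\<^sup>2 = moment 2 / P"
    using weak_deriv_moment[OF assms] P by (simp add: P_def field_simps)
  have L6: "Lp_norm 6 f ^ 6 = (nrm H)\<^sup>2 / P ^ 5"
    using Lp_norm_6[OF f] P unfolding P_def[symmetric] by (simp add: field_simps)
  have p4: "x ^ 4 = (x\<^sup>2)\<^sup>2" for x :: real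
    by simp
  define T where "T = moment 2 * (moment 0)\<^sup>2 + 2 * (moment 1)\<^sup>2 * moment 0"
  have T: "T = total / 3"
    by (simp add: T_def total_def)
  have "I22 f = (T / P ^ 3) / ((nrm H)\<^sup>2 / P ^ 5)"
    unfolding I22_def p4 m0 m1 m2 L6 T_def
    by (simp add: power_divide add_divide_distrib power2_eq_square power3_eq_cube)
  also have "\<dots> = P\<^sup>2 * T / (nrm H)\<^sup>2"
    using P by (simp add: field_simps eval_nat_numeral)
  also have "P\<^sup>2 * T = P\<^sup>2 / 3 * total"
    by (simp add: T)
  also have "P\<^sup>2 / 3 * total = 8 * pi\<^sup>2 / 3 * (total / 2)"
    by (simp add: P_def power_mult_distrib)
  finally show ?thesis .
qed

text \<open>Division by zero is 0 in HOL, so the lower bound for \<open>I22\<close> depends on a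
  nonzero denominator. If \<open>H\<close> had norm 0, then \<open>FT F\<close> and with it
  \<open>F\<close> would vanish almost everywhere.\<close>

lemma nrm_H_pos:
  assumes "\<not> (AE x in lborel. F x = 0)" shows "0 < (nrm H)\<^sup>2"
proof (rule ccontr)
  assume "\<not> 0 < (nrm H)\<^sup>2"
  then have "(LINT x|lborel. norm (FT F x) ^ 6) = 0"
    by (simp add: integral_FT_power6)
  then have "AE x in lborel. norm (FT F x) ^ 6 = 0"
    using integral_nonneg_eq_0_iff_AE[OF integral_FT_power6(1)] by simp
  then have "AE x in lborel. FT F x = 0" by eventually_elim simp
  then have "nrm F = 0"
    using nrm_eq_0_iff[OF Plancherel_L1_L2(1)[OF F_integrable F_L2]] Plancherel_L1_L2(2)[OF F_integrable F_L2] by simp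
  then show False using assms nrm_eq_0_iff[OF F_L2] by simp
qed

lemma I22_bound:
  assumes "\<not> (AE x in lborel. F x = 0)" "fourier_pair f F" "f \<in> H1"
  shows "8 * pi\<^sup>2 / 3 \<le> I22 f" and "I22 f = 8 * pi\<^sup>2 / 3 \<longleftrightarrow> (nrm H)\<^sup>2 = total / 2"
proof -
  define C where "C = 8 * pi\<^sup>2 / 3"
  have C: "0 < C" by (simp add: C_def)
  note H = nrm_H_pos[OF assms(1)]
  have I: "I22 f = C * (total / 2) / (nrm H)\<^sup>2"
    unfolding C_def by (rule I22_eq[OF assms(2,3)])
  have "C * (nrm H)\<^sup>2 \<le> C * (total / 2)"
    using nrm_H_le C by (intro mult_left_mono) auto
  then show "8 * pi\<^sup>2 / 3 \<le> I22 f"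
    unfolding I C_def[symmetric] using H by (simp add: pos_le_divide_eq)
  have "C * t / h = C \<longleftrightarrow> h = t" if "0 < h" for t h
    using that C by (auto simp: field_simps)
  from this[OF H] show "I22 f = 8 * pi\<^sup>2 / 3 \<longleftrightarrow> (nrm H)\<^sup>2 = total / 2"
    unfolding I C_def[symmetric] .
qed

end

section \<open>Passing between functions and spectra\<close>

lemma integrable_inverse_1_plus_square_lborel: "integrable lborel (\<lambda>x::real. 1 / (1 + x\<^sup>2))"
  using integrable_inverse_1_plus_square by (simp add: set_integrable_def inverse_eq_divide)

text \<open>Every admissible function has a transform meeting the locale assumptions: the weak
  derivative supplies the second moment, and together with square integrability this makes the
  transform integrable.\<close>

lemma H1_plus_spectrum:
  assumes "f \<in> H1_plus_nonzero"
  obtains F where "positive_spectrum F" "fourier_pair f F" "\<not> (AE x in lborel. F x = 0)" "f \<in> H1"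
proof -
  from assms have f: "f \<in> L2" "f \<in> H1" and van: "AE \<xi> in lborel. \<xi> < 0 \<longrightarrow> fourier_L2 f \<xi> = 0" and nz: "\<not> (AE x in lborel. f x = 0)"
    by (auto simp: H1_plus_nonzero_def H1_plus_def L2_plus_def)
  note pair0 = fourier_pair_fourier_L2[OF f(1)]
  note [measurable] = f(1)[THEN L2_measurable] fourier_pair_L2(2)[OF pair0, THEN L2_measurable]
  \<comment> \<open>The transform is determined only up to a null set; this representative vanishes
    at every nonpositive point.\<close>
  define F where "F \<xi> = (if \<xi> \<le> 0 then 0 else fourier_L2 f \<xi>)" for \<xi>
  have [measurable]: "F \<in> borel_measurable borel" unfolding F_def[abs_def] by measurable
  have "AE \<xi> in lborel. fourier_L2 f \<xi> = F \<xi>"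
    using van AE_lborel_singleton[of 0] by eventually_elim (auto simp: F_def)
  then have pair: "fourier_pair f F"
    by (intro fourier_pair_cong_AE[OF pair0]) auto
  obtain g where weak: "is_weak_deriv_L2 f g"
    using f(2) by (auto simp: H1_def)
  then have "g \<in> L2" by (simp add: is_weak_deriv_L2_def)
  then obtain G where G: "fourier_pair g G"
    using fourier_pair_exists by blast
  have "(\<lambda>\<xi>. \<i> * complex_of_real \<xi> * F \<xi>) \<in> L2"
    by (rule L2_cong_AE[OF fourier_pair_L2(2)[OF G] _ fourier_pair_weak_deriv[OF pair G weak]]) measurable
  then have m2: "integrable lborel (\<lambda>x. x\<^sup>2 * (norm (F x))\<^sup>2)"
    by (simp add: L2_iff norm_mult power_mult_distrib)
  have F2: "F \<in> L2" by (rule fourier_pair_L2(2)[OF pair])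
  have "positive_spectrum F"
  proof
    show "integrable lborel F"
    proof (rule Bochner_Integration.integrable_bound)
      show "integrable lborel (\<lambda>x. (norm (F x))\<^sup>2 + x\<^sup>2 * (norm (F x))\<^sup>2 + 1 / (1 + x\<^sup>2))"
        using F2 m2 integrable_inverse_1_plus_square_lborel by (simp add: L2_iff)
      have "norm (F x) \<le> (norm (F x))\<^sup>2 + x\<^sup>2 * (norm (F x))\<^sup>2 + 1 / (1 + x\<^sup>2)" for x
      proof -
        \<comment> \<open>The arithmetic-geometric inequality for \<open>s * norm (F x)\<close> and
          \<open>1 / s\<close> bounds \<open>norm (F x)\<close> by integrable terms.\<close>
        define s where "s = sqrt (1 + x\<^sup>2)"
        have s: "s\<^sup>2 = 1 + x\<^sup>2" "0 < s" unfolding s_def by (auto simp: add_pos_nonneg)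
        have "2 * (s * norm (F x)) * (1 / s) \<le> (s * norm (F x))\<^sup>2 + (1 / s)\<^sup>2"
          by (rule sum_squares_bound)
        then have "2 * norm (F x) \<le> (1 + x\<^sup>2) * (norm (F x))\<^sup>2 + 1 / (1 + x\<^sup>2)"
          using s by (simp add: power_mult_distrib power_divide)
        then show ?thesis using norm_ge_zero[of "F x"] unfolding distrib_right by linarith
      qed
      then show "AE x in lborel. norm (F x) \<le> norm ((norm (F x))\<^sup>2 + x\<^sup>2 * (norm (F x))\<^sup>2 + 1 / (1 + x\<^sup>2))"
        by (intro AE_I2) (simp add: order_trans[OF _ abs_ge_self])
    qed measurable
  qed (use F2 m2 in \<open>auto simp: F_def\<close>)
  moreover have "\<not> (AE x in lborel. F x = 0)"
    using nz nrm_eq_0_iff[OF f(1)] nrm_eq_0_iff[OF F2] fourier_pair_nrm[OF pair] by auto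
  ultimately show thesis
    using that pair f(2) by blast
qed

text \<open>A minimizer is an arbitrary Borel representative, whereas the classical derivative is
  computed for the explicit rational function; this bridges the two.\<close>

lemma is_weak_deriv_L2_cong_AE:
  assumes weak: "is_weak_deriv_L2 f g" and [measurable]: "f \<in> borel_measurable borel" "f' \<in> borel_measurable borel"
    and AE: "AE x in lborel. f x = f' x"
  shows "is_weak_deriv_L2 f' g"
  unfolding is_weak_deriv_L2_def
proof (intro conjI allI impI)
  show "g \<in> L2" using weak by (simp add: is_weak_deriv_L2_def)
  fix \<phi> assume \<phi>: "test_function \<phi>"
  then obtain D where D: "\<And>x. (\<phi> has_vector_derivative D x) (at x)" "continuous_on UNIV D"
    by (auto simp: test_function_def C1_differentiable_on_def)
  have vd: "vector_derivative \<phi> (at x) = D x" for x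
    using D(1) by (rule vector_derivative_at)
  have [measurable]: "D \<in> borel_measurable borel"
    using D(2) by (rule borel_measurable_continuous_onI)
  have "(LINT x|lborel. f' x * vector_derivative \<phi> (at x)) = (LINT x|lborel. f x * vector_derivative \<phi> (at x))"
    unfolding vd using AE by (intro integral_cong_AE) auto
  then show "(LINT x|lborel. f' x * vector_derivative \<phi> (at x)) = - (LINT x|lborel. g x * \<phi> x)"
    using weak \<phi> by (simp add: is_weak_deriv_L2_def)
qed

text \<open>The spectrum is guessed as a one-sided exponential, and inversion shows that
  \<open>f\<close> is its inverse transform. Membership in the positive-frequency space and the
  value of the functional are then read off the spectrum.\<close>

lemma rational_minimizer:
  fixes lam \<mu> \<theta> y :: real
  assumes pos: "0 < lam" "0 < \<mu>" and [measurable]: "f \<in> borel_measurable lborel"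
    and AE: "AE x in lborel. f x = complex_of_real lam * exp (\<i> * complex_of_real \<theta>) / (complex_of_real (\<mu> * x + y) + \<i>)"
  shows "f \<in> H1_plus_nonzero" "I22 f = 8 * pi\<^sup>2 / 3"
proof -
  define a where "a = complex_of_real lam * exp (\<i> * complex_of_real \<theta>)"
  define f0 where "f0 x = a / (complex_of_real (\<mu> * x + y) + \<i>)" for x
  \<comment> \<open>\<open>\<kappa>\<close> and \<open>c\<close> solve
    \<open>c / (\<kappa> - i * x) = 2 * pi * f0 x\<close>: the factorisation
    \<open>\<kappa> - i * x = - i * (\<mu> * x + y + i) / \<mu>\<close> gives
    \<open>\<kappa> = (1 - i * y) / \<mu>\<close>, and the remaining constants go into
    \<open>c\<close>.\<close>
  define \<kappa> where "\<kappa> = Complex (1 / \<mu>) (- y / \<mu>)"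
  define c where "c = - \<i> * (complex_of_real (2 * pi) * a / complex_of_real \<mu>)"
  have a: "a \<noteq> 0" using pos by (simp add: a_def)
  have den: "complex_of_real t + \<i> \<noteq> 0" for t by (simp add: complex_eq_iff)
  have re: "0 < Re \<kappa>" using pos by (simp add: \<kappa>_def)
  define F where "F x = c * exp_pos \<kappa> x" for x
  have F_eq: "F = (\<lambda>x. c * exp_pos \<kappa> x)" by (simp add: F_def[abs_def])
  interpret positive_spectrum F
    unfolding F_eq by (rule positive_spectrum_exp_pos[OF re])
  have FT_F: "FT F (- x) = complex_of_real (2 * pi) * f0 x" for x
  proof -
    have "FT F (- x) = c / (\<kappa> + \<i> * complex_of_real (- x))"
      unfolding F_eq FT_cmult exp_pos_facts(4)[OF re] by simp
    also have "\<kappa> + \<i> * complex_of_real (- x) = - \<i> * (complex_of_real (\<mu> * x + y) + \<i>) / complex_of_real \<mu>"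
      using pos by (simp add: \<kappa>_def complex_eq_iff field_simps)
    finally show ?thesis
      using pos den[of "\<mu> * x + y"] by (simp add: c_def f0_def)
  qed
  obtain f1 where f1: "fourier_pair f1 F"
    using fourier_pair_surj[OF F_L2] .
  have ff0: "AE x in lborel. f x = f0 x"
    using AE by (simp add: f0_def a_def)
  have "AE x in lborel. f1 x = f x"
    using fourier_pair_inversion_integral[OF f1 F_integrable] ff0 by eventually_elim (simp add: FT_F)
  then have pair: "fourier_pair f F"
    by (intro fourier_pair_cong_AE[OF f1]) auto
  have fL2: "f \<in> L2" by (rule fourier_pair_L2(1)[OF pair])
  have f0cont: "continuous_on UNIV f0"
    unfolding f0_def[abs_def] by (intro continuous_intros ballI den)
  note [measurable] = f0cont[THEN borel_measurable_continuous_onI]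
  have f0L2: "f0 \<in> L2"
    using ff0 by (intro L2_cong_AE[OF fL2]) auto
  define f0' where "f0' x = - (complex_of_real \<mu> * a) / (complex_of_real (\<mu> * x + y) + \<i>)\<^sup>2" for x
  have D: "(f0 has_vector_derivative f0' x) (at x)" for x
  proof -
    have "((\<lambda>z. a / (complex_of_real \<mu> * z + complex_of_real y + \<i>)) has_field_derivative f0' x) (at (complex_of_real x))"
      using den[of "\<mu> * x + y"] by (auto intro!: derivative_eq_intros simp: f0'_def power2_eq_square)
    from has_vector_derivative_real_field[OF this] show ?thesis
      by (simp add: f0_def[abs_def])
  qed
  have f0'cont: "continuous_on UNIV f0'"
    unfolding f0'_def[abs_def] by (intro continuous_intros ballI power_not_zero den)
  have "f0' \<in> L2"
  proof (rule L2_dominated[OF f0L2])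
    show "f0' \<in> borel_measurable borel"
      using f0'cont by (rule borel_measurable_continuous_onI)
    fix x
    let ?d = "complex_of_real (\<mu> * x + y) + \<i>"
    have inv: "1 / t \<le> 1" if "1 \<le> t" for t :: real
      using that by simp
    \<comment> \<open>The denominator has imaginary part 1, so the extra power of it in the
      derivative only helps and \<open>f0\<close> itself dominates.\<close>
    have "1 \<le> norm ?d"
      using abs_Im_le_cmod[of ?d] by simp
    then have "norm a / norm ?d * (1 / norm ?d) \<le> norm a / norm ?d * 1"
      by (intro mult_left_mono inv) auto
    then have "\<mu> * (norm a / norm ?d * (1 / norm ?d)) \<le> \<mu> * (norm a / norm ?d)"
      using pos by (intro mult_left_mono) auto
    then show "norm (f0' x) \<le> \<mu> * norm (f0 x)"
    proof -
      have "norm (f0' x) = \<mu> * (norm a / norm ?d * (1 / norm ?d))"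
        unfolding f0'_def norm_divide norm_minus_cancel norm_mult norm_power norm_of_real power2_eq_square
        using pos by simp
      then show ?thesis
        using \<open>\<mu> * (norm a / norm ?d * (1 / norm ?d)) \<le> _\<close> unfolding f0_def norm_divide by (simp only:)
    qed
  qed
  then have "is_weak_deriv_L2 f0 f0'"
    by (intro is_weak_deriv_L2_classical D f0'cont)
  then have "is_weak_deriv_L2 f f0'"
  proof (rule is_weak_deriv_L2_cong_AE)
    show "AE x in lborel. f0 x = f x" using ff0 by eventually_elim simp
  qed measurable
  then have H1: "f \<in> H1" using fL2 by (auto simp: H1_def)
  have "AE \<xi> in lborel. fourier_L2 f \<xi> = F \<xi>"
    by (rule fourier_L2_AE_eq[OF pair])
  then have "AE \<xi> in lborel. \<xi> < 0 \<longrightarrow> fourier_L2 f \<xi> = 0"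
    by eventually_elim (simp add: F_supp)
  then have plus: "f \<in> H1_plus"
    using H1 fL2 by (simp add: H1_plus_def L2_plus_def)
  have Fnz: "\<not> (AE x in lborel. F x = 0)"
  proof
    assume "AE x in lborel. F x = 0"
    then have "FT F (- 0) = 0"
      unfolding FT_def by (intro integral_eq_zero_AE) (auto elim: eventually_mono)
    then show False
      unfolding FT_F using a den[of y] by (simp add: f0_def)
  qed
  then have "\<not> (AE x in lborel. f x = 0)"
    using nrm_eq_0_iff[OF fL2] nrm_eq_0_iff[OF F_L2] fourier_pair_nrm[OF pair] by auto
  with plus show "f \<in> H1_plus_nonzero"
    by (simp add: H1_plus_nonzero_def)
  show "I22 f = 8 * pi\<^sup>2 / 3"
    using I22_bound(2)[OF Fnz pair H1] exp_pos_equality[OF re, of c, folded F_eq] by simp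
qed

lemma minimizer_rational:
  assumes f: "f \<in> H1_plus_nonzero" and min: "I22 f = 8 * pi\<^sup>2 / 3"
  obtains lam \<mu> \<theta> y :: real where "0 < lam" "0 < \<mu>"
    "AE x in lborel. f x = complex_of_real lam * exp (\<i> * complex_of_real \<theta>) / (complex_of_real (\<mu> * x + y) + \<i>)"
proof -
  obtain F where F: "positive_spectrum F" "fourier_pair f F" "\<not> (AE x in lborel. F x = 0)" "f \<in> H1"
    using H1_plus_spectrum[OF f] .
  interpret positive_spectrum F by (rule F(1))
  have "(nrm H)\<^sup>2 = total / 2"
    using I22_bound(2)[OF F(3,2,4)] min by simp
  then obtain c \<beta> where c: "c \<noteq> 0" "0 < Im \<beta>" "\<And>x. FT F x = c / (complex_of_real x - \<beta>)"
    using equality_imp_rational[OF F(3)] by metis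
  \<comment> \<open>Inversion evaluates the fraction at \<open>- x\<close>, and
    \<open>- x - \<beta> = - b * ((x + Re \<beta>) / b + i)\<close>. Hence
    \<open>\<mu> = 1 / b\<close> and \<open>y = Re \<beta> / b\<close>, while the prefactor
    \<open>a\<close> is split into modulus and argument to give \<open>lam\<close> and
    \<open>\<theta>\<close>.\<close>
  define b where "b = Im \<beta>"
  define a where "a = - c / complex_of_real (2 * pi * b)"
  have b: "0 < b" using c by (simp add: b_def)
  have a: "a \<noteq> 0" using c(1) b by (simp add: a_def)
  have "AE x in lborel. f x = complex_of_real (norm a) * exp (\<i> * complex_of_real (Arg a)) / (complex_of_real (1 / b * x + Re \<beta> / b) + \<i>)"
    using fourier_pair_inversion_integral[OF F(2) F_integrable]
  proof eventually_elim
    fix x assume "f x = FT F (- x) / (2 * pi)"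
    also have "\<dots> = c / (complex_of_real (- x) - \<beta>) / (2 * pi)"
      by (simp only: c(3))
    also have "complex_of_real (- x) - \<beta> = - complex_of_real b * (complex_of_real (1 / b * x + Re \<beta> / b) + \<i>)"
      using b by (simp add: complex_eq_iff b_def field_simps)
    also have "c / (- complex_of_real b * (complex_of_real (1 / b * x + Re \<beta> / b) + \<i>)) / (2 * pi)
        = a / (complex_of_real (1 / b * x + Re \<beta> / b) + \<i>)"
      by (simp add: a_def)
    also have "a = complex_of_real (norm a) * exp (\<i> * complex_of_real (Arg a))"
      using rcis_cmod_Arg[of a] by (simp add: rcis_def cis_conv_exp)
    finally show "f x = complex_of_real (norm a) * exp (\<i> * complex_of_real (Arg a)) / (complex_of_real (1 / b * x + Re \<beta> / b) + \<i>)" .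
  qed
  then show thesis
    using that[of "norm a" "1 / b" "Arg a" "Re \<beta> / b"] a b by simp
qed

theorem proposition1p7:
  "(\<exists>f\<in>H1_plus_nonzero. I22 f = J22 \<and> (\<forall>g\<in>H1_plus_nonzero. I22 f \<le> I22 g)) \<and>
   J22 = 8 * pi\<^sup>2 / 3 \<and>
   G22 = {f \<in> borel_measurable lborel.
            \<exists>lam \<mu> \<theta> y :: real. lam > 0 \<and> \<mu> > 0 \<and>
              (AE x in lborel. f x =
                 complex_of_real lam * exp (\<i> * complex_of_real \<theta>)
                   / (complex_of_real (\<mu> * x + y) + \<i>))}"
proof -
  have lower: "8 * pi\<^sup>2 / 3 \<le> I22 f" if "f \<in> H1_plus_nonzero" for f
    using H1_plus_spectrum[OF that] positive_spectrum.I22_bound(1) by metis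
  define f0 where "f0 x = complex_of_real 1 * exp (\<i> * complex_of_real 0) / (complex_of_real (1 * x + 0) + \<i>)" for x :: real
  have [measurable]: "f0 \<in> borel_measurable lborel"
    unfolding f0_def[abs_def] by measurable
  have f0: "f0 \<in> H1_plus_nonzero" "I22 f0 = 8 * pi\<^sup>2 / 3"
    by (rule rational_minimizer[of 1 1 f0 0 0]; simp add: f0_def)+
  have J: "J22 = 8 * pi\<^sup>2 / 3"
    unfolding J22_def
  \<comment> \<open>The infimum of a set of reals is meaningful only for a nonempty set bounded
    below; an attained lower bound settles both at once.\<close>
  proof (rule cInf_eq_minimum)
    show "8 * pi\<^sup>2 / 3 \<in> I22 ` H1_plus_nonzero"
      by (rule image_eqI[of _ I22 f0]) (simp_all only: f0)
    show "8 * pi\<^sup>2 / 3 \<le> z" if "z \<in> I22 ` H1_plus_nonzero" for z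
      using that by (rule imageE) (simp only: lower)
  qed
  have "G22 = {f \<in> borel_measurable lborel.
            \<exists>lam \<mu> \<theta> y :: real. lam > 0 \<and> \<mu> > 0 \<and>
              (AE x in lborel. f x =
                 complex_of_real lam * exp (\<i> * complex_of_real \<theta>)
                   / (complex_of_real (\<mu> * x + y) + \<i>))}" (is "_ = ?R")
  proof (intro set_eqI iffI)
    fix f assume "f \<in> G22"
    then have f: "f \<in> H1_plus_nonzero" "I22 f = 8 * pi\<^sup>2 / 3"
      by (simp_all add: G22_def J)
    have "f \<in> borel_measurable lborel"
      using f(1) by (simp add: H1_plus_nonzero_def H1_plus_def L2_plus_def L2_iff)
    moreover obtain lam \<mu> \<theta> y :: real where "0 < lam" "0 < \<mu>"
      "AE x in lborel. f x = complex_of_real lam * exp (\<i> * complex_of_real \<theta>) / (complex_of_real (\<mu> * x + y) + \<i>)"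
      using minimizer_rational[OF f] .
    ultimately show "f \<in> ?R"
      by (intro CollectI conjI exI)
  next
    fix f assume "f \<in> ?R"
    then obtain lam \<mu> \<theta> y :: real where "0 < lam" "0 < \<mu>" "f \<in> borel_measurable lborel"
      "AE x in lborel. f x = complex_of_real lam * exp (\<i> * complex_of_real \<theta>) / (complex_of_real (\<mu> * x + y) + \<i>)"
      by blast
    from rational_minimizer[OF this] show "f \<in> G22"
      by (simp add: G22_def J)
  qed
  moreover have "\<exists>f\<in>H1_plus_nonzero. I22 f = J22 \<and> (\<forall>g\<in>H1_plus_nonzero. I22 f \<le> I22 g)"
    by (intro bexI[of _ f0] conjI ballI) (simp_all only: f0 J lower)
  ultimately show ?thesis
    using J by blast
qed

end
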